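(* Assume the Riemann Hypothesis and assume that $1/\zeta'(\tfrac12+i\gamma) = O(\gamma)$ for all positive zeros $\gamma$ of Hardy's $Z$-function. Let $\gamma_1<\gamma_2<\dots$ be the positive zeros of $Z$, and let $u_n\in(\gamma_n,\gamma_{n+1})$ be the $n$-th stationary point of $Z$, i.e. the unique zero of $Z'$ in $(\gamma_n,\gamma_{n+1})$. Put \[ \alpha_n = \frac{u_n-\gamma_n}{\gamma_{n+1}-\gamma_n}, \qquad \mathcal{I}_t = \left[t - \frac{1}{\log\log t},\ t+\frac{1}{\log\log t}\right] \ (t>e). \] If the set \[ \mathscr{Z} = \left\{ n\ge 2 : \gamma_{n+1}-\gamma_n < \frac{1}{\log \gamma_n},\ \{u_{n-1},u_{n+1}\}\not\subset \mathcal{I}_{\gamma_n}\cup\mathcal{I}_{\gamma_{n+1}},\ \alpha_n\in[0.44,0.56]\right\} \] is infinite, then the de Bruijn–Newman constant $\Lambda$ equals $0$.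
   Context: Hardy's $Z$-function is $Z(t) = e^{i\vartheta(t)}\zeta(\tfrac12 + it)$, where $\vartheta(t) = \frac{1}{2i}\log\frac{\Gamma(\frac14 + i\frac t2)}{\Gamma(\frac14 - i\frac t2)} - \frac{\log \pi}{2} t$. Under the Riemann Hypothesis, all zeros of $Z'$ in the right half-plane are real, and between any two consecutive zeros of $Z$ there is exactly one zero of $Z'$ (these are the stationary points $u_n$). The de Bruijn–Newman constant $\Lambda$ is the unique real number such that $H_\lambda(z)=\int_0^\infty e^{\lambda u^2}\Phi(u)\cos(zu)\,du$, with $\Phi(u)=\sum_{n\ge1}(2\pi^2n^4e^{9u}-3\pi n^2e^{5u})e^{-\pi n^2e^{4u}}$, has only real zeros if and only if $\lambda\ge\Lambda$; the Riemann Hypothesis is equivalent to $\Lambda\le 0$. *)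

theory Defs
  imports "HOL-Complex_Analysis.Complex_Analysis"
begin

section \<open>The Riemann zeta function\<close>

(* The analytic continuation of the Dirichlet series to the plane without 1.  Existence and
   uniqueness are riemann_zeta_ex1 below; the value at the pole 1 is a convention. *)
definition riemann_zeta :: "complex \<Rightarrow> complex" where
  "riemann_zeta = (THE f. f holomorphic_on (- {1}) \<and>
     (\<forall>s. Re s > 1 \<longrightarrow> (\<lambda>n. of_nat (Suc n) powr (- s)) sums f s) \<and> f 1 = 0)"

lemma powr_taylor_bound:
  fixes a :: complex and x R :: real
  assumes x: "0 \<le> x" "x \<le> 1" and a: "cmod a \<le> R"
  shows "cmod ((1 + of_real x) powr a - (\<Sum>j\<le>K. (a gchoose j) * of_real x ^ j))
           \<le> ((R + K) ^ Suc K * 2 powr R) * x ^ Suc K"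
proof -
  define f :: "nat \<Rightarrow> complex \<Rightarrow> complex"
    where "f = (\<lambda>i w. (\<Prod>l=0..<i. a - of_nat l) * (1 + w) powr (a - of_nat i))"
  let ?S = "closed_segment 0 (of_real x) :: complex set"
  let ?B = "(R + K) ^ Suc K * 2 powr R"
  have R0: "R \<ge> 0" using a norm_ge_zero[of a] by linarith
  have S: "\<exists>u. z = of_real u \<and> 0 \<le> u \<and> u \<le> 1" if "z \<in> ?S" for z
  proof -
    have "z \<in> of_real ` closed_segment 0 x"
      using that closed_segment_of_real[of 0 x, where ?'a=complex] by simp
    then show ?thesis using x by (auto simp: closed_segment_eq_real_ivl)
  qed
  have "cmod (f 0 (of_real x) - (\<Sum>i\<le>K. f i 0 * (of_real x - 0) ^ i / fact i))
          \<le> ?B * cmod (of_real x - 0) ^ Suc K / fact K"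
  proof (rule complex_Taylor[where S = ?S])
    fix i z assume "z \<in> ?S" "i \<le> K"
    then obtain u where u: "z = of_real u" "0 \<le> u" using S by blast
    have nz: "1 + z \<notin> \<real>\<^sub>\<le>\<^sub>0" using u by (auto simp: complex_nonpos_Reals_iff)
    have "(f i has_field_derivative f (Suc i) z) (at z)"
      unfolding f_def using nz
      by (auto intro!: derivative_eq_intros simp: algebra_simps)
    then show "(f i has_field_derivative f (Suc i) z) (at z within ?S)"
      by (rule has_field_derivative_at_within)
  next
    fix z assume "z \<in> ?S"
    then obtain u where u: "z = of_real u" "0 \<le> u" "u \<le> 1" using S by blast
    have "cmod (\<Prod>l=0..<Suc K. a - of_nat l) \<le> (\<Prod>l=0..<Suc K. R + K)"
      unfolding prod_norm[symmetric]
    proof (intro prod_mono conjI norm_ge_zero)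
      fix l assume "l \<in> {0..<Suc K}"
      have "cmod (a - of_nat l) \<le> cmod a + cmod (of_nat l)" by (rule norm_triangle_ineq4)
      then show "cmod (a - of_nat l) \<le> R + K"
        using a \<open>l \<in> {0..<Suc K}\<close> by simp
    qed
    moreover have "cmod ((1 + z) powr (a - of_nat (Suc K))) \<le> 2 powr R"
    proof -
      have "1 + z = of_real (1 + u)" using u by simp
      then have "cmod ((1 + z) powr (a - of_nat (Suc K))) = (1 + u) powr (Re a - Suc K)"
        using u by (subst norm_powr_real_powr) auto
      also have "\<dots> \<le> (1 + u) powr R"
        using u a complex_Re_le_cmod[of a] by (intro powr_mono) auto
      also have "\<dots> \<le> 2 powr R" using u R0 by (intro powr_mono2) auto
      finally show ?thesis .
    qed
    ultimately show "cmod (f (Suc K) z) \<le> ?B"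
      unfolding f_def norm_mult using R0 by (intro mult_mono) (auto intro: zero_le_power)
  qed auto
  also have "\<dots> \<le> ?B * x ^ Suc K"
  proof -
    have "?B * x ^ Suc K / fact K \<le> ?B * x ^ Suc K / 1"
      using R0 x by (intro divide_left_mono) (auto intro: fact_ge_1)
    then show ?thesis using x by (simp add: norm_power)
  qed
  also have "f 0 (of_real x) - (\<Sum>i\<le>K. f i 0 * (of_real x - 0) ^ i / fact i)
    = (1 + of_real x) powr a - (\<Sum>j\<le>K. (a gchoose j) * of_real x ^ j)"
    by (simp add: f_def gbinomial_prod_rev)
  finally show ?thesis .
qed

(* The terms of the expansion of (n + 2) powr (1 - s) in powers of n + 1, truncated after K
   steps.  Summing over n telescopes the leading part and relates zeta at s to its values at
   s + 1, s + 2, ...; this continues the Dirichlet series one unit to the left at a time. *)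
definition zt :: "nat \<Rightarrow> nat \<Rightarrow> complex \<Rightarrow> complex" where
  "zt K n s = of_nat (Suc (Suc n)) powr (1 - s)
     - (\<Sum>j\<le>K. ((1 - s) gchoose j) * of_nat (Suc n) powr (1 - s - of_nat j))"

lemma zt_bound:
  assumes "cmod (1 - s) \<le> R"
  shows "cmod (zt K n s) \<le> ((R + K) ^ Suc K * 2 powr R) * real (Suc n) powr (- Re s - K)"
proof -
  let ?N = "of_nat (Suc n) :: complex"
  define x where "x = 1 / real (Suc n)"
  have N: "?N = of_real (real (Suc n))" by simp
  have NN: "of_nat (Suc (Suc n)) = of_real (real (Suc n)) * (of_real (1 + x) :: complex)"
  proof -
    have "real (Suc (Suc n)) = real (Suc n) * (1 + x)" by (simp add: x_def field_simps)
    then show ?thesis by (metis of_real_mult of_real_of_nat_eq)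
  qed
  have 1: "(of_nat (Suc (Suc n)) :: complex) powr (1 - s) = ?N powr (1 - s) * (1 + of_real x) powr (1 - s)"
    unfolding NN by (subst powr_times_real) (auto simp: x_def)
  have 2: "?N powr (1 - s - of_nat j) = ?N powr (1 - s) * of_real x ^ j" for j
  proof -
    have "?N powr (1 - s - of_nat j) = ?N powr (1 - s) / ?N powr of_nat j"
      by (rule powr_diff)
    also have "?N powr of_nat j = ?N ^ j"
      by (rule powr_nat') (simp del: of_nat_Suc)
    finally show ?thesis by (simp add: x_def power_divide)
  qed
  have "zt K n s = ?N powr (1 - s) *
      ((1 + of_real x) powr (1 - s) - (\<Sum>j\<le>K. ((1 - s) gchoose j) * of_real x ^ j))"
    unfolding zt_def 1 2 by (simp add: algebra_simps sum_distrib_left)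
  moreover have "cmod (?N powr (1 - s)) = real (Suc n) powr (1 - Re s)"
    unfolding N by (subst norm_powr_real_powr) auto
  ultimately have "cmod (zt K n s) \<le> real (Suc n) powr (1 - Re s) * (((R + K) ^ Suc K * 2 powr R) * x ^ Suc K)"
    using powr_taylor_bound[of x "1 - s" R K] assms
    by (simp only: norm_mult) (intro mult_left_mono, auto simp: x_def)
  also have "x ^ Suc K = real (Suc n) powr (- real (Suc K))"
    unfolding x_def by (subst powr_minus, subst powr_realpow) (auto simp: field_simps)
  also have "real (Suc n) powr (1 - Re s) * (((R + K) ^ Suc K * 2 powr R) * real (Suc n) powr (- real (Suc K)))
     = ((R + K) ^ Suc K * 2 powr R) * (real (Suc n) powr (1 - Re s) * real (Suc n) powr (- real (Suc K)))"
    by (simp only: mult_ac)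
  also have "real (Suc n) powr (1 - Re s) * real (Suc n) powr (- real (Suc K)) = real (Suc n) powr (- Re s - K)"
    by (simp only: powr_add[symmetric]) (simp add: algebra_simps)
  finally show ?thesis .
qed

lemma summable_Suc_powr: "e < -1 \<Longrightarrow> summable (\<lambda>n. real (Suc n) powr e)"
  using summable_real_powr_iff[of e] summable_Suc_iff[of "\<lambda>n. real n powr e"] by simp

lemma zt_suminf:
  shows "(\<lambda>s. \<Sum>n. zt K n s) holomorphic_on {s. Re s > 1 - real K}"
    and "Re s > 1 - real K \<Longrightarrow> summable (\<lambda>n. zt K n s)"
proof -
  have ul: "uniform_limit (cball s d) (\<lambda>n w. \<Sum>i<n. zt K i w) (\<lambda>w. \<Sum>i. zt K i w) sequentially
         \<and> summable (\<lambda>n. zt K n s)"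
    if "d > 0" "Re s - d > 1 - real K" for s d
  proof -
    define R where "R = cmod (1 - s) + d"
    define M where "M = (\<lambda>n. ((R + K) ^ Suc K * 2 powr R) * real (Suc n) powr (- (Re s - d) - K))"
    have M: "summable M" unfolding M_def
      using that by (intro summable_mult summable_Suc_powr) auto
    have le: "cmod (zt K n w) \<le> M n" if w: "w \<in> cball s d" for n w
    proof -
      have d: "cmod (s - w) \<le> d" using w by (simp add: dist_norm)
      have "cmod (1 - w) \<le> cmod (1 - s) + cmod (s - w)"
        by (metis diff_add_cancel add_diff_eq norm_triangle_ineq)
      then have "cmod (1 - w) \<le> R" using d by (simp add: R_def)
      from zt_bound[OF this, of K n] have "cmod (zt K n w) \<le> ((R + K) ^ Suc K * 2 powr R) * real (Suc n) powr (- Re w - K)" .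
      also have "\<dots> \<le> M n" unfolding M_def
      proof (rule mult_left_mono)
        have "Re s - Re w \<le> d" using d complex_Re_le_cmod[of "s - w"] by simp
        then show "real (Suc n) powr (- Re w - K) \<le> real (Suc n) powr (- (Re s - d) - K)"
          by (intro powr_mono) auto
        show "0 \<le> (R + K) ^ Suc K * 2 powr R" using \<open>d > 0\<close> by (simp add: R_def)
      qed
      finally show ?thesis .
    qed
    have "summable (\<lambda>n. zt K n s)"
      using le[of s] that by (intro summable_comparison_test'[OF M, of 0]) auto
    then show ?thesis using Weierstrass_m_test[of "cball s d" "zt K" M] le M by blast
  qed
  have d: "\<exists>d>0. Re s - d > 1 - real K" if "Re s > 1 - real K" for s
    using that by (intro exI[of _ "(Re s - (1 - real K)) / 2"]) (auto simp: field_simps)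
  show "Re s > 1 - real K \<Longrightarrow> summable (\<lambda>n. zt K n s)" using d[of s] ul by blast
  show "(\<lambda>s. \<Sum>n. zt K n s) holomorphic_on {s. Re s > 1 - real K}"
  proof (rule holomorphic_uniform_sequence)
    show "open {s. Re s > 1 - real K}" by (rule open_halfspace_Re_gt)
    show "(\<lambda>w. \<Sum>i<n. zt K i w) holomorphic_on {s. Re s > 1 - real K}" for n
      unfolding zt_def gbinomial_prod_rev by (intro holomorphic_intros) auto
    fix s assume "s \<in> {s. Re s > 1 - real K}"
    then obtain d where d: "d > 0" "Re s - d > 1 - real K" using d by auto
    have "cball s d \<subseteq> {s. Re s > 1 - real K}"
    proof
      fix w assume "w \<in> cball s d"
      then have "Re s - Re w \<le> d" using complex_Re_le_cmod[of "s - w"] by (simp add: dist_norm)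
      then show "w \<in> {s. Re s > 1 - real K}" using d by simp
    qed
    with d ul show "\<exists>d. 0 < d \<and> cball s d \<subseteq> {s. Re s > 1 - real K} \<and>
        uniform_limit (cball s d) (\<lambda>n w. \<Sum>i<n. zt K i w) (\<lambda>s. \<Sum>n. zt K n s) sequentially" by blast
  qed
qed


abbreviation (input) dz :: "complex \<Rightarrow> complex" where
  "dz s \<equiv> (\<Sum>n. of_nat (Suc n) powr (- s))"

lemma dz_summable: "Re s > 1 \<Longrightarrow> summable (\<lambda>n. of_nat (Suc n) powr (- s) :: complex)"
proof (rule summable_norm_cancel)
  assume "Re s > 1"
  then have "summable (\<lambda>n. real (Suc n) powr (- Re s))" by (intro summable_Suc_powr) auto
  moreover have "cmod (of_nat (Suc n) powr (- s)) = real (Suc n) powr (- Re s)" for n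
    by (subst norm_powr_real_powr) auto
  ultimately show "summable (\<lambda>n. cmod (of_nat (Suc n) powr (- s)))" by simp
qed

lemma dz_recursion:
  assumes s: "Re s > 1"
  shows "(s - 1) * dz s = 1 + (\<Sum>n. zt (Suc m) n s)
    - (\<Sum>i<m. ((1 - s) gchoose Suc i) / of_nat (i + 2) * ((s + of_nat i) * dz (s + of_nat i + 1)))"
proof -
  define f :: "nat \<Rightarrow> nat \<Rightarrow> complex" where
    "f = (\<lambda>j n. ((1 - s) gchoose j) * of_nat (Suc n) powr (1 - s - of_nat j))"
  have f: "f (Suc i) sums (((1 - s) gchoose Suc i) * dz (s + of_nat i))" for i
  proof -
    have "(\<lambda>n. of_nat (Suc n) powr (- (s + of_nat i)) :: complex) sums dz (s + of_nat i)"
      by (rule summable_sums, rule dz_summable) (use s in simp)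
    from sums_mult[OF this, of "(1 - s) gchoose Suc i"] show ?thesis
      by (simp add: f_def algebra_simps)
  qed
  have tele: "(\<lambda>n. of_nat (Suc (Suc n)) powr (1 - s) - of_nat (Suc n) powr (1 - s) :: complex) sums (0 - 1)"
  proof -
    have "(\<lambda>n. of_nat (Suc n) powr (1 - s) :: complex) \<longlonglongrightarrow> 0"
    proof (rule tendsto_norm_zero_cancel)
      have "(\<lambda>n. real (Suc n) powr (1 - Re s)) \<longlonglongrightarrow> 0"
        using s by (intro tendsto_neg_powr filterlim_compose[OF filterlim_real_sequentially filterlim_Suc]) auto
      moreover have "cmod (of_nat (Suc n) powr (1 - s)) = real (Suc n) powr (1 - Re s)" for n
        by (subst norm_powr_real_powr) auto
      ultimately show "(\<lambda>n. cmod (of_nat (Suc n) powr (1 - s))) \<longlonglongrightarrow> 0" by simp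
    qed
    from telescope_sums[OF this] show ?thesis by simp
  qed
  have "(\<lambda>n. zt (Suc m) n s) = (\<lambda>n. of_nat (Suc (Suc n)) powr (1 - s) - of_nat (Suc n) powr (1 - s)
      - (\<Sum>i\<le>m. f (Suc i) n))"
    by (auto simp: zt_def f_def sum.atMost_Suc_shift simp del: of_nat_Suc sum.atMost_Suc)
  moreover have "\<dots> sums (0 - 1 - (\<Sum>i\<le>m. ((1 - s) gchoose Suc i) * dz (s + of_nat i)))"
    by (intro sums_diff tele sums_sum f)
  ultimately have "(\<Sum>n. zt (Suc m) n s) = - 1 - (\<Sum>i\<le>m. ((1 - s) gchoose Suc i) * dz (s + of_nat i))"
    by (simp add: sums_iff)
  also have "(\<Sum>i\<le>m. ((1 - s) gchoose Suc i) * dz (s + of_nat i)) =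
      (1 - s) * dz s + (\<Sum>i<m. ((1 - s) gchoose Suc (Suc i)) * dz (s + of_nat i + 1))"
    by (simp add: lessThan_Suc_atMost[symmetric] sum.lessThan_Suc_shift add_ac diff_diff_eq
             del: sum.lessThan_Suc)
  also have "(\<Sum>i<m. ((1 - s) gchoose Suc (Suc i)) * dz (s + of_nat i + 1)) =
      - (\<Sum>i<m. ((1 - s) gchoose Suc i) / of_nat (i + 2) * ((s + of_nat i) * dz (s + of_nat i + 1)))"
    unfolding sum_negf[symmetric]
  proof (rule sum.cong[OF refl])
    fix i
    have "of_nat (Suc (Suc i)) * ((1 - s) gchoose Suc (Suc i)) = ((1 - s) gchoose Suc i) * (1 - s - of_nat (Suc i))"
      using gbinomial_mult_1[of "1 - s" "Suc i"]
      by (metis add_diff_cancel_left' left_diff_distrib mult.commute)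
    then have eq: "of_nat (i + 2) * ((1 - s) gchoose Suc (Suc i)) = - (((1 - s) gchoose Suc i) * (s + of_nat i))"
      by (simp add: eq_neg_iff_add_eq_0 algebra_simps)
    have nz: "of_nat (i + 2) \<noteq> (0::complex)" by (subst of_nat_eq_0_iff) simp
    have "((1 - s) gchoose Suc (Suc i)) = of_nat (i + 2) * ((1 - s) gchoose Suc (Suc i)) / of_nat (i + 2)"
      by (rule nonzero_mult_div_cancel_left[OF nz, symmetric])
    also have "\<dots> = - (((1 - s) gchoose Suc i) / of_nat (i + 2) * (s + of_nat i))"
      unfolding eq by simp
    finally have "((1 - s) gchoose Suc (Suc i)) = - (((1 - s) gchoose Suc i) / of_nat (i + 2) * (s + of_nat i))" .
    then show "((1 - s) gchoose Suc (Suc i)) * dz (s + of_nat i + 1)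
       = - (((1 - s) gchoose Suc i) / of_nat (i + 2) * ((s + of_nat i) * dz (s + of_nat i + 1)))"
      by (simp only: mult_minus_left mult.assoc)
  qed
  finally show ?thesis by (simp add: algebra_simps)
qed

lemma dz_halfplane:
  "\<exists>g. g holomorphic_on {s. Re s > - real k} \<and> (\<forall>s. Re s > 1 \<longrightarrow> g s = (s - 1) * dz s)"
proof (induction k)
  case 0
  have "(\<lambda>s. 1 + (\<Sum>n. zt (Suc 0) n s)) holomorphic_on {s. Re s > - real 0}"
    using zt_suminf(1)[of "Suc 0"] by (intro holomorphic_intros) auto
  then show ?case using dz_recursion[of _ 0] by (intro exI conjI) auto
next
  case (Suc k)
  then obtain g where g: "g holomorphic_on {s. Re s > - real k}"
    "\<And>s. Re s > 1 \<Longrightarrow> g s = (s - 1) * dz s" by blast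
  let ?h = "\<lambda>s. 1 + (\<Sum>n. zt (Suc (Suc k)) n s)
    - (\<Sum>i<Suc k. ((1 - s) gchoose Suc i) / of_nat (i + 2) * g (s + of_nat i + 1))"
  have "(\<lambda>s. g (s + of_nat i + 1)) holomorphic_on {s. Re s > - real (Suc k)}" for i
    by (rule holomorphic_on_compose_gen[OF _ g(1), unfolded o_def, of "\<lambda>s. s + of_nat i + 1"])
       (auto intro!: holomorphic_intros)
  moreover have "(\<lambda>s. \<Sum>n. zt (Suc (Suc k)) n s) holomorphic_on {s. Re s > - real (Suc k)}"
    using zt_suminf(1)[of "Suc (Suc k)"] by simp
  ultimately have "?h holomorphic_on {s. Re s > - real (Suc k)}"
    unfolding gbinomial_prod_rev by (intro holomorphic_intros) auto
  moreover have "?h s = (s - 1) * dz s" if "Re s > 1" for s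
    unfolding dz_recursion[OF that, of "Suc k"] using that by (simp add: g(2) del: sum.lessThan_Suc)
  ultimately show ?case by (intro exI[of _ ?h]) auto
qed

lemma zeta_minus_pole_entire: "\<exists>G. G holomorphic_on UNIV \<and> (\<forall>s. Re s > 1 \<longrightarrow> G s = (s - 1) * dz s)"
proof -
  obtain g where g: "\<And>k. g k holomorphic_on {s. Re s > - real k}"
    "\<And>k s. Re s > 1 \<Longrightarrow> g k s = (s - 1) * dz s" using dz_halfplane by metis
  have eq: "g k s = g l s" if "Re s > - real k" "k \<le> l" for k l s
  proof (rule analytic_continuation_open[of "{s. Re s > 1}" "{s. Re s > - real k}" "g k" "g l"])
    show "{s. Re s > 1} \<noteq> {}" by (auto intro!: exI[of _ 2])
    show "connected {s. Re s > - real k}" by (intro convex_connected convex_halfspace_Re_gt)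
    show "g l holomorphic_on {s. Re s > - real k}"
      using that by (intro holomorphic_on_subset[OF g(1)]) auto
  qed (use g that in \<open>auto intro: open_halfspace_Re_gt\<close>)
  define G where "G = (\<lambda>s. g (nat \<lceil>- Re s\<rceil> + 1) s)"
  have G: "G s = g k s" if "Re s > - real k" for s k
  proof -
    let ?l = "nat \<lceil>- Re s\<rceil> + 1"
    have "Re s > - real ?l" by linarith
    then show ?thesis unfolding G_def using eq[of k s ?l] eq[of ?l s k] that by (metis nle_le)
  qed
  have "G holomorphic_on (\<Union>k. {s. Re s > - real k})"
  proof (rule holomorphic_on_UN_open)
    show "G holomorphic_on {s. Re s > - real k}" for k
      by (rule holomorphic_transform[OF g(1)]) (simp add: G)
    show "open {s. Re s > - real k}" for k by (rule open_halfspace_Re_gt)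
  qed
  moreover have "(\<Union>k. {s. Re s > - real k}) = UNIV"
  proof (intro equalityI subsetI UNIV_I)
    fix s :: complex
    obtain k where "- Re s < real k" using reals_Archimedean2 by blast
    then show "s \<in> (\<Union>k. {s. Re s > - real k})" by (auto intro!: exI[of _ k])
  qed
  moreover have "G s = (s - 1) * dz s" if "Re s > 1" for s
    using G[of 0 s] g(2)[of s 0] that by simp
  ultimately show ?thesis by auto
qed

lemma riemann_zeta_ex1:
  "\<exists>!f. f holomorphic_on (- {1}) \<and> (\<forall>s. Re s > 1 \<longrightarrow> (\<lambda>n. of_nat (Suc n) powr (- s)) sums f s) \<and> f 1 = (0::complex)"
proof (rule ex_ex1I)
  obtain G where G: "G holomorphic_on UNIV" "\<And>s. Re s > 1 \<Longrightarrow> G s = (s - 1) * dz s"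
    using zeta_minus_pole_entire by blast
  have "(\<lambda>s. G s / (s - 1)) holomorphic_on (- {1})"
    by (intro holomorphic_intros holomorphic_on_subset[OF G(1)]) auto
  moreover have "(\<lambda>n. of_nat (Suc n) powr (- s)) sums (G s / (s - 1))" if "Re s > 1" for s
  proof -
    have "s \<noteq> 1" using that by auto
    then have "G s / (s - 1) = dz s" using G(2)[OF that] by simp
    then show ?thesis using summable_sums[OF dz_summable[OF that]] by simp
  qed
  ultimately show "\<exists>f. f holomorphic_on (- {1}) \<and>
      (\<forall>s. Re s > 1 \<longrightarrow> (\<lambda>n. of_nat (Suc n) powr (- s)) sums f s) \<and> f 1 = (0::complex)"
    by (intro exI[of _ "\<lambda>s. G s / (s - 1)"]) auto
next
  fix f h :: "complex \<Rightarrow> complex"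
  assume f: "f holomorphic_on (- {1}) \<and> (\<forall>s. Re s > 1 \<longrightarrow> (\<lambda>n. of_nat (Suc n) powr (- s)) sums f s) \<and> f 1 = 0"
     and h: "h holomorphic_on (- {1}) \<and> (\<forall>s. Re s > 1 \<longrightarrow> (\<lambda>n. of_nat (Suc n) powr (- s)) sums h s) \<and> h 1 = 0"
  have "f s = h s" if "s \<noteq> 1" for s
  proof (rule analytic_continuation_open[of "{s. Re s > 1}" "- {1}" f h])
    show "{s. Re s > 1} \<noteq> {}" by (auto intro!: exI[of _ 2])
    show "connected (- {1::complex})" by (rule connected_punctured_universe) simp
  qed (use f h that in \<open>auto intro: open_halfspace_Re_gt sums_unique2\<close>)
  then show "f = h" using f h by (metis ext)
qed

lemma
  shows riemann_zeta_holomorphic: "riemann_zeta holomorphic_on (- {1})"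
    and riemann_zeta_sums: "Re s > 1 \<Longrightarrow> (\<lambda>n. of_nat (Suc n) powr (- s)) sums riemann_zeta s"
    and riemann_zeta_1: "riemann_zeta 1 = 0"
  using theI'[OF riemann_zeta_ex1, folded riemann_zeta_def] by auto

definition riemann_hypothesis :: bool where
  "riemann_hypothesis \<longleftrightarrow>
     (\<forall>s. 0 < Re s \<and> Re s < 1 \<and> riemann_zeta s = 0 \<longrightarrow> Re s = 1 / 2)"

section \<open>Hardy's Z-function\<close>

(* The logarithm of the Gamma quotient is the branch continuous in z with value 0 at z = 0:
   ln_Gamma is holomorphic off the non-positive real axis and real on the positive one. *)
definition hardy_theta :: "complex \<Rightarrow> complex" where
  "hardy_theta z =
     1 / (2 * \<i>) * (ln_Gamma (1 / 4 + \<i> * z / 2) - ln_Gamma (1 / 4 - \<i> * z / 2))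
       - of_real (ln pi) / 2 * z"

definition hardy_Z :: "complex \<Rightarrow> complex" where
  "hardy_Z z = exp (\<i> * hardy_theta z) * riemann_zeta (1 / 2 + \<i> * z)"

definition hardy_Z_pos_zeros :: "real set" where
  "hardy_Z_pos_zeros = {t. 0 < t \<and> hardy_Z (of_real t) = 0}"

(* Non-vanishing of the derivative is part of the assumption 1 / zeta'(1/2 + i t) = O(t);
   it is stated separately because 1 / 0 = 0 here. *)
definition zeta_deriv_recip_bound :: bool where
  "zeta_deriv_recip_bound \<longleftrightarrow>
     (\<exists>C. \<forall>t\<in>hardy_Z_pos_zeros.
        deriv riemann_zeta (1 / 2 + \<i> * of_real t) \<noteq> 0 \<and>
        cmod (1 / deriv riemann_zeta (1 / 2 + \<i> * of_real t)) \<le> C * t)"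

definition loglog_interval :: "real \<Rightarrow> real set" where
  "loglog_interval t = {t - 1 / ln (ln t) .. t + 1 / ln (ln t)}"

section \<open>The de Bruijn--Newman constant\<close>

definition newman_Phi :: "real \<Rightarrow> real" where
  "newman_Phi u = (\<Sum>k. let n = real (Suc k) in
     (2 * pi\<^sup>2 * n ^ 4 * exp (9 * u) - 3 * pi * n\<^sup>2 * exp (5 * u)) * exp (- pi * n\<^sup>2 * exp (4 * u)))"

definition newman_H :: "real \<Rightarrow> complex \<Rightarrow> complex" where
  "newman_H l z =
     (LBINT u:{0..}. of_real (exp (l * u\<^sup>2) * newman_Phi u) * cos (z * of_real u))"

definition de_bruijn_newman :: real where
  "de_bruijn_newman =
     (THE L. \<forall>l. (\<forall>z. newman_H l z = 0 \<longrightarrow> z \<in> \<real>) \<longleftrightarrow> L \<le> l)"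

end

theory Submission
  imports Defs "HOL-Probability.Probability" "HOL-Real_Asymp.Real_Asymp"
begin

text \<open>
  Under the Riemann Hypothesis, \<open>H\<^sub>\<lambda>\<close> has only real zeros if and only if \<open>\<lambda> \<ge> 0\<close>.

  For \<open>\<lambda> \<ge> 0\<close> this is de Bruijn's theorem.  The Riemann Hypothesis says that \<open>H\<^sub>0\<close>, a rescaled completed
  zeta function, has only real zeros.  An even entire function of small growth with only real zeros grows in
  modulus with the distance to the real axis, so multiplying its kernel by \<open>cosh (c u)\<close>, that is, averaging
  its vertical shifts by \<open>\<plusminus> i c\<close>, keeps the zeros real.  Finally \<open>exp (\<lambda> u\<^sup>2)\<close> is a limit of powers of such
  factors.

  For \<open>\<lambda> = - a < 0\<close> this is Dobner's argument.  Writing \<open>\<Phi>\<close> as a sum over \<open>n\<close> of translates by \<open>ln n / 2\<close> of one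
  function \<open>\<phi>\<close> turns \<open>H\<^sub>\<lambda>\<close> into a series of Fourier integrals of \<open>\<phi>\<close>, and the saddle point method shows
  that near a suitable curve in the lower half-plane \<open>H\<^sub>\<lambda>\<close> is asymptotic, after normalisation, to
  the entire Dirichlet series \<open>F(w) = \<Sum> n powr (- 1 / 2 - w) * exp (- a / 4 * (ln n)\<^sup>2)\<close>.  The function \<open>F\<close>
  has order at most 2 and is bounded but not constant on the positive half-line, hence has a zero; by
  almost periodicity \<open>F\<close> recurs arbitrarily high up, and Hurwitz's theorem transports that zero to a nonreal
  zero of \<open>H\<^sub>\<lambda>\<close>.
\<close>

section \<open>Entire functions and contour integrals\<close>

text \<open>Three points shape the argument. (1) Evenness of \<open>newman_Phi\<close>, which comes
  from the theta functional equation, turns the half-line cosine integral into a Fourier integral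
  over the whole line, which can be translated and split over n; it also makes
  \<open>newman_H\<close> even, so that one half-plane settles the other. (2) The comparison of
  moduli for real-rooted functions is only a weak inequality, so a zero created by averaging is
  excluded through the equality case of the maximum modulus principle, together with positivity on
  the imaginary axis. (3) For a negative parameter, the translate by L = ln n / 2 multiplies the
  n-th integrand by exp (2 a L s), which is unbounded in n. The path must therefore descend
  quadratically to the right of the saddle; completing the square then costs exp (a L^2 / 2), half
  of what the coefficient exp (- a L^2) provides. At the saddle, whose real part is ln (x / (4 pi))
  / 4, the same factor is a power of x; moving down the logarithmic curve compensates it and keeps
  the argument of F bounded up to a vertical translation, which almost periods remove.\<close>

lemma sums_integral_dominated:
  fixes f :: "nat \<Rightarrow> 'a \<Rightarrow> 'b::{banach, second_countable_topology}"
  assumes [measurable]: "\<And>k. f k \<in> borel_measurable M"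
    and sm: "\<And>x. summable (\<lambda>k. norm (f k x))"
    and le: "\<And>x. (\<Sum>k. norm (f k x)) \<le> G x" and G: "integrable M G"
  shows "(\<lambda>k. \<integral>x. f k x \<partial>M) sums (\<integral>x. (\<Sum>k. f k x) \<partial>M)"
proof (rule sums_integral)
  have fin: "(\<Sum>k<n. norm (f k x)) \<le> G x" for n x
    using sum_le_suminf[OF sm[of x], of "{..<n}"] le[of x] by force
  have int: "integrable M (f k)" for k
  proof (rule Bochner_Integration.integrable_bound[OF G])
    have "norm (f k x) \<le> norm (G x)" for x
      using fin[of x "Suc k"] sum_nonneg[of "{..<k}" "\<lambda>k. norm (f k x)"] by simp
    then show "AE x in M. norm (f k x) \<le> norm (G x)" by simp
  qed simp
  then show "integrable M (f k)" for k .
  show "AE x in M. summable (\<lambda>k. norm (f k x))" using sm by simp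
  show "summable (\<lambda>k. \<integral>x. norm (f k x) \<partial>M)"
  proof (rule summableI_nonneg_bounded)
    fix n
    have "(\<Sum>k<n. \<integral>x. norm (f k x) \<partial>M) = (\<integral>x. (\<Sum>k<n. norm (f k x)) \<partial>M)"
      by (rule Bochner_Integration.integral_sum[symmetric]) (use int in auto)
    also have "\<dots> \<le> (\<integral>x. G x \<partial>M)"
      by (rule integral_mono) (use int G fin in auto)
    finally show "(\<Sum>k<n. \<integral>x. norm (f k x) \<partial>M) \<le> (\<integral>x. G x \<partial>M)" .
  qed simp
qed

text \<open>Expanding the exponential and integrating termwise gives a power series in z that
  converges everywhere; \<open>int\<close> supplies the dominating function. The measure is
  arbitrary so that one proof serves Fourier integrals over \<open>lborel\<close> and Dirichlet
  series over counting measure.\<close>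

lemma entire_exp_integral:
  fixes g :: "'a \<Rightarrow> complex" and h :: "'a \<Rightarrow> real"
  assumes [measurable]: "g \<in> borel_measurable M" "h \<in> borel_measurable M"
    and int: "\<And>r. integrable M (\<lambda>x. norm (g x) * exp (r * \<bar>h x\<bar>))"
  shows "(\<lambda>z. \<integral>x. g x * exp (z * of_real (h x)) \<partial>M) holomorphic_on A"
proof -
  define c where "c = (\<lambda>k. \<integral>x. g x * (of_real (h x) ^ k / fact k) \<partial>M)"
  have "(\<lambda>k. c k * (w - 0)^k) sums (\<integral>x. g x * exp (w * of_real (h x)) \<partial>M)" for w
  proof -
    let ?f = "\<lambda>k x. g x * (of_real (h x) ^ k / fact k) * w ^ k"
    have s: "(\<lambda>k. norm (?f k x)) sums (norm (g x) * exp (norm w * \<bar>h x\<bar>))" for x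
      using sums_mult[OF exp_converges[of "norm w * \<bar>h x\<bar>"], of "norm (g x)"]
      by (simp add: norm_mult norm_divide norm_power power_mult_distrib field_simps)
    have s': "?f k x = g x * ((w * of_real (h x)) ^ k /\<^sub>R fact k)" for k x
      by (simp add: scaleR_conv_of_real power_mult_distrib field_simps)
    have "(\<lambda>k. \<integral>x. ?f k x \<partial>M) sums (\<integral>x. (\<Sum>k. ?f k x) \<partial>M)"
      by (rule sums_integral_dominated[OF _ _ _ int[of "norm w"]])
         (use s in \<open>auto simp: sums_iff\<close>)
    moreover have "(\<Sum>k. ?f k x) = g x * exp (w * of_real (h x))" for x
      unfolding s' using sums_mult[OF exp_converges[of "w * of_real (h x)"], of "g x"]
      by (simp add: sums_iff)
    ultimately show ?thesis by (simp add: c_def)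
  qed
  then have "(\<lambda>z. \<integral>x. g x * exp (z * of_real (h x)) \<partial>M) holomorphic_on ball 0 R" for R
    by (intro power_series_holomorphic) auto
  then have "(\<lambda>z. \<integral>x. g x * exp (z * of_real (h x)) \<partial>M) holomorphic_on (\<Union>n. ball 0 (real n))"
    by (intro holomorphic_on_UN_open) auto
  moreover have "(\<Union>n. ball 0 (real n)) = (UNIV :: complex set)"
    using reals_Archimedean2 by (auto simp: dist_norm)
  ultimately show ?thesis by (metis holomorphic_on_subset subset_UNIV)
qed

text \<open>The Moebius map f / (2 M - f) takes the half-plane Re < M into the unit disc and fixes
  0, so Schwarz's lemma bounds it by |z| / R, at most 1/2 here. Then |f| <= |2 M - f| / 2 <= M + |f|
  / 2 gives the bound 2 M.\<close>

lemma borel_caratheodory: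
  fixes f :: "complex \<Rightarrow> complex"
  assumes hol: "f holomorphic_on ball 0 R" and R: "R > 0" and f0: "f 0 = 0" and M: "M > 0"
    and Re: "\<And>z. z \<in> ball 0 R \<Longrightarrow> Re (f z) < M"
    and z: "norm z \<le> R / 2"
  shows "norm (f z) \<le> 2 * M"
proof -
  define \<phi> where "\<phi> = (\<lambda>w. f (of_real R * w) / (2 * of_real M - f (of_real R * w)))"
  have in_ball: "of_real R * w \<in> ball 0 R" if "norm w < 1" for w :: complex
    using that R by (simp add: norm_mult)
  have lt: "norm (f u) < norm (2 * of_real M - f u)" if "u \<in> ball 0 R" for u
  proof -
    have "(norm (2 * of_real M - f u))\<^sup>2 = (norm (f u))\<^sup>2 + 4 * M * (M - Re (f u))"
      unfolding cmod_power2 by (simp add: power2_eq_square algebra_simps)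
    moreover have "4 * M * (M - Re (f u)) > 0" using M Re[OF that] by simp
    ultimately have "(norm (f u))\<^sup>2 < (norm (2 * of_real M - f u))\<^sup>2" by linarith
    then show ?thesis by (rule power_less_imp_less_base) simp
  qed
  have "norm (\<phi> (z / of_real R)) \<le> norm (z / of_real R)"
  proof (rule Schwarz_Lemma)
    have "(\<lambda>w. f (of_real R * w)) holomorphic_on ball 0 1"
      by (rule holomorphic_on_compose_gen[OF _ hol, unfolded o_def])
         (use in_ball in \<open>auto intro!: holomorphic_intros\<close>)
    moreover have "2 * of_real M - f (of_real R * w) \<noteq> 0" if "norm w < 1" for w
      using lt[OF in_ball[OF that]] by auto
    ultimately show "\<phi> holomorphic_on ball 0 1"
      unfolding \<phi>_def by (intro holomorphic_intros) auto
    show "\<phi> 0 = 0" by (simp add: \<phi>_def f0)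
    show "norm (\<phi> w) < 1" if "norm w < 1" for w
      unfolding \<phi>_def norm_divide
      by (subst divide_less_eq_1_pos)
         (rule le_less_trans[OF norm_ge_zero lt[OF in_ball[OF that]]], rule lt[OF in_ball[OF that]])
    show "norm (z / of_real R) < 1" using z R by (simp add: norm_divide)
  qed
  also have "\<dots> \<le> 1 / 2" using z R by (simp add: norm_divide field_simps)
  finally have *: "norm (f z) / norm (2 * of_real M - f z) \<le> 1 / 2"
    using R by (simp add: \<phi>_def norm_divide)
  have pos: "norm (2 * of_real M - f z) > 0"
    using le_less_trans[OF norm_ge_zero lt[of z]] z R by simp
  have "norm (2 * of_real M - f z) \<le> 2 * M + norm (f z)"
    using norm_triangle_ineq4[of "2 * of_real M" "f z"] M by (simp add: norm_mult)
  moreover have "norm (f z) \<le> 1 / 2 * norm (2 * of_real M - f z)"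
    using * pos by (simp only: pos_divide_le_eq)
  ultimately show ?thesis by linarith
qed

text \<open>A zero-free function on a disc has a holomorphic logarithm. Normalised to vanish at 0,
  it has real part below M, and \<open>borel_caratheodory\<close> turns this one-sided bound into a
  bound on its modulus.\<close>

lemma log_bound_of_nonzero:
  fixes q :: "complex \<Rightarrow> complex"
  assumes hol: "q holomorphic_on ball 0 R" and R: "R > 0" and M: "M > 0"
    and nz: "\<And>z. z \<in> ball 0 R \<Longrightarrow> q z \<noteq> 0"
    and le: "\<And>z. z \<in> ball 0 R \<Longrightarrow> norm (q z) < exp M * norm (q 0)"
  obtains g where "g holomorphic_on ball 0 R" "g 0 = 0"
    "\<And>z. z \<in> ball 0 R \<Longrightarrow> q z = q 0 * exp (g z)"
    "\<And>z. norm z \<le> R / 2 \<Longrightarrow> norm (g z) \<le> 2 * M"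
proof -
  obtain G where G: "G holomorphic_on ball 0 R" "\<And>z. z \<in> ball 0 R \<Longrightarrow> q z = exp (G z)"
    using contractible_imp_holomorphic_log[OF hol convex_imp_contractible[OF convex_ball] nz]
    by metis
  define g where "g = (\<lambda>z. G z - G 0)"
  have g: "g holomorphic_on ball 0 R" unfolding g_def by (intro holomorphic_intros G)
  have qg: "q z = q 0 * exp (g z)" if "z \<in> ball 0 R" for z
    using G(2)[OF that] G(2)[of 0] R by (simp add: g_def exp_diff)
  have "Re (g z) < M" if "z \<in> ball 0 R" for z
  proof -
    have "norm (q 0) * exp (Re (g z)) < exp M * norm (q 0)"
      using le[OF that] qg[OF that] by (simp add: norm_mult)
    then show ?thesis using nz[of 0] R by (simp add: mult.commute)
  qed
  then have "norm (g z) \<le> 2 * M" if "norm z \<le> R / 2" for z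
    using borel_caratheodory[OF g R _ M _ that] by (simp add: g_def)
  then show thesis using that[OF g _ qg] by (simp add: g_def)
qed

text \<open>Integrals over t in [-n, n] along either curve are differences of values of a primitive
  \<open>F\<close>. The endpoints of the two curves are joined by vertical segments of length at
  most D on which f is at most \<open>B t\<close>, so the discrepancy vanishes as n grows.\<close>

lemma contour_shift:
  fixes f :: "complex \<Rightarrow> complex" and h h' B :: "real \<Rightarrow> real"
  assumes hol: "f holomorphic_on UNIV"
    and h: "\<And>t. (h has_real_derivative h' t) (at t)" and h': "continuous_on UNIV h'"
    and D: "\<And>t. \<bar>h t - c\<bar> \<le> D"
    and B: "\<And>t y. y \<in> closed_segment c (h t) \<Longrightarrow> norm (f (Complex t y)) \<le> B t"
    and lim: "(B \<longlongrightarrow> 0) at_top" "(B \<longlongrightarrow> 0) at_bot"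
    and int1: "integrable lborel (\<lambda>t. f (Complex t c))"
    and int2: "integrable lborel (\<lambda>t. f (Complex t (h t)) * Complex 1 (h' t))"
  shows "(\<integral>t. f (Complex t c) \<partial>lborel) = (\<integral>t. f (Complex t (h t)) * Complex 1 (h' t) \<partial>lborel)"
proof -
  obtain F where F: "\<And>z. (F has_field_derivative f z) (at z)"
    using holomorphic_convex_primitive'[of UNIV f] hol by (metis UNIV_I convex_UNIV open_UNIV)
  have contf: "continuous_on UNIV f" by (rule holomorphic_on_imp_continuous_on[OF hol])
  have lim_int: "(\<lambda>n. F (Complex (real n) (k (real n))) - F (Complex (- real n) (k (- real n))))
      \<longlonglongrightarrow> (\<integral>t. f (Complex t (k t)) * Complex 1 (k' t) \<partial>lborel)"
    if k: "\<And>t. (k has_real_derivative k' t) (at t)" and k': "continuous_on UNIV k'"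
      and int: "integrable lborel (\<lambda>t. f (Complex t (k t)) * Complex 1 (k' t))" for k k'
  proof -
    let ?g = "\<lambda>t. f (Complex t (k t)) * Complex 1 (k' t)"
    have contk: "continuous_on UNIV k" using k by (meson DERIV_continuous continuous_at_imp_continuous_on)
    have cont: "continuous_on UNIV ?g"
      unfolding Complex_eq using contk k'
      by (intro continuous_intros continuous_on_compose2[OF contf]) auto
    have der: "((\<lambda>t. F (Complex t (k t))) has_vector_derivative ?g t) (at t)" for t
    proof -
      have 1: "((\<lambda>t. Complex t (k t)) has_vector_derivative Complex 1 (k' t)) (at t)"
        unfolding Complex_eq using k[of t]
        by (auto intro!: derivative_eq_intros has_vector_derivative_real_field simp: has_real_derivative_iff_has_vector_derivative)
      show ?thesis using field_vector_diff_chain_at[OF 1 F] by (simp add: o_def mult.commute)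
    qed
    have "(\<integral>t. indicator {- real n..real n} t *\<^sub>R ?g t \<partial>lborel)
       = F (Complex (real n) (k (real n))) - F (Complex (- real n) (k (- real n)))" for n
      by (rule integral_FTC_atLeastAtMost)
         (use der cont in \<open>auto intro: has_vector_derivative_at_within continuous_on_subset\<close>)
    moreover have "(\<lambda>n. \<integral>t. indicator {- real n..real n} t *\<^sub>R ?g t \<partial>lborel) \<longlonglongrightarrow> (\<integral>t. ?g t \<partial>lborel)"
    proof (rule integral_dominated_convergence)
      show "?g \<in> borel_measurable lborel" using int by auto
      then show "(\<lambda>t. indicator {- real n..real n} t *\<^sub>R ?g t) \<in> borel_measurable lborel" for n by measurable
      show "integrable lborel (\<lambda>t. norm (?g t))" using int by auto
      show "AE t in lborel. (\<lambda>n. indicator {- real n..real n} t *\<^sub>R ?g t) \<longlonglongrightarrow> ?g t"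
      proof (rule AE_I2)
        fix t :: real
        obtain N where N: "\<bar>t\<bar> \<le> real N" using real_arch_simple by blast
        have "eventually (\<lambda>n. indicator {- real n..real n} t *\<^sub>R ?g t = ?g t) sequentially"
          by (rule eventually_mono[OF eventually_ge_at_top[of N]]) (use N in \<open>auto simp: indicator_def\<close>)
        then show "(\<lambda>n. indicator {- real n..real n} t *\<^sub>R ?g t) \<longlonglongrightarrow> ?g t"
          by (rule tendsto_eventually)
      qed
    qed (auto split: split_indicator)
    ultimately show ?thesis by simp
  qed
  define dif where "dif = (\<lambda>t. F (Complex t (h t)) - F (Complex t c))"
  have dif: "norm (dif t) \<le> B t * D" for t
  proof -
    have "norm (dif t) \<le> B t * norm (Complex t (h t) - Complex t c)"
      unfolding dif_def
    proof (rule field_differentiable_bound[where S = "closed_segment (Complex t c) (Complex t (h t))"])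
      fix z assume "z \<in> closed_segment (Complex t c) (Complex t (h t))"
      then obtain u where u: "0 \<le> u" "u \<le> 1" "z = (1 - u) *\<^sub>R Complex t c + u *\<^sub>R Complex t (h t)"
        by (auto simp: in_segment)
      then have "z = Complex t ((1 - u) * c + u * h t)"
        by (simp add: complex_eq_iff algebra_simps)
      moreover have "(1 - u) * c + u * h t \<in> closed_segment c (h t)"
        using u by (auto simp: in_segment)
      ultimately show "norm (f z) \<le> B t" using B by metis
    qed (use F in \<open>auto intro: has_field_derivative_at_within\<close>)
    also have "norm (Complex t (h t) - Complex t c) = \<bar>h t - c\<bar>"
      by (simp add: cmod_def)
    also have "B t * \<bar>h t - c\<bar> \<le> B t * D"
      using D[of t] B[of c t] norm_ge_zero order_trans
      by (intro mult_left_mono) (auto intro: order_trans[OF norm_ge_zero])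
    finally show ?thesis .
  qed
  have z: "(\<lambda>n. dif (real n)) \<longlonglongrightarrow> 0"
    by (rule Lim_null_comparison[of _ "\<lambda>n. B (real n) * D"])
       (use dif in \<open>auto intro!: tendsto_mult_left_zero filterlim_compose[OF lim(1)] filterlim_real_sequentially\<close>)
  have z': "(\<lambda>n. dif (- real n)) \<longlonglongrightarrow> 0"
    by (rule Lim_null_comparison[of _ "\<lambda>n. B (- real n) * D"])
       (use dif in \<open>auto intro!: tendsto_mult_left_zero filterlim_compose[OF lim(2)]
          filterlim_real_sequentially filterlim_compose[OF filterlim_uminus_at_bot_at_top]\<close>)
  have "Complex 1 0 = 1" by (simp add: complex_eq_iff)
  then have 1: "(\<lambda>n. F (Complex (real n) c) - F (Complex (- real n) c)) \<longlonglongrightarrow> (\<integral>t. f (Complex t c) \<partial>lborel)"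
    using lim_int[of "\<lambda>_. c" "\<lambda>_. 0"] int1 by simp
  have 2: "(\<lambda>n. F (Complex (real n) (h (real n))) - F (Complex (- real n) (h (- real n))))
      \<longlonglongrightarrow> (\<integral>t. f (Complex t (h t)) * Complex 1 (h' t) \<partial>lborel)"
    by (rule lim_int[OF h h' int2])
  have "(\<lambda>n. (F (Complex (real n) c) - F (Complex (- real n) c)) + dif (real n) - dif (- real n))
      \<longlonglongrightarrow> (\<integral>t. f (Complex t c) \<partial>lborel) + 0 - 0"
    by (intro tendsto_intros 1 z z')
  then have "(\<lambda>n. F (Complex (real n) (h (real n))) - F (Complex (- real n) (h (- real n))))
      \<longlonglongrightarrow> (\<integral>t. f (Complex t c) \<partial>lborel)"
    by (simp add: dif_def algebra_simps)
  from LIMSEQ_unique[OF this 2] show ?thesis .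
qed

text \<open>The factor is normalised to 1 at 0, so dividing by it leaves the value at 0 unchanged.
  If \<open>a\<close> is not a zero of q, the exponent is 0.\<close>

lemma entire_divide_zero:
  fixes q :: "complex \<Rightarrow> complex"
  assumes hol: "q holomorphic_on UNIV" and q0: "q 0 \<noteq> 0" and a: "a \<noteq> 0"
  obtains k p where "p holomorphic_on UNIV" "\<And>z. q z = (1 - z / a) ^ k * p z" "p a \<noteq> 0"
proof -
  define n where "n = nat (zorder q a)"
  define g where "g = zor_poly q a"
  obtain r where r: "r > 0" "g holomorphic_on cball a r"
    "\<And>w. w \<in> cball a r \<Longrightarrow> q w = g w * (w - a) ^ n \<and> g w \<noteq> 0"
  proof -
    have "\<exists>r>0. g holomorphic_on cball a r \<and> (\<forall>w\<in>cball a r. q w = g w * (w - a) ^ n \<and> g w \<noteq> 0)"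
      using zorder_exist_zero[OF hol, of a] q0 unfolding n_def g_def by (auto simp: connected_UNIV)
    then show thesis using that by blast
  qed
  define p where "p = (\<lambda>w. (if w = a then g a else q w / (w - a) ^ n) * (- a) ^ n)"
  have pg: "p w = g w * (- a) ^ n" if "w \<in> ball a r" for w
    using r(3)[of w] that by (auto simp: p_def)
  have "p holomorphic_on ball a r \<union> (- {a})"
  proof (rule holomorphic_on_Un)
    have "(\<lambda>w. g w * (- a) ^ n) holomorphic_on ball a r"
      by (intro holomorphic_intros holomorphic_on_subset[OF r(2)]) auto
    then show "p holomorphic_on ball a r" by (rule holomorphic_transform) (simp add: pg)
    have "(\<lambda>w. q w / (w - a) ^ n * (- a) ^ n) holomorphic_on - {a}"
      by (intro holomorphic_intros holomorphic_on_subset[OF hol]) auto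
    then show "p holomorphic_on - {a}" by (rule holomorphic_transform) (simp add: p_def)
  qed auto
  moreover have "ball a r \<union> (- {a}) = UNIV" using r(1) by auto
  ultimately have hp: "p holomorphic_on UNIV" by simp
  have qp: "q z = (1 - z / a) ^ n * p z" for z
  proof (cases "z = a")
    case True
    then show ?thesis using r(3)[of a] r(1) a by (cases "n = 0") (auto simp: p_def)
  next
    case False
    have "1 - z / a = (z - a) / (- a)" using a by (simp add: field_simps)
    then have "(1 - z / a) ^ n = (z - a) ^ n / (- a) ^ n" by (simp only: power_divide)
    then show ?thesis using False a by (simp add: p_def)
  qed
  have "p a \<noteq> 0" using pg[of a] r a by simp
  with hp qp show thesis by (rule that)
qed

lemma entire_divide_zeros:
  fixes f :: "complex \<Rightarrow> complex"
  assumes hol: "f holomorphic_on UNIV" and f0: "f 0 \<noteq> 0" and S: "finite S" "0 \<notin> S"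
  shows "\<exists>k p. p holomorphic_on UNIV \<and> (\<forall>z. f z = (\<Prod>a\<in>S. (1 - z / a) ^ k a) * p z) \<and> (\<forall>a\<in>S. p a \<noteq> 0)"
  using S
proof (induction S)
  case empty
  show ?case using hol by (intro exI[of _ "\<lambda>_. 0"] exI[of _ f]) auto
next
  case (insert b S)
  then obtain k p where p: "p holomorphic_on UNIV" "\<And>z. f z = (\<Prod>a\<in>S. (1 - z / a) ^ k a) * p z"
    "\<And>a. a \<in> S \<Longrightarrow> p a \<noteq> 0" by auto
  have "p 0 \<noteq> 0" using f0 p(2)[of 0] by auto
  then obtain m r where r: "r holomorphic_on UNIV" "\<And>z. p z = (1 - z / b) ^ m * r z" "r b \<noteq> 0"
    using entire_divide_zero[OF p(1), of b] insert by (metis insertI1)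
  have "f z = (\<Prod>a\<in>insert b S. (1 - z / a) ^ (k(b := m)) a) * r z" for z
  proof -
    have "(\<Prod>a\<in>S. (1 - z / a) ^ (k(b := m)) a) = (\<Prod>a\<in>S. (1 - z / a) ^ k a)"
      using insert by (intro prod.cong) auto
    then show ?thesis using insert by (simp add: p(2) r(2))
  qed
  moreover have "r a \<noteq> 0" if "a \<in> insert b S" for a
    using that r(3) p(3)[of a] r(2)[of a] by auto
  ultimately show ?case using r(1) by blast
qed

text \<open>Difference quotients along the real axis are real and the reals are closed. This makes
  the linear coefficient of a logarithm real in the comparison of moduli below.\<close>

lemma deriv_of_real_Reals:
  fixes q :: "complex \<Rightarrow> complex"
  assumes der: "(q has_field_derivative d) (at 0)"
    and re: "eventually (\<lambda>x. q (of_real x) \<in> \<real>) (at (0::real))" and q0: "q 0 \<in> \<real>"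
  shows "d \<in> \<real>"
proof -
  have "((\<lambda>h. (q (0 + h) - q 0) / h) \<longlongrightarrow> d) (at 0)" using der unfolding DERIV_def .
  moreover have "filterlim (of_real :: real \<Rightarrow> complex) (at 0) (at 0)"
    by (auto simp: filterlim_at eventually_at_filter intro!: tendsto_eq_intros)
  ultimately have "((\<lambda>x. (q (0 + of_real x) - q 0) / of_real x) \<longlongrightarrow> d) (at (0::real))"
    by (rule filterlim_compose)
  then show ?thesis
    by (rule Lim_in_closed_set[rotated -1])
       (use re q0 in \<open>auto elim!: eventually_mono intro!: closed_complex_Reals\<close>)
qed

section \<open>Entire functions with only real zeros\<close>

text \<open>Divide out the zeros in a disc of radius R and write the zero-free quotient as
  \<open>p 0 * exp (g z)\<close>. Growth below every exp (e |z|^2) makes the second derivative of g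
  of order e near the two points, so g is a linear function d z up to O(e |z|^2). Since d is real,
  Re (d z) does not see the height, while each factor |1 - z / a| with a real zero a grows with |Im
  z|. Letting e tend to 0 gives the claim.\<close>

lemma real_zeros_norm_mono:
  fixes f :: "complex \<Rightarrow> complex"
  assumes hol: "f holomorphic_on UNIV"
    and growth: "\<And>e. e > 0 \<Longrightarrow> \<exists>C. \<forall>z. norm (f z) \<le> C * exp (e * (norm z)\<^sup>2)"
    and re: "\<And>x::real. f (of_real x) \<in> \<real>"
    and zeros: "\<And>z. f z = 0 \<Longrightarrow> z \<in> \<real>" and f0: "f 0 \<noteq> 0"
    and y: "\<bar>y1\<bar> \<le> \<bar>y2\<bar>"
  shows "norm (f (Complex x y1)) \<le> norm (f (Complex x y2))"
proof -
  define z1 z2 where "z1 = Complex x y1" and "z2 = Complex x y2"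
  define N where "N = (norm z1)\<^sup>2 + (norm z2)\<^sup>2"
  \<comment> \<open>The constant 320: M is at most 5 e R^2, |g| is at most 2 M for |z| <= R / 2, and
    Cauchy's estimate on circles of radius R / 4 gives 2 (2 M) / (R / 4)^2 = 64 M / R^2 <= 320 e for
    the second derivative.\<close>
  have key: "norm (f z1) \<le> norm (f z2) * exp (320 * e * N)" if e: "e > 0" for e
  proof -
    obtain C where C: "\<And>z. norm (f z) \<le> C * exp (e * (norm z)\<^sup>2)" using growth[OF e] by blast
    have C0: "norm (f 0) \<le> C" using C[of 0] by simp
    have Cpos: "C > 0" using C0 f0 by (meson less_le_trans zero_less_norm_iff)
    define c where "c = ln (C / norm (f 0)) + 1"
    have "ln (C / norm (f 0)) \<ge> 0" using C0 f0 Cpos by (intro ln_ge_zero) (simp add: field_simps)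
    then have c: "c \<ge> 1" by (simp add: c_def)
    \<comment> \<open>R puts both points into the disc of radius R / 4, where the Taylor bound
      holds, and is so large that c <= e R^2, which absorbs the constant
      \<open>C / norm (f 0)\<close>.\<close>
    define R where "R = 4 * (norm z1 + norm z2) + 1 + c / e"
    have R: "R \<ge> 1" "4 * norm z1 \<le> R" "4 * norm z2 \<le> R" "c / e \<le> R"
      using c e by (auto simp: R_def)
    have "c / e \<le> R\<^sup>2" using R self_le_power[of R 2] by linarith
    then have cR: "c \<le> e * R\<^sup>2" using e by (simp add: field_simps)
    define M where "M = c + 4 * e * R\<^sup>2"
    have M: "M > 0" "M \<le> 5 * e * R\<^sup>2" using c cR e by (auto simp: M_def intro!: add_pos_nonneg)
    define S where "S = {z \<in> cball 0 R. f z = 0}"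
    have finS: "finite S"
    proof (cases "f constant_on UNIV")
      case True
      then have "S = {}" using f0 by (fastforce simp: S_def constant_on_def)
      then show ?thesis by simp
    next
      case False
      then show ?thesis unfolding S_def
        using holomorphic_compact_finite_zeros[of f UNIV "cball 0 R"] hol by (simp add: connected_UNIV)
    qed
    have S: "a \<in> \<real>" "a \<noteq> 0" "norm a \<le> R" if "a \<in> S" for a
      using that zeros f0 by (auto simp: S_def)
    obtain k p where p: "p holomorphic_on UNIV" "\<And>z. f z = (\<Prod>a\<in>S. (1 - z / a) ^ k a) * p z"
      "\<And>a. a \<in> S \<Longrightarrow> p a \<noteq> 0"
      using entire_divide_zeros[OF hol f0 finS] S(2) by blast
    define P where "P = (\<lambda>z. \<Prod>a\<in>S. (1 - z / a) ^ k a)"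
    have fP: "f z = P z * p z" for z by (simp add: p(2) P_def)
    have p0: "p 0 = f 0" using fP[of 0] by (simp add: P_def)
    \<comment> \<open>The reason for the doubled radius: if |a| <= R and |z| = 2 R, then |1 - z / a|
      >= |z / a| - 1 >= 1. Dividing by P does not enlarge the modulus on this circle, and the
      maximum principle carries the bound inwards.\<close>
    have Pge: "1 \<le> norm (P z)" if "norm z = 2 * R" for z
      unfolding P_def prod_norm[symmetric]
    proof (rule prod_ge_1)
      fix a assume a: "a \<in> S"
      have "norm (z / a) - norm (1::complex) \<le> norm (1 - z / a)"
        by (metis norm_minus_commute norm_triangle_ineq2)
      moreover have "norm (z / a) \<ge> 2"
        using S[OF a] that R by (simp add: norm_divide field_simps)
      ultimately show "1 \<le> norm ((1 - z / a) ^ k a)" by (auto simp: norm_power intro!: one_le_power)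
    qed
    have ple: "norm (p z) \<le> C * exp (4 * e * R\<^sup>2)" if "z \<in> cball 0 (2 * R)" for z
    proof (rule maximum_modulus_frontier[of p "cball 0 (2 * R)"])
      fix w :: complex assume "w \<in> frontier (cball 0 (2 * R))"
      then have w: "norm w = 2 * R" using R by (simp add: dist_norm)
      have "norm (p w) \<le> norm (f w)"
        using Pge[OF w] by (simp add: fP norm_mult mult_le_cancel_right1)
      also have "\<dots> \<le> C * exp (4 * e * R\<^sup>2)"
        using C[of w] by (simp add: w power_mult_distrib mult_ac)
      finally show "norm (p w) \<le> C * exp (4 * e * R\<^sup>2)" .
    qed (use that p(1) in \<open>auto intro: holomorphic_on_subset holomorphic_on_imp_continuous_on\<close>)
    have R0: "R > 0" using R by simp
    have hp: "p holomorphic_on ball 0 R" using p(1) by (rule holomorphic_on_subset) auto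
    have pnz: "p z \<noteq> 0" if "z \<in> ball 0 R" for z
      using that p(3)[of z] fP[of z] by (auto simp: S_def)
    have plt: "norm (p z) < exp M * norm (p 0)" if "z \<in> ball 0 R" for z
    proof -
      have "exp M * norm (p 0) = C * exp (4 * e * R\<^sup>2) * exp 1"
        using Cpos f0 by (simp add: M_def c_def exp_add p0)
      moreover have "C * exp (4 * e * R\<^sup>2) * 1 < C * exp (4 * e * R\<^sup>2) * exp 1"
        using Cpos by (intro mult_strict_left_mono) auto
      moreover have "norm (p z) \<le> C * exp (4 * e * R\<^sup>2)" using that R0 by (intro ple) auto
      ultimately show ?thesis by linarith
    qed
    obtain g where g: "g holomorphic_on ball 0 R" "g 0 = 0"
      "\<And>z. z \<in> ball 0 R \<Longrightarrow> p z = p 0 * exp (g z)"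
      "\<And>z. norm z \<le> R / 2 \<Longrightarrow> norm (g z) \<le> 2 * M"
      by (rule log_bound_of_nonzero[OF hp R0 M(1) pnz plt]) (assumption+, rule that)
    define d where "d = deriv g 0"
    have gd: "(g has_field_derivative d) (at 0)"
      unfolding d_def using holomorphic_derivI[OF g(1), of 0] R0 by simp
    have Preal: "P (of_real t) \<in> \<real>" for t
      unfolding P_def using S(1) by (intro prod_in_Reals Reals_power Reals_diff Reals_divide) auto
    \<comment> \<open>Reality of f on the real axis enters here: P is real there and nonzero near 0,
      so p is real near 0 on the axis, and \<open>p 0 * d\<close> is its derivative at 0.\<close>
    have "d \<in> \<real>"
    proof -
      have "((\<lambda>z. p 0 * exp (g z)) has_field_derivative p 0 * d) (at 0)"
        using gd by (auto intro!: derivative_eq_intros simp: g(2))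
      then have "(p has_field_derivative p 0 * d) (at 0)"
        by (rule has_field_derivative_transform_within_open[of _ _ _ "ball 0 R"])
           (use R0 in simp_all, rule g(3)[symmetric], simp)
      moreover have "eventually (\<lambda>t. p (of_real t) \<in> \<real>) (at (0::real))"
      proof -
        have "((\<lambda>t::real. P (of_real t)) \<longlongrightarrow> P (of_real 0)) (at 0)"
          unfolding P_def using S(2) by (intro tendsto_intros) auto
        then have "eventually (\<lambda>t::real. P (of_real t) \<noteq> 0) (at 0)"
          by (rule tendsto_imp_eventually_ne) (simp add: P_def)
        then show ?thesis
        proof eventually_elim
          case (elim t)
          then have "p (of_real t) = f (of_real t) / P (of_real t)" by (simp add: fP)
          then show ?case using re[of t] Preal[of t] by (simp add: Reals_divide)
        qed
      qed
      moreover have "p 0 \<in> \<real>" using re[of 0] by (simp add: p0)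
      ultimately have "p 0 * d \<in> \<real>" by (rule deriv_of_real_Reals)
      then have "p 0 * d / p 0 \<in> \<real>" using \<open>p 0 \<in> \<real>\<close> by (rule Reals_divide)
      then show ?thesis using f0 p0 by simp
    qed
    have taylor: "norm (g z - d * z) \<le> 320 * e * (norm z)\<^sup>2" if z: "norm z \<le> R / 4" for z
    proof -
      have der: "((deriv ^^ i) g has_field_derivative (deriv ^^ Suc i) g w) (at w)"
        if "w \<in> ball 0 R" for i w
        using holomorphic_derivI[OF holomorphic_higher_deriv[OF g(1), of i] _ that] by simp
      have "norm ((deriv ^^ 0) g z - (\<Sum>i\<le>1. (deriv ^^ i) g 0 * (z - 0) ^ i / fact i))
         \<le> (320 * e) * norm (z - 0) ^ Suc 1 / fact 1"
      proof (rule complex_Taylor[where S = "cball 0 (R / 4)"])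
        fix w :: complex assume w: "w \<in> cball 0 (R / 4)"
        have sub: "cball w (R / 4) \<subseteq> cball 0 (R / 2)"
        proof
          fix v assume "v \<in> cball w (R / 4)"
          then show "v \<in> cball 0 (R / 2)" using w norm_triangle_ineq4[of w "w - v"] by (simp add: dist_norm)
        qed
        have sub': "cball w (R / 4) \<subseteq> ball 0 R" using sub R0 by auto
        have "norm ((deriv ^^ 2) g w) \<le> fact 2 * (2 * M) / (R / 4) ^ 2"
        proof (rule Cauchy_inequality)
          show "g holomorphic_on ball w (R / 4)"
            using sub' by (intro holomorphic_on_subset[OF g(1)]) auto
          show "continuous_on (cball w (R / 4)) g"
            using sub' by (intro holomorphic_on_imp_continuous_on holomorphic_on_subset[OF g(1)]) auto
          show "norm (g v) \<le> 2 * M" if "norm (w - v) = R / 4" for v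
            using that sub by (intro g(4)) (auto simp: dist_norm subset_iff)
        qed (use R0 in auto)
        also have "\<dots> = 64 * (M / R\<^sup>2)" by (simp add: field_simps power2_eq_square)
        also have "\<dots> \<le> 64 * (5 * e)" using M(2) R0 by (intro mult_left_mono) (auto simp: field_simps)
        finally show "norm ((deriv ^^ Suc 1) g w) \<le> 320 * e" by (simp add: numeral_2_eq_2)
        show "((deriv ^^ i) g has_field_derivative (deriv ^^ Suc i) g w) (at w within cball 0 (R / 4))" for i
          by (rule has_field_derivative_at_within[OF der]) (use w R0 in auto)
      qed (use z R0 in auto)
      then show ?thesis using g(2) by (simp add: d_def power2_eq_square mult_ac)
    qed
    obtain d' where d': "d = of_real d'" using \<open>d \<in> \<real>\<close> by (auto elim: Reals_cases)
    have zR: "norm z1 \<le> R / 4" "norm z2 \<le> R / 4" using R by auto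
    have fz: "norm (f z) = norm (P z) * (norm (f 0) * exp (Re (g z)))" if "norm z \<le> R / 4" for z
    proof -
      have "p z = f 0 * exp (g z)" using g(3)[of z] that R0 by (simp add: p0)
      then show ?thesis unfolding fP[of z] by (simp add: norm_mult)
    qed
    have Re1: "Re (g z1) \<le> d' * x + 320 * e * (norm z1)\<^sup>2"
      using taylor[of z1] R complex_Re_le_cmod[of "g z1 - d * z1"] by (simp add: d' z1_def)
    have Re2: "d' * x - 320 * e * (norm z2)\<^sup>2 \<le> Re (g z2)"
      using taylor[of z2] R complex_Re_le_cmod[of "d * z2 - g z2"]
      by (simp add: d' z2_def norm_minus_commute)
    have "norm (P z1) \<le> norm (P z2)"
      unfolding P_def prod_norm[symmetric] norm_power
    proof (intro prod_mono conjI power_mono zero_le_power norm_ge_zero)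
      fix a assume "a \<in> S"
      then obtain b where b: "a = of_real b" "b \<noteq> 0" using S by (metis Reals_cases of_real_0)
      have "(norm (1 - z / a))\<^sup>2 = (1 - Re z / b)\<^sup>2 + (Im z)\<^sup>2 / b\<^sup>2" for z
        by (simp add: b cmod_power2 power_divide)
      moreover have "y1\<^sup>2 / b\<^sup>2 \<le> y2\<^sup>2 / b\<^sup>2" using y by (intro divide_right_mono) (auto simp: abs_le_square_iff)
      ultimately have "(norm (1 - z1 / a))\<^sup>2 \<le> (norm (1 - z2 / a))\<^sup>2" by (simp add: z1_def z2_def)
      then show "norm (1 - z1 / a) \<le> norm (1 - z2 / a)" by simp
    qed
    moreover have "Re (g z1) \<le> Re (g z2) + 320 * e * N" using Re1 Re2 by (simp add: N_def algebra_simps)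
    ultimately have "norm (P z1) * (norm (f 0) * exp (Re (g z1)))
        \<le> norm (P z2) * (norm (f 0) * exp (Re (g z2) + 320 * e * N))"
      by (intro mult_mono) auto
    also have "\<dots> = (norm (P z2) * (norm (f 0) * exp (Re (g z2)))) * exp (320 * e * N)"
      by (simp add: exp_add)
    also note fz[OF zR(2), symmetric]
    also note fz[OF zR(1), symmetric]
    finally show ?thesis .
  qed
  have "((\<lambda>e. norm (f z2) * exp (320 * e * N)) \<longlongrightarrow> norm (f z2) * exp (320 * 0 * N)) (at_right 0)"
    by (intro tendsto_intros)
  then have "norm (f z1) \<le> norm (f z2) * exp (320 * 0 * N)"
    by (rule tendsto_lowerbound) (auto simp: eventually_at_filter key)
  then show ?thesis by (simp add: z1_def z2_def)
qed

section \<open>Nonvanishing of zeta on the line Re s = 1\<close>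

lemma norm_nat_powr: "norm (of_nat n powr (- s) :: complex) = real n powr (- Re s)"
  by (cases "n = 0") (simp_all add: norm_powr_real_powr)

lemma zeta_norm_summable_on:
  assumes "Re s > 1"
  shows "(\<lambda>n. norm (of_nat n powr (- s) :: complex)) summable_on {1..}"
proof -
  have "summable (\<lambda>n. real (Suc n) powr (- Re s))" using assms by (intro summable_Suc_powr) auto
  then have "(\<lambda>n. real (Suc n) powr (- Re s)) summable_on UNIV"
    by (intro norm_summable_imp_summable_on) auto
  then have "(\<lambda>n. real n powr (- Re s)) summable_on (Suc ` UNIV)"
    by (subst summable_on_reindex) (auto simp: o_def)
  moreover have "Suc ` UNIV = {1..}" by (auto simp: image_iff) (metis Suc_le_D)
  ultimately show ?thesis by (simp add: norm_nat_powr)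
qed

lemma zeta_has_sum:
  assumes s: "Re s > 1"
  shows "((\<lambda>n. of_nat n powr (- s)) has_sum riemann_zeta s) {1..}"
proof -
  have "summable (\<lambda>n. real (Suc n) powr (- Re s))" using s by (intro summable_Suc_powr) auto
  then have "((\<lambda>n. of_nat (Suc n) powr (- s)) has_sum riemann_zeta s) UNIV"
    by (intro norm_summable_imp_has_sum riemann_zeta_sums s) (simp only: norm_nat_powr)
  then have "((\<lambda>n. of_nat n powr (- s)) has_sum riemann_zeta s) (Suc ` UNIV)"
    by (subst has_sum_reindex) (auto simp: o_def)
  moreover have "Suc ` UNIV = {1..}" by (auto simp: image_iff) (metis Suc_le_D)
  ultimately show ?thesis by simp
qed

text \<open>Multiplying the series by 1 - q^(-s) subtracts the terms at multiples of q; by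
  primality, the multiples of q that survived P are exactly q times the survivors.\<close>

lemma zeta_sieve:
  assumes s: "Re s > 1" and P: "finite P" "\<And>p. p \<in> P \<Longrightarrow> prime p"
  shows "((\<lambda>n. of_nat n powr (- s)) has_sum riemann_zeta s * (\<Prod>p\<in>P. 1 - of_nat p powr (- s)))
    {n. n \<ge> 1 \<and> (\<forall>p\<in>P. \<not> p dvd n)}"
  using P
proof (induction P)
  case empty
  then show ?case using zeta_has_sum[OF s] by (simp add: atLeast_def)
next
  case (insert q P)
  define A where "A = {n::nat. n \<ge> 1 \<and> (\<forall>p\<in>P. \<not> p dvd n)}"
  define S where "S = riemann_zeta s * (\<Prod>p\<in>P. 1 - of_nat p powr (- s))"
  have q: "prime q" using insert by simp
  have A: "((\<lambda>n. of_nat n powr (- s)) has_sum S) A" unfolding A_def S_def using insert by auto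
  have B: "(\<lambda>n. q * n) ` A = {n \<in> A. q dvd n}"
  proof (intro equalityI subsetI)
    fix m assume "m \<in> (\<lambda>n. q * n) ` A"
    then obtain n where n: "n \<in> A" "m = q * n" by auto
    have "\<not> p dvd q * n" if "p \<in> P" for p
      using that n(1) insert q primes_dvd_imp_eq[of p q] prime_dvd_mult_iff[of p q n] by (auto simp: A_def)
    then show "m \<in> {n \<in> A. q dvd n}" using n q prime_gt_0_nat[of q] by (auto simp: A_def)
  next
    fix m assume "m \<in> {n \<in> A. q dvd n}"
    then obtain n where "m \<in> A" "m = q * n" by auto
    then have "n \<in> A" by (auto simp: A_def Suc_le_eq)
    then show "m \<in> (\<lambda>n. q * n) ` A" using \<open>m = q * n\<close> by blast
  qed
  have inj: "inj_on (\<lambda>n. q * n) A" using q prime_gt_0_nat[of q] by (auto intro!: inj_onI)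
  have "((\<lambda>n. of_nat q powr (- s) * of_nat n powr (- s)) has_sum of_nat q powr (- s) * S) A"
    by (rule has_sum_cmult_right[OF A])
  also have "(\<lambda>n. of_nat q powr (- s) * of_nat n powr (- s)) = (\<lambda>n. of_nat n powr (- s)) \<circ> (\<lambda>n. q * n)"
    by (auto simp: fun_eq_iff powr_times_real)
  finally have "((\<lambda>n. of_nat n powr (- s)) has_sum of_nat q powr (- s) * S) {n \<in> A. q dvd n}"
    unfolding B[symmetric] by (simp add: has_sum_reindex[OF inj] o_def)
  then have "((\<lambda>n. of_nat n powr (- s)) has_sum (S - of_nat q powr (- s) * S)) (A - {n \<in> A. q dvd n})"
    by (intro has_sum_Diff A) auto
  moreover have "A - {n \<in> A. q dvd n} = {n. n \<ge> 1 \<and> (\<forall>p\<in>insert q P. \<not> p dvd n)}" by (auto simp: A_def)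
  moreover have "S - of_nat q powr (- s) * S = riemann_zeta s * (\<Prod>p\<in>insert q P. 1 - of_nat p powr (- s))"
    using insert by (simp add: S_def algebra_simps)
  ultimately show ?case by simp
qed

text \<open>After sieving by all primes up to N, the remaining indices are 1 and numbers above N, so
  the distance from 1 is at most a tail of an absolutely convergent series.\<close>

lemma zeta_euler_limit:
  assumes s: "Re s > 1"
  shows "(\<lambda>N. riemann_zeta s * (\<Prod>p | prime p \<and> p \<le> N. 1 - of_nat p powr (- s))) \<longlonglongrightarrow> 1"
proof -
  define r where "r = (\<lambda>n. norm (of_nat n powr (- s) :: complex))"
  have r: "r summable_on {1..}" using zeta_norm_summable_on[OF s] by (simp add: r_def)
  have rsub: "r summable_on X" if "X \<subseteq> {1..}" for X using summable_on_subset_banach[OF r that] .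
  have bound: "norm (riemann_zeta s * (\<Prod>p | prime p \<and> p \<le> N. 1 - of_nat p powr (- s)) - 1) \<le> infsum r {N<..}" for N
  proof -
    define A where "A = {n. n \<ge> 1 \<and> (\<forall>p\<in>{p. prime p \<and> p \<le> N}. \<not> p dvd n)}"
    have hs: "((\<lambda>n. of_nat n powr (- s)) has_sum (riemann_zeta s * (\<Prod>p | prime p \<and> p \<le> N. 1 - of_nat p powr (- s)) - 1)) (A - {1})"
    proof (rule has_sum_Diff)
      show "((\<lambda>n. of_nat n powr (- s)) has_sum (riemann_zeta s * (\<Prod>p | prime p \<and> p \<le> N. 1 - of_nat p powr (- s)))) A"
        unfolding A_def by (rule zeta_sieve[OF s]) auto
      show "((\<lambda>n. of_nat n powr (- s)) has_sum 1) {1::nat}" by (rule has_sum_finiteI) auto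
      show "{1} \<subseteq> A" by (auto simp: A_def)
    qed
    have sub: "A - {1} \<subseteq> {N<..}"
    proof
      fix n assume n: "n \<in> A - {1}"
      then obtain p where p: "prime p" "p dvd n" using prime_factor_nat[of n] by auto
      with n have "p > N" by (auto simp: A_def)
      moreover have "p \<le> n" using p n by (auto simp: A_def intro: dvd_imp_le)
      ultimately show "n \<in> {N<..}" by simp
    qed
    have "(r has_sum infsum r (A - {1})) (A - {1})" by (intro has_sum_infsum rsub) (auto simp: A_def)
    from norm_infsum_le[OF hs this] have "norm (riemann_zeta s * (\<Prod>p | prime p \<and> p \<le> N. 1 - of_nat p powr (- s)) - 1) \<le> infsum r (A - {1})"
      by (simp add: r_def)
    also have "\<dots> \<le> infsum r {N<..}"
      using sub by (intro infsum_mono2 rsub) (auto simp: A_def r_def)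
    finally show ?thesis .
  qed
  have "(\<lambda>N. infsum r {N<..}) \<longlonglongrightarrow> 0"
  proof -
    have eq: "infsum r {N<..} = infsum r {1..} - sum r {1..N}" for N
    proof -
      have "(r has_sum (infsum r {1..} - sum r {1..N})) ({1..} - {1..N})"
        by (intro has_sum_Diff has_sum_infsum r has_sum_finite) auto
      moreover have "{1..} - {1..N} = {N<..}" by auto
      ultimately show ?thesis by (simp add: infsumI)
    qed
    have "(r \<circ> Suc) summable_on UNIV" using r summable_on_reindex[of Suc UNIV r]
      by (metis inj_Suc atLeast_Suc_greaterThan One_nat_def greaterThan_0)
    then have "((r \<circ> Suc) has_sum infsum r {1..}) UNIV"
      using has_sum_reindex[of Suc UNIV r "infsum r {1..}"] has_sum_infsum[OF r]
      by (metis inj_Suc atLeast_Suc_greaterThan One_nat_def greaterThan_0)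
    then have "(\<lambda>N. \<Sum>n<N. r (Suc n)) \<longlonglongrightarrow> infsum r {1..}"
      using has_sum_imp_sums by (fastforce simp: sums_def o_def)
    moreover have "(\<Sum>n<N. r (Suc n)) = sum r {1..N}" for N
      by (simp add: lessThan_atLeast0 sum.shift_bounds_Suc_ivl[symmetric] atLeastLessThanSuc_atLeastAtMost)
    ultimately have "(\<lambda>N. infsum r {1..} - sum r {1..N}) \<longlonglongrightarrow> infsum r {1..} - infsum r {1..}"
      by (intro tendsto_diff tendsto_const) simp
    then show ?thesis by (simp add: eq)
  qed
  then have "(\<lambda>N. riemann_zeta s * (\<Prod>p | prime p \<and> p \<le> N. 1 - of_nat p powr (- s)) - 1) \<longlonglongrightarrow> 0"
    by (rule Lim_null_comparison[rotated]) (simp add: bound)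
  then show ?thesis by (simp add: LIM_zero_iff)
qed

text \<open>The logarithm of the left side is a power series whose n-th term is - r^n (3 + 4 Re u +
  Re (u^2)) / n with u = w^n. For |u| = 1 the bracket equals 2 (1 + Re u)^2.\<close>

lemma three_four_one:
  fixes r :: real and w :: complex
  assumes r: "0 < r" "r < 1" and w: "norm w = 1"
  shows "norm (1 - of_real r :: complex) ^ 3 * norm (1 - of_real r * w) ^ 4 * norm (1 - of_real r * w\<^sup>2) \<le> 1"
proof -
  have s: "(\<lambda>n. - Re (z ^ n) / real n) sums ln (norm (1 - z)) \<and> norm (1 - z) > 0" if "norm z < 1" for z :: complex
  proof -
    have nz: "1 - z \<noteq> 0" using that by auto
    have "(\<lambda>n. - (z ^ n) / of_nat n) sums ln (1 - z)" using Ln_series'[of "- z"] that by simp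
    from sums_Re[OF this] show ?thesis using nz by (simp add: Re_Ln Re_divide_of_nat)
  qed
  define a b c :: complex where "a = of_real r" and "b = of_real r * w" and "c = of_real r * w\<^sup>2"
  have n: "norm a < 1" "norm b < 1" "norm c < 1" using r w by (auto simp: a_def b_def c_def norm_mult norm_power)
  note sa = s[OF n(1)] and sb = s[OF n(2)] and sc = s[OF n(3)]
  have S1: "(\<lambda>n. 3 * (- Re (a ^ n) / real n) + 4 * (- Re (b ^ n) / real n) + (- Re (c ^ n) / real n))
     sums (3 * ln (norm (1 - a)) + 4 * ln (norm (1 - b)) + ln (norm (1 - c)))"
    using sa sb sc by (intro sums_add sums_mult) auto
  have S2: "3 * (- Re (a ^ n) / real n) + 4 * (- Re (b ^ n) / real n) + (- Re (c ^ n) / real n) \<le> 0" for n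
  proof -
    define u where "u = w ^ n"
    have "norm u = 1" using w by (simp add: u_def norm_power)
    then have u: "(Re u)\<^sup>2 + (Im u)\<^sup>2 = 1" using cmod_power2[of u] by simp
    have "Re (u\<^sup>2) = 2 * (Re u)\<^sup>2 - 1" using u by (simp add: power2_eq_square)
    moreover have "2 * (1 + Re u)\<^sup>2 \<ge> 0" by simp
    ultimately have "3 + 4 * Re u + Re (u\<^sup>2) \<ge> 0" by (simp add: power2_eq_square algebra_simps)
    then have "r ^ n * (3 + 4 * Re u + Re (u\<^sup>2)) / real n \<ge> 0" using r by (intro divide_nonneg_nonneg mult_nonneg_nonneg) auto
    moreover have "Re (a ^ n) = r ^ n" "Re (b ^ n) = r ^ n * Re u" "Re (c ^ n) = r ^ n * Re (u\<^sup>2)"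
    proof -
      show "Re (a ^ n) = r ^ n" by (simp add: a_def flip: of_real_power)
      show "Re (b ^ n) = r ^ n * Re u" by (simp add: b_def u_def power_mult_distrib flip: of_real_power)
      have "c ^ n = of_real (r ^ n) * u\<^sup>2" by (simp add: c_def u_def power_mult_distrib power_mult[symmetric] mult.commute)
      then show "Re (c ^ n) = r ^ n * Re (u\<^sup>2)" by simp
    qed
    ultimately show ?thesis by (simp add: add_divide_distrib algebra_simps)
  qed
  have "3 * ln (norm (1 - a)) + 4 * ln (norm (1 - b)) + ln (norm (1 - c)) \<le> 0"
    by (rule sums_le[OF S2 S1 sums_zero])
  moreover have "ln (norm (1 - a) ^ 3 * norm (1 - b) ^ 4 * norm (1 - c)) = 3 * ln (norm (1 - a)) + 4 * ln (norm (1 - b)) + ln (norm (1 - c))"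
    using sa sb sc by (simp add: ln_mult ln_realpow)
  ultimately have "ln (norm (1 - a) ^ 3 * norm (1 - b) ^ 4 * norm (1 - c)) \<le> 0" by simp
  then have "norm (1 - a) ^ 3 * norm (1 - b) ^ 4 * norm (1 - c) \<le> 1"
    using sa sb sc by (subst (asm) ln_le_zero_iff) (auto intro!: mult_pos_pos)
  then show ?thesis by (simp add: a_def b_def c_def)
qed

text \<open>The inequality for a single Euler factor, with r = p^(-\<sigma>) and w = p^(-i t),
  multiplies over the primes p <= N; the truncated products times the zeta values tend to 1.\<close>

lemma zeta_three_four_one:
  fixes \<sigma> t :: real
  assumes \<sigma>: "\<sigma> > 1"
  shows "1 \<le> norm (riemann_zeta (of_real \<sigma>)) ^ 3 * norm (riemann_zeta (Complex \<sigma> t)) ^ 4 * norm (riemann_zeta (Complex \<sigma> (2 * t)))"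
proof -
  define E where "E = (\<lambda>s N. \<Prod>p | prime p \<and> p \<le> N. 1 - of_nat p powr (- s) :: complex)"
  let ?f = "\<lambda>N. norm (riemann_zeta (of_real \<sigma>) * E (of_real \<sigma>) N) ^ 3 * norm (riemann_zeta (Complex \<sigma> t) * E (Complex \<sigma> t) N) ^ 4
      * norm (riemann_zeta (Complex \<sigma> (2 * t)) * E (Complex \<sigma> (2 * t)) N)"
  have "?f \<longlonglongrightarrow> norm (1::complex) ^ 3 * norm (1::complex) ^ 4 * norm (1::complex)"
    unfolding E_def using \<sigma> by (intro tendsto_intros zeta_euler_limit) auto
  moreover have "?f N \<le> norm (riemann_zeta (of_real \<sigma>)) ^ 3 * norm (riemann_zeta (Complex \<sigma> t)) ^ 4 * norm (riemann_zeta (Complex \<sigma> (2 * t)))" for N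
  proof -
    have "norm (E (of_real \<sigma>) N) ^ 3 * norm (E (Complex \<sigma> t) N) ^ 4 * norm (E (Complex \<sigma> (2 * t)) N)
      = (\<Prod>p | prime p \<and> p \<le> N. norm (1 - of_nat p powr (- of_real \<sigma>) :: complex) ^ 3 * norm (1 - of_nat p powr (- Complex \<sigma> t) :: complex) ^ 4 * norm (1 - of_nat p powr (- Complex \<sigma> (2 * t)) :: complex))"
      by (simp add: E_def prod_norm[symmetric] prod.distrib prod_power_distrib)
    also have "\<dots> \<le> 1"
    proof (rule prod_le_1, safe)
      fix p :: nat assume p: "prime p"
      have p1: "p > 1" using prime_gt_1_nat[OF p] .
      define r where "r = real p powr (- \<sigma>)"
      define w where "w = (of_nat p powr (- \<i> * of_real t) :: complex)"
      have r: "0 < r" "r < 1" using p1 \<sigma> by (auto simp: r_def powr_less_one)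
      have w: "norm w = 1" using p1 norm_nat_powr[of p "\<i> * of_real t"] by (simp add: w_def)
      have 1: "of_nat p powr (- of_real \<sigma>) = (of_real r :: complex)"
        by (simp add: r_def powr_of_real[symmetric])
      have 2: "of_nat p powr (- Complex \<sigma> t) = of_real r * w"
        by (simp add: 1[symmetric] w_def powr_add[symmetric] Complex_eq algebra_simps)
      have 3: "of_nat p powr (- Complex \<sigma> (2 * t)) = of_real r * w\<^sup>2"
        unfolding 1[symmetric] w_def power2_eq_square
        by (simp add: powr_add[symmetric] Complex_eq algebra_simps)
      show "norm (1 - of_nat p powr (- of_real \<sigma>) :: complex) ^ 3 * norm (1 - of_nat p powr (- Complex \<sigma> t) :: complex) ^ 4 * norm (1 - of_nat p powr (- Complex \<sigma> (2 * t)) :: complex) \<le> 1"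
        unfolding 1 2 3 by (rule three_four_one[OF r w])
    qed auto
    finally have le: "norm (E (of_real \<sigma>) N) ^ 3 * norm (E (Complex \<sigma> t) N) ^ 4 * norm (E (Complex \<sigma> (2 * t)) N) \<le> 1" .
    have "?f N = (norm (riemann_zeta (of_real \<sigma>)) ^ 3 * norm (riemann_zeta (Complex \<sigma> t)) ^ 4 * norm (riemann_zeta (Complex \<sigma> (2 * t)))) *
      (norm (E (of_real \<sigma>) N) ^ 3 * norm (E (Complex \<sigma> t) N) ^ 4 * norm (E (Complex \<sigma> (2 * t)) N))"
      by (simp add: norm_mult power_mult_distrib mult_ac)
    also have "\<dots> \<le> (norm (riemann_zeta (of_real \<sigma>)) ^ 3 * norm (riemann_zeta (Complex \<sigma> t)) ^ 4 * norm (riemann_zeta (Complex \<sigma> (2 * t)))) * 1"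
      by (intro mult_left_mono le) auto
    finally show ?thesis by simp
  qed
  ultimately show ?thesis by (intro tendsto_upperbound[of ?f 1 sequentially]) auto
qed

lemma zeta_times_entire:
  obtains G where "G holomorphic_on UNIV" "\<And>s. s \<noteq> 1 \<Longrightarrow> G s = (s - 1) * riemann_zeta s"
proof -
  obtain G where G: "G holomorphic_on UNIV" "\<And>s. Re s > 1 \<Longrightarrow> G s = (s - 1) * (\<Sum>n. of_nat (Suc n) powr (- s))"
    using zeta_minus_pole_entire by blast
  have "G s = (s - 1) * riemann_zeta s" if "s \<noteq> 1" for s
  proof (rule analytic_continuation_open[of "{s. Re s > 1}" "- {1}" G "\<lambda>s. (s - 1) * riemann_zeta s"])
    show "{s. Re s > 1} \<noteq> {}" by (auto intro!: exI[of _ 2])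
    show "connected (- {1::complex})" by (rule connected_punctured_universe) simp
    show "G holomorphic_on - {1}" by (rule holomorphic_on_subset[OF G(1)]) auto
    show "(\<lambda>s. (s - 1) * riemann_zeta s) holomorphic_on - {1}" by (intro holomorphic_intros riemann_zeta_holomorphic)
    show "G z = (z - 1) * riemann_zeta z" if "z \<in> {s. Re s > 1}" for z
      using G(2)[of z] riemann_zeta_sums[of z] that by (simp add: sums_iff)
  qed (use that in \<open>auto intro: open_halfspace_Re_gt\<close>)
  then show thesis using that G(1) by blast
qed

text \<open>\<open>riemann_hypothesis\<close> speaks only of the open strip, while zeros of H_0
  below the real axis lead to all of Re s > 1/2; this lemma covers Re s >= 1. On the line Re s = 1,
  a zero at 1 + i t would set a factor of order h^4 against the triple pole of zeta (1 + h)^3,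
  contradicting \<open>zeta_three_four_one\<close> as h tends to 0.\<close>

lemma zeta_nonzero:
  assumes "Re s \<ge> 1" "s \<noteq> 1"
  shows "riemann_zeta s \<noteq> 0"
proof (cases "Re s > 1")
  case True
  show ?thesis
  proof
    assume "riemann_zeta s = 0"
    then have "(\<lambda>N::nat. 0::complex) \<longlonglongrightarrow> 1" using zeta_euler_limit[OF True] by simp
    then show False using LIMSEQ_unique[OF tendsto_const] by fastforce
  qed
next
  case False
  then have Re: "Re s = 1" using assms by simp
  define t where "t = Im s"
  have s: "s = Complex 1 t" using Re by (simp add: t_def complex_eq_iff)
  have t: "t \<noteq> 0" using s assms by (auto simp: complex_eq_iff)
  obtain G where G: "G holomorphic_on UNIV" "\<And>s. s \<noteq> 1 \<Longrightarrow> G s = (s - 1) * riemann_zeta s"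
    using zeta_times_entire by blast
  show ?thesis
  proof
    assume z0: "riemann_zeta s = 0"
    have contz: "isCont riemann_zeta w" if "w \<noteq> 1" for w
      using riemann_zeta_holomorphic that
      by (metis Compl_iff continuous_on_eq_continuous_at empty_iff holomorphic_on_imp_continuous_on insert_iff open_Compl closed_singleton)
    have contG: "isCont G w" for w
      using holomorphic_on_imp_continuous_on[OF G(1)] by (simp add: continuous_on_eq_continuous_at)
    have "riemann_zeta field_differentiable at s"
      using riemann_zeta_holomorphic assms(2) holomorphic_on_imp_differentiable_at[of riemann_zeta "- {1}" s] by auto
    then obtain d where d: "(riemann_zeta has_field_derivative d) (at s)" by (auto simp: field_differentiable_def)
    have filt: "filterlim (\<lambda>h::real. of_real h :: complex) (at 0) (at_right 0)"
      by (auto simp: filterlim_at eventually_at_filter intro!: tendsto_eq_intros)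
    have l1: "((\<lambda>h::real. riemann_zeta (s + of_real h) / of_real h) \<longlongrightarrow> d) (at_right 0)"
      using filterlim_compose[OF d[unfolded DERIV_def] filt] z0 by simp
    have l0: "((\<lambda>h::real. G (1 + of_real h)) \<longlongrightarrow> G (1 + of_real 0)) (at_right 0)"
      by (rule isCont_tendsto_compose[OF contG]) (intro tendsto_intros)
    have l2: "((\<lambda>h::real. riemann_zeta (Complex 1 (2 * t) + of_real h)) \<longlongrightarrow> riemann_zeta (Complex 1 (2 * t) + of_real 0)) (at_right 0)"
      by (rule isCont_tendsto_compose[OF contz]) (use t in \<open>auto simp: complex_eq_iff intro!: tendsto_eq_intros\<close>)
    \<comment> \<open>The three poles are absorbed into G and four powers of h into the difference
      quotient at the supposed zero; the one factor h left over forces the limit 0.\<close>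
    let ?f = "\<lambda>h::real. norm (G (1 + of_real h)) ^ 3 * norm (riemann_zeta (s + of_real h) / of_real h) ^ 4
        * norm (riemann_zeta (Complex 1 (2 * t) + of_real h)) * h"
    have lim: "(?f \<longlongrightarrow> norm (G (1 + of_real 0)) ^ 3 * norm d ^ 4 * norm (riemann_zeta (Complex 1 (2 * t) + of_real 0)) * 0) (at_right 0)"
      by (intro tendsto_intros l0 l1 l2)
    have "eventually (\<lambda>h. 1 \<le> ?f h) (at_right 0)"
      unfolding eventually_at_right_field
    proof (intro exI[of _ 1] conjI allI impI)
      fix h :: real assume h: "0 < h" "h < 1"
      have e: "complex_of_real (1 + h) = 1 + of_real h" "Complex (1 + h) t = s + of_real h" "Complex (1 + h) (2 * t) = Complex 1 (2 * t) + of_real h"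
        by (simp_all add: s complex_eq_iff)
      have "1 \<le> norm (riemann_zeta (1 + of_real h)) ^ 3 * norm (riemann_zeta (s + of_real h)) ^ 4 * norm (riemann_zeta (Complex 1 (2 * t) + of_real h))"
        using zeta_three_four_one[of "1 + h" t] h by (simp only: e)
      also have "riemann_zeta (1 + of_real h) = G (1 + of_real h) / of_real h" using h by (simp add: G(2))
      also have "norm (G (1 + of_real h) / of_real h) ^ 3 * norm (riemann_zeta (s + of_real h)) ^ 4 * norm (riemann_zeta (Complex 1 (2 * t) + of_real h)) = ?f h"
        using h by (simp add: norm_divide power_divide field_simps eval_nat_numeral)
      finally show "1 \<le> ?f h" .
    qed auto
    from tendsto_lowerbound[OF lim this] show False by simp
  qed
qed

section \<open>Theta functions and the kernel Phi\<close>

lemma series_integral_M_test: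
  fixes f :: "nat \<Rightarrow> real \<Rightarrow> real"
  assumes cont: "\<And>n. continuous_on {a..b} (f n)"
    and le: "\<And>n y. y \<in> {a..b} \<Longrightarrow> \<bar>f n y\<bar> \<le> M n" and M: "summable M"
  shows "continuous_on {a..b} (\<lambda>y. \<Sum>n. f n y)"
    and "(\<lambda>n. integral {a..b} (f n)) sums integral {a..b} (\<lambda>y. \<Sum>n. f n y)"
proof -
  have u: "uniform_limit {a..b} (\<lambda>n y. \<Sum>i<n. f i y) (\<lambda>y. \<Sum>n. f n y) sequentially"
    by (rule Weierstrass_m_test[OF _ M]) (use le in auto)
  have c: "continuous_on {a..b} (\<lambda>y. \<Sum>i<n. f i y)" for n by (intro continuous_intros cont)
  show "continuous_on {a..b} (\<lambda>y. \<Sum>n. f n y)"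
    by (rule uniform_limit_theorem[OF _ u]) (use c in auto)
  obtain I J where IJ: "\<And>n. ((\<lambda>y. \<Sum>i<n. f i y) has_integral I n) {a..b}"
    "((\<lambda>y. \<Sum>n. f n y) has_integral J) {a..b}" "I \<longlonglongrightarrow> J"
    using uniform_limit_integral[OF u c] by (metis sequentially_bot)
  have "I n = (\<Sum>i<n. integral {a..b} (f i))" for n
    using integral_unique[OF IJ(1)[of n]]
    by (simp add: integral_sum integrable_continuous_interval cont)
  then have "I = (\<lambda>n. \<Sum>i<n. integral {a..b} (f i))" by blast
  then show "(\<lambda>n. integral {a..b} (f n)) sums integral {a..b} (\<lambda>y. \<Sum>n. f n y)"
    using IJ integral_unique[OF IJ(2)] by (simp add: sums_def)
qed

text \<open>Orthogonality to all these cosines gives orthogonality to every polynomial in cos (2 pi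
  y), and such polynomials are dense by Weierstrass after the substitution y = arccos x / (2 pi).
  Hence the integral of D^2 equals that of D (D - p) with p uniformly close to D, and must
  vanish.\<close>

lemma cos_coefficients_zero_imp_zero:
  fixes D :: "real \<Rightarrow> real"
  assumes cont: "continuous_on {0..1/2} D"
    and 0: "\<And>k::nat. integral {0..1/2} (\<lambda>y. D y * cos (2 * pi * real k * y)) = 0"
    and y: "y \<in> {0..1/2}"
  shows "D y = 0"
proof -
  have int: "(\<lambda>y. D y * f y) integrable_on {0..1/2}" if "continuous_on {0..1/2} f" for f
    by (intro integrable_continuous_interval continuous_intros cont that)
  \<comment> \<open>Frequencies range over the integers because the induction in \<open>pow\<close>
    steps from k to k - 1 and k + 1.\<close>
  have cz: "integral {0..1/2} (\<lambda>y. D y * cos (2 * pi * real_of_int k * y)) = 0" for k :: int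
  proof -
    have eq: "cos (2 * pi * real_of_int k * y) = cos (2 * pi * real (nat \<bar>k\<bar>) * y)" for y
      by (cases "k \<ge> 0") auto
    have "(\<lambda>y. D y * cos (2 * pi * real_of_int k * y)) = (\<lambda>y. D y * cos (2 * pi * real (nat \<bar>k\<bar>) * y))"
      by (rule ext) (simp only: eq)
    then show ?thesis using assms(2)[of "nat \<bar>k\<bar>"] by metis
  qed
  have pow: "integral {0..1/2} (\<lambda>y. D y * (cos (2 * pi * y) ^ m * cos (2 * pi * real_of_int k * y))) = 0"
    for m and k :: int
  proof (induction m arbitrary: k)
    case 0
    then show ?case using cz by simp
  next
    case (Suc m)
    let ?I = "\<lambda>j::int. \<lambda>y. D y * (cos (2 * pi * y) ^ m * cos (2 * pi * real_of_int j * y))"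
    have eq: "D y * (cos (2 * pi * y) ^ Suc m * cos (2 * pi * real_of_int k * y))
        = (1/2) * ?I (k - 1) y + (1/2) * ?I (k + 1) y" for y
    proof -
      have "cos (2 * pi * y) * cos (2 * pi * real_of_int k * y) =
          (cos (2 * pi * real_of_int (k - 1) * y) + cos (2 * pi * real_of_int (k + 1) * y)) / 2"
        by (simp add: cos_times_cos algebra_simps) (simp add: cos_diff cos_add algebra_simps)
      then have "D y * (cos (2 * pi * y) ^ m * (cos (2 * pi * y) * cos (2 * pi * real_of_int k * y)))
          = (1/2) * ?I (k - 1) y + (1/2) * ?I (k + 1) y"
        by (simp only:) (simp add: field_simps)
      then show ?thesis by (simp add: mult_ac)
    qed
    have ii: "?I j integrable_on {0..1/2}" for j by (intro int continuous_intros)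
    show ?case unfolding eq
      by (subst integral_add) (use Suc[of "k - 1"] Suc[of "k + 1"] ii[of "k - 1"] ii[of "k + 1"] in \<open>auto intro!: integrable_on_mult_right\<close>)
  qed
  have poly: "integral {0..1/2} (\<lambda>y. D y * p (cos (2 * pi * y))) = 0" if p: "real_polynomial_function p" for p
  proof -
    obtain a n where p: "p = (\<lambda>x. \<Sum>i\<le>n. a i * x ^ i)"
      using p real_polynomial_function_iff_sum by blast
    have "integral {0..1/2} (\<lambda>y. D y * p (cos (2 * pi * y)))
        = integral {0..1/2} (\<lambda>y. \<Sum>i\<le>n. a i * (D y * cos (2 * pi * y) ^ i))"
      by (simp add: p sum_distrib_left mult_ac)
    also have "\<dots> = (\<Sum>i\<le>n. integral {0..1/2} (\<lambda>y. a i * (D y * cos (2 * pi * y) ^ i)))"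
      by (rule integral_sum) (auto intro!: integrable_on_mult_right int continuous_intros)
    also have "\<dots> = 0" using pow[of _ 0] by simp
    finally show ?thesis .
  qed
  have absint: "(\<lambda>y. \<bar>D y\<bar>) integrable_on {0..1/2}"
    by (intro integrable_continuous_interval continuous_intros cont)
  define K where "K = integral {0..1/2} (\<lambda>y. \<bar>D y\<bar>)"
  have K: "K \<ge> 0" unfolding K_def by (intro integral_nonneg absint) auto
  have le: "integral {0..1/2} (\<lambda>y. D y * D y) \<le> e * K" if "e > 0" for e
  proof -
    have "continuous_on {-1..1} (\<lambda>x. D (arccos x / (2 * pi)))"
      by (rule continuous_on_compose2[OF cont])
         (auto intro!: continuous_intros divide_nonneg_pos arccos_lbound simp: field_simps arccos_ubound)
    then obtain p where p: "real_polynomial_function p"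
      "\<And>x. x \<in> {-1..1} \<Longrightarrow> \<bar>D (arccos x / (2 * pi)) - p x\<bar> < e"
      using Stone_Weierstrass_real_polynomial_function[of "{-1..1::real}"] \<open>e > 0\<close> by blast
    have contp: "continuous_on {0..1/2} (\<lambda>y. p (cos (2 * pi * y)))"
      by (rule continuous_on_compose2[OF continuous_on_polymonial_function[of p UNIV]])
         (use p(1) in \<open>auto intro!: continuous_intros simp: real_polynomial_function_eq\<close>)
    have pe: "\<bar>D y - p (cos (2 * pi * y))\<bar> \<le> e" if "y \<in> {0..1/2}" for y
    proof -
      have "arccos (cos (2 * pi * y)) = 2 * pi * y" using that by (intro arccos_cos) auto
      then show ?thesis using p(2)[of "cos (2 * pi * y)"] by (simp add: less_imp_le)
    qed
    have "integral {0..1/2} (\<lambda>y. D y * D y)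
       = integral {0..1/2} (\<lambda>y. D y * (D y - p (cos (2 * pi * y))) + D y * p (cos (2 * pi * y)))"
      by (simp add: algebra_simps)
    also have "\<dots> = integral {0..1/2} (\<lambda>y. D y * (D y - p (cos (2 * pi * y)))) + 0"
      using poly[OF p(1)] by (subst integral_add) (auto intro!: int contp continuous_intros cont)
    also have "\<dots> \<le> integral {0..1/2} (\<lambda>y. e * \<bar>D y\<bar>)"
      unfolding add_0_right
    proof (rule Henstock_Kurzweil_Integration.integral_le)
      show "(\<lambda>y. D y * (D y - p (cos (2 * pi * y)))) integrable_on {0..1/2}"
        by (auto intro!: int contp continuous_intros cont)
      show "(\<lambda>y. e * \<bar>D y\<bar>) integrable_on {0..1/2}" by (intro integrable_on_mult_right absint)
      fix y :: real assume y: "y \<in> {0..1/2}"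
      have "D y * (D y - p (cos (2 * pi * y))) \<le> \<bar>D y\<bar> * \<bar>D y - p (cos (2 * pi * y))\<bar>"
        by (metis abs_ge_self abs_mult)
      also have "\<dots> \<le> \<bar>D y\<bar> * e" by (intro mult_left_mono pe y) auto
      finally show "D y * (D y - p (cos (2 * pi * y))) \<le> e * \<bar>D y\<bar>" by (simp add: mult.commute)
    qed
    finally show ?thesis by (simp add: K_def)
  qed
  have "integral {0..1/2} (\<lambda>y. D y * D y) \<le> 0"
  proof (rule field_le_epsilon)
    fix e :: real assume "e > 0"
    then have "integral {0..1/2} (\<lambda>y. D y * D y) \<le> e / (K + 1) * K" using K by (intro le) auto
    also have "\<dots> \<le> e" using K \<open>e > 0\<close> by (simp add: field_simps)
    finally show "integral {0..1/2} (\<lambda>y. D y * D y) \<le> 0 + e" by simp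
  qed
  moreover have "integral {0..1/2} (\<lambda>y. D y * D y) \<ge> 0"
    by (intro integral_nonneg int cont) auto
  ultimately have "integral {0..1/2} (\<lambda>y. D y * D y) = 0" by simp
  moreover have "continuous_on {0..1/2} (\<lambda>y. D y * D y)" by (intro continuous_intros cont)
  ultimately have "D y * D y = 0"
    using integral_eq_0_iff[of 0 "1/2" "\<lambda>y. D y * D y"] y by simp
  then show ?thesis by simp
qed

text \<open>Rescaling u by sqrt (2 pi x) turns the weight into the standard normal density, whose
  characteristic function is known.\<close>

lemma gaussian_fourier:
  assumes x: "x > 0"
  shows "integrable lborel (\<lambda>u. exp (- pi * x * u\<^sup>2) * cos (t * u))"
    and "(\<integral>u. exp (- pi * x * u\<^sup>2) * cos (t * u) \<partial>lborel) = exp (- t\<^sup>2 / (4 * pi * x)) / sqrt x"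
proof -
  define c where "c = sqrt (2 * pi * x)"
  have c: "c > 0" "c\<^sup>2 = 2 * pi * x" using x by (auto simp: c_def)
  define s where "s = t / c"
  define F where "F = (\<lambda>u. std_normal_density u * cos (s * u))"
  have "integrable lborel (\<lambda>u. std_normal_density u *\<^sub>R exp (\<i> * of_real (s * u)))"
    by (rule Bochner_Integration.integrable_bound[OF integrable_normal_density[of 1 0]])
       (auto simp: norm_mult)
  from integrable_Re[OF this] have intF: "integrable lborel F"
    by (simp add: F_def Re_exp)
  have "Re (char std_normal_distribution s) = (\<integral>u. F u \<partial>lborel)"
  proof -
    have "char std_normal_distribution s = (\<integral>u. std_normal_density u *\<^sub>R exp (\<i> * of_real (s * u)) \<partial>lborel)"
      unfolding char_def by (subst integral_density) (auto simp: mult_ac)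
    then show ?thesis
      using integral_Re[OF \<open>integrable lborel (\<lambda>u. std_normal_density u *\<^sub>R exp (\<i> * of_real (s * u)))\<close>]
      by (simp add: F_def Re_exp)
  qed
  then have valF: "(\<integral>u. F u \<partial>lborel) = exp (- s\<^sup>2 / 2)"
    by (simp add: char_std_normal_distribution)
  have Fc: "F (0 + c * u) = exp (- pi * x * u\<^sup>2) * cos (t * u) / sqrt (2 * pi)" for u
    using c by (simp add: F_def std_normal_density_def s_def power_mult_distrib)
  have "integrable lborel (\<lambda>u. F (0 + c * u))"
    using lborel_integrable_real_affine[OF intF, of c 0] c by simp
  from integrable_mult_right[OF this[unfolded Fc], of "sqrt (2 * pi)"]
  show "integrable lborel (\<lambda>u. exp (- pi * x * u\<^sup>2) * cos (t * u))" by simp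
  have "exp (- s\<^sup>2 / 2) = c * (\<integral>u. F (0 + c * u) \<partial>lborel)"
    using lborel_integral_real_affine[of c F 0] c valF by simp
  also have "\<dots> = c * ((\<integral>u. exp (- pi * x * u\<^sup>2) * cos (t * u) \<partial>lborel) / sqrt (2 * pi))"
    unfolding Fc by simp
  also have "\<dots> = sqrt x * (\<integral>u. exp (- pi * x * u\<^sup>2) * cos (t * u) \<partial>lborel)"
    by (simp add: c_def real_sqrt_mult)
  finally show "(\<integral>u. exp (- pi * x * u\<^sup>2) * cos (t * u) \<partial>lborel) = exp (- t\<^sup>2 / (4 * pi * x)) / sqrt x"
    using x c by (simp add: s_def power_divide field_simps)
qed

text \<open>Truncation is at natural numbers because the periodised Gaussian below is integrated one
  unit interval at a time.\<close>

lemma gaussian_cos_half_line: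
  assumes x: "x > 0"
  shows "(\<lambda>N. integral {0..real N} (\<lambda>u. exp (- pi * x * u\<^sup>2) * cos (t * u)))
    \<longlonglongrightarrow> exp (- t\<^sup>2 / (4 * pi * x)) / (2 * sqrt x)"
proof -
  define G where "G = (\<lambda>u. exp (- pi * x * u\<^sup>2) * cos (t * u))"
  have int: "integrable lborel G" using gaussian_fourier(1)[OF x] by (simp add: G_def)
  have cont: "continuous_on A G" for A unfolding G_def by (intro continuous_intros)
  have even: "G (- u) = G u" for u by (simp add: G_def)
  have "(\<lambda>N. \<integral>u. indicator {- real N..real N} u *\<^sub>R G u \<partial>lborel) \<longlonglongrightarrow> (\<integral>u. G u \<partial>lborel)"
  proof (rule integral_dominated_convergence)
    show "integrable lborel (\<lambda>u. norm (G u))" using int by auto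
    show "G \<in> borel_measurable lborel" using int by auto
    then show "(\<lambda>u. indicator {- real n..real n} u *\<^sub>R G u) \<in> borel_measurable lborel" for n by measurable
    show "AE u in lborel. (\<lambda>n. indicator {- real n..real n} u *\<^sub>R G u) \<longlonglongrightarrow> G u"
    proof (rule AE_I2)
      fix u :: real
      obtain N where N: "\<bar>u\<bar> \<le> real N" using real_arch_simple by blast
      have "eventually (\<lambda>n. indicator {- real n..real n} u *\<^sub>R G u = G u) sequentially"
        by (rule eventually_mono[OF eventually_ge_at_top[of N]]) (use N in \<open>auto simp: indicator_def\<close>)
      then show "(\<lambda>n. indicator {- real n..real n} u *\<^sub>R G u) \<longlonglongrightarrow> G u"
        by (rule tendsto_eventually)
    qed
  qed (auto split: split_indicator)
  moreover have "(\<integral>u. indicator {- real N..real N} u *\<^sub>R G u \<partial>lborel) = 2 * integral {0..real N} G" for N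
  proof -
    have "(\<integral>u. indicator {- real N..real N} u *\<^sub>R G u \<partial>lborel) = integral {- real N..real N} G"
      using set_borel_integral_eq_integral(2)[OF borel_integrable_atLeastAtMost'[OF cont, of "- real N" "real N"]]
      by (simp add: set_lebesgue_integral_def)
    also have "\<dots> = integral {- real N..0} G + integral {0..real N} G"
      by (rule Henstock_Kurzweil_Integration.integral_combine[symmetric])
         (auto intro!: integrable_continuous_interval cont)
    also have "integral {- real N..0} G = integral {0..real N} G"
      using Henstock_Kurzweil_Integration.integral_reflect_real[of "real N" 0 G] by (simp add: even)
    finally show ?thesis by simp
  qed
  ultimately have "(\<lambda>N. 2 * integral {0..real N} G) \<longlonglongrightarrow> exp (- t\<^sup>2 / (4 * pi * x)) / sqrt x"
    using gaussian_fourier(2)[OF x, of t] by (simp add: G_def)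
  from tendsto_mult[OF tendsto_const[of "1/2"] this] show ?thesis by (simp add: G_def)
qed

text \<open>Poisson summation for exp (- pi x u^2). The periodised Gaussian and its expected cosine
  series are both continuous on [0, 1/2] and have the same cosine coefficients, so
  \<open>cos_coefficients_zero_imp_zero\<close> identifies them; evaluation at y = 0 is the
  claim.\<close>

lemma theta_functional_equation:
  fixes x :: real
  assumes x: "x > 0"
  shows "1 + 2 * (\<Sum>k. exp (- pi * (real (Suc k))\<^sup>2 * x))
    = (1 + 2 * (\<Sum>k. exp (- pi * (real (Suc k))\<^sup>2 / x))) / sqrt x"
proof -
  define G where "G = (\<lambda>u. exp (- pi * x * u\<^sup>2))"
  \<comment> \<open>Summed over n, this is the sum of G (m + y) over all integers m, with negative m
    reflected by evenness of G. That sum is symmetric about y = 0 and y = 1/2, so the interval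
    [0, 1/2] carries all of it.\<close>
  define f where "f = (\<lambda>n y. G (real n + y) + G (real n + 1 - y))"
  define g where "g = (\<lambda>k y. (2 / sqrt x) * exp (- pi * (real (Suc k))\<^sup>2 / x) * cos (2 * pi * real (Suc k) * y))"
  have contG: "continuous_on A G" for A unfolding G_def by (intro continuous_intros)
  have contf: "continuous_on A (f n)" for A n unfolding f_def G_def by (intro continuous_intros)
  have contg: "continuous_on A (g k)" for A k unfolding g_def by (intro continuous_intros)
  have sq: "real n \<le> (real n)\<^sup>2" for n using self_le_power[of "real n" 2] by (cases n) auto
  have geo: "exp (- (c * (real n)\<^sup>2)) \<le> exp (- c) ^ n" if "c > 0" for c n
    using that sq[of n] by (simp add: exp_of_nat_mult[symmetric] mult.commute)
  define Mf where "Mf = (\<lambda>n. 2 * exp (- (pi * x)) ^ n)"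
  have Mf: "summable Mf" unfolding Mf_def using x by (intro summable_mult summable_geometric) auto
  have lef: "\<bar>f n y\<bar> \<le> Mf n" if y: "y \<in> {0..1/2}" for n y
  proof -
    have "(real n)\<^sup>2 \<le> (real n + y)\<^sup>2" "(real n)\<^sup>2 \<le> (real n + 1 - y)\<^sup>2"
      using y by (auto intro!: power_mono)
    then have "G (real n + y) \<le> exp (- (pi * x * (real n)\<^sup>2))" "G (real n + 1 - y) \<le> exp (- (pi * x * (real n)\<^sup>2))"
      using x by (auto simp: G_def)
    then have "f n y \<le> 2 * exp (- (pi * x * (real n)\<^sup>2))" by (simp add: f_def)
    also have "\<dots> \<le> Mf n" unfolding Mf_def using x by (intro mult_left_mono geo) auto
    finally show ?thesis by (simp add: f_def G_def add_nonneg_nonneg)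
  qed
  define Mg where "Mg = (\<lambda>n. (2 / sqrt x) * exp (- (pi / x)) ^ Suc n)"
  have "summable (\<lambda>n. exp (- (pi / x)) ^ n)" using x by (intro summable_geometric) auto
  then have Mg: "summable Mg" unfolding Mg_def by (intro summable_mult) (simp only: summable_Suc_iff)
  have leg: "\<bar>g n y\<bar> \<le> Mg n" for n y
  proof -
    have "\<bar>g n y\<bar> \<le> (2 / sqrt x) * exp (- pi * (real (Suc n))\<^sup>2 / x) * 1"
      unfolding g_def abs_mult using x by (intro mult_mono) (auto simp del: of_nat_Suc)
    also have "\<dots> \<le> Mg n" unfolding Mg_def
      using geo[of "pi / x" "Suc n"] x by (simp del: of_nat_Suc power_Suc add: divide_right_mono)
    finally show ?thesis .
  qed
  define C where "C = (\<lambda>j y. cos (2 * pi * real j * y))"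
  have contC: "continuous_on A (C j)" for A j unfolding C_def by (intro continuous_intros)
  have C1: "\<bar>C j y\<bar> \<le> 1" for j y by (simp add: C_def)
  have mulC: "\<bar>a * C j y\<bar> \<le> m" if "\<bar>a\<bar> \<le> m" for a m j y
    using mult_mono[OF that C1[of j y]] that by (simp add: abs_mult)
  have coef: "(1/2 * exp (- pi * (real j)\<^sup>2 / x)) / sqrt x = exp (- (2 * pi * real j)\<^sup>2 / (4 * pi * x)) / (2 * sqrt x)" for j
    using x by (simp add: power_mult_distrib power2_eq_square field_simps)
  have fcoef: "integral {0..1/2} (\<lambda>y. (\<Sum>n. f n y) * C j y) = (1/2 * exp (- pi * (real j)\<^sup>2 / x)) / sqrt x" for j
  proof -
    let ?H = "\<lambda>u. G u * C j u"
    have contH: "continuous_on A ?H" for A by (intro continuous_intros contG contC)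
    have ii: "?H integrable_on {a..b}" for a b by (intro integrable_continuous_interval contH)
    have "(\<lambda>n. integral {0..1/2} (\<lambda>y. f n y * C j y)) sums integral {0..1/2} (\<lambda>y. \<Sum>n. f n y * C j y)"
      by (rule series_integral_M_test(2)[OF _ _ Mf])
         (use lef contf contC in \<open>auto intro!: continuous_intros mulC\<close>)
    moreover have "(\<Sum>n. f n y * C j y) = (\<Sum>n. f n y) * C j y" if "y \<in> {0..1/2}" for y
      using suminf_mult2[OF summable_rabs_cancel[OF summable_comparison_test'[OF Mf, of 0 "\<lambda>n. \<bar>f n y\<bar>"]], of "C j y"]
        lef[OF that] by simp
    then have "integral {0..1/2} (\<lambda>y. \<Sum>n. f n y * C j y) = integral {0..1/2} (\<lambda>y. (\<Sum>n. f n y) * C j y)"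
      by (rule Henstock_Kurzweil_Integration.integral_cong)
    ultimately have s: "(\<lambda>n. integral {0..1/2} (\<lambda>y. f n y * C j y)) sums integral {0..1/2} (\<lambda>y. (\<Sum>n. f n y) * C j y)"
      by simp
    \<comment> \<open>The two parts of f n unfold to [n, n + 1/2] and, after a reflection, to
      [n + 1/2, n + 1]; the cosine is invariant under both moves.\<close>
    have piece: "integral {0..1/2} (\<lambda>y. f n y * C j y) = integral {real n..real (Suc n)} ?H" for n
    proof -
      have cj: "C j (real n + y) = C j y" "C j (real n + 1 - y) = C j y" for y
      proof -
        have "2 * pi * real j * (real n + y) = 2 * pi * real j * y + 2 * pi * real (j * n)" by (simp add: algebra_simps)
        moreover have "cos (2 * pi * real (j * n)) = 1" "sin (2 * pi * real (j * n)) = 0"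
          using cos_2npi[of "j * n"] sin_2npi[of "j * n"] by (simp_all only: mult_ac)
        ultimately show "C j (real n + y) = C j y" by (simp only: C_def cos_add mult_1_right mult_zero_right diff_zero)
        have "2 * pi * real j * (real n + 1 - y) = 2 * pi * real (j * (n + 1)) - 2 * pi * real j * y" by (simp add: algebra_simps)
        moreover have "cos (2 * pi * real (j * (n + 1))) = 1" "sin (2 * pi * real (j * (n + 1))) = 0"
          using cos_2npi[of "j * (n + 1)"] sin_2npi[of "j * (n + 1)"] by (simp_all only: mult_ac)
        ultimately show "C j (real n + 1 - y) = C j y" by (simp only: C_def cos_diff mult_1_left mult_zero_left add_0_right)
      qed
      have eq: "f n y * C j y = ?H (y + real n) + ?H (- y + (real n + 1))" for y
        using cj[of y] by (simp add: f_def algebra_simps)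
      have i1: "(\<lambda>y. ?H (y + real n)) integrable_on {0..1/2}" "(\<lambda>y. ?H (- y + (real n + 1))) integrable_on {0..1/2}"
        by (auto intro!: integrable_continuous_interval continuous_intros continuous_on_compose2[OF contG] continuous_on_compose2[OF contC])
      have "integral {0..1/2} (\<lambda>y. f n y * C j y) = integral {0..1/2} (\<lambda>y. ?H (y + real n)) + integral {0..1/2} (\<lambda>y. ?H (- y + (real n + 1)))"
        unfolding eq by (rule Henstock_Kurzweil_Integration.integral_add[OF i1])
      also have "integral {0..1/2} (\<lambda>y. ?H (y + real n)) = integral {real n..real n + 1/2} ?H"
        using integral_shift_real_ivl[of "real n" "real n" "real n + 1/2" ?H] by simp
      also have "integral {0..1/2} (\<lambda>y. ?H (- y + (real n + 1))) = integral {real n + 1/2..real n + 1} ?H"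
        using Henstock_Kurzweil_Integration.integral_reflect_real[of 0 "- 1/2" "\<lambda>v. ?H (v + (real n + 1))"]
          integral_shift_real_ivl[of "real n + 1/2" "real n + 1" "real n + 1" ?H] by simp
      also have "integral {real n..real n + 1/2} ?H + integral {real n + 1/2..real n + 1} ?H = integral {real n..real n + 1} ?H"
        by (rule Henstock_Kurzweil_Integration.integral_combine) (use ii in auto)
      finally show ?thesis by (simp add: add.commute)
    qed
    have "(\<Sum>n<N. integral {0..1/2} (\<lambda>y. f n y * C j y)) = integral {0..real N} ?H" for N
    proof (induction N)
      case (Suc N)
      have "integral {0..real N} ?H + integral {real N..real (Suc N)} ?H = integral {0..real (Suc N)} ?H"
        by (rule Henstock_Kurzweil_Integration.integral_combine) (use ii in auto)
      then show ?case using Suc piece[of N] by simp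
    qed auto
    then have "(\<lambda>N. integral {0..real N} ?H) \<longlonglongrightarrow> integral {0..1/2} (\<lambda>y. (\<Sum>n. f n y) * C j y)"
      using s by (simp add: sums_def)
    moreover have "(\<lambda>N. integral {0..real N} ?H) \<longlonglongrightarrow> (1/2 * exp (- pi * (real j)\<^sup>2 / x)) / sqrt x"
      unfolding coef using gaussian_cos_half_line[OF x, of "2 * pi * real j"] by (simp only: G_def C_def)
    ultimately show ?thesis by (rule LIMSEQ_unique)
  qed
  have cos_int: "integral {0..1/2} (\<lambda>y. cos (2 * pi * real_of_int m * y)) = 0" if "m \<noteq> 0" for m :: int
  proof -
    have "((\<lambda>y. cos (2 * pi * real_of_int m * y)) has_integral
        sin (2 * pi * real_of_int m * (1/2)) / (2 * pi * real_of_int m) - sin (2 * pi * real_of_int m * 0) / (2 * pi * real_of_int m)) {0..1/2}"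
      by (rule fundamental_theorem_of_calculus)
         (use that in \<open>auto intro!: derivative_eq_intros simp: has_real_derivative_iff_has_vector_derivative[symmetric]\<close>)
    moreover have "sin (pi * real_of_int m) = 0" using sin_zero_iff_int2[of "pi * real_of_int m"] by (auto simp: mult.commute)
    ultimately show ?thesis by (auto dest!: integral_unique)
  qed
  have orth: "integral {0..1/2} (\<lambda>y. C i y * C j y) = (if i = j then if i = 0 then 1/2 else 1/4 else 0)" for i j
  proof -
    have eq: "C i y * C j y = 1/2 * cos (2 * pi * real_of_int (int i - int j) * y) + 1/2 * cos (2 * pi * real_of_int (int i + int j) * y)" for y
      by (simp add: C_def cos_times_cos algebra_simps)
    have "integral {0..1/2} (\<lambda>y. C i y * C j y) = 1/2 * integral {0..1/2} (\<lambda>y. cos (2 * pi * real_of_int (int i - int j) * y))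
        + 1/2 * integral {0..1/2} (\<lambda>y. cos (2 * pi * real_of_int (int i + int j) * y))"
      unfolding eq by (subst Henstock_Kurzweil_Integration.integral_add)
        (auto intro!: integrable_continuous_interval continuous_intros)
    then show ?thesis using cos_int[of "int i - int j"] cos_int[of "int i + int j"] by (cases "i = j") auto
  qed
  have gcoef: "integral {0..1/2} (\<lambda>y. (\<Sum>n. g n y) * C j y) = (if j = 0 then 0 else (1/2 * exp (- pi * (real j)\<^sup>2 / x)) / sqrt x)" for j
  proof -
    have "(\<lambda>n. integral {0..1/2} (\<lambda>y. g n y * C j y)) sums integral {0..1/2} (\<lambda>y. \<Sum>n. g n y * C j y)"
      by (rule series_integral_M_test(2)[OF _ _ Mg])
         (use leg contg contC in \<open>auto intro!: continuous_intros mulC\<close>)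
    moreover have "(\<Sum>n. g n y * C j y) = (\<Sum>n. g n y) * C j y" for y
      using suminf_mult2[OF summable_rabs_cancel[OF summable_comparison_test'[OF Mg, of 0 "\<lambda>n. \<bar>g n y\<bar>"]], of "C j y"]
        leg by simp
    moreover have "integral {0..1/2} (\<lambda>y. g n y * C j y) = (2 / sqrt x) * exp (- pi * (real (Suc n))\<^sup>2 / x) * (if Suc n = j then 1/4 else 0)" for n
    proof -
      have "integral {0..1/2} (\<lambda>y. g n y * C j y) = integral {0..1/2} (\<lambda>y. (2 / sqrt x) * exp (- pi * (real (Suc n))\<^sup>2 / x) * (C (Suc n) y * C j y))"
        by (simp add: g_def C_def mult_ac)
      also have "\<dots> = (2 / sqrt x) * exp (- pi * (real (Suc n))\<^sup>2 / x) * integral {0..1/2} (\<lambda>y. C (Suc n) y * C j y)"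
        by (rule Henstock_Kurzweil_Integration.integral_mult_right)
      finally show ?thesis unfolding orth by simp
    qed
    ultimately have "(\<lambda>n. (2 / sqrt x) * exp (- pi * (real (Suc n))\<^sup>2 / x) * (if Suc n = j then 1/4 else 0)) sums integral {0..1/2} (\<lambda>y. (\<Sum>n. g n y) * C j y)"
      by simp
    moreover have "(\<lambda>n. (2 / sqrt x) * exp (- pi * (real (Suc n))\<^sup>2 / x) * (if Suc n = j then 1/4 else 0)) sums (if j = 0 then 0 else (1/2 * exp (- pi * (real j)\<^sup>2 / x)) / sqrt x)"
    proof (cases j)
      case (Suc i)
      have "(\<lambda>n. (2 / sqrt x) * exp (- pi * (real (Suc n))\<^sup>2 / x) * (if Suc n = j then 1/4 else 0)) =
        (\<lambda>n. if n = i then (1/2 * exp (- pi * (real (Suc n))\<^sup>2 / x)) / sqrt x else 0)"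
        using Suc by (auto simp: fun_eq_iff)
      then show ?thesis using sums_single[of i "\<lambda>n. (1/2 * exp (- pi * (real (Suc n))\<^sup>2 / x)) / sqrt x"] Suc by simp
    qed auto
    ultimately show ?thesis by (rule sums_unique2)
  qed
  \<comment> \<open>The series of g starts at frequency 1; 1 / sqrt x is the term of frequency
    0.\<close>
  define D where "D = (\<lambda>y. (\<Sum>n. f n y) - (\<Sum>n. g n y) - 1 / sqrt x)"
  have cf: "continuous_on {0..1/2} (\<lambda>y. \<Sum>n. f n y)" by (rule series_integral_M_test(1)[OF contf lef Mf])
  have cg: "continuous_on {0..1/2} (\<lambda>y. \<Sum>n. g n y)" by (rule series_integral_M_test(1)[OF contg leg Mg])
  have "D 0 = 0"
  proof (rule cos_coefficients_zero_imp_zero[of D])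
    show "continuous_on {0..1/2} D" unfolding D_def by (intro continuous_intros cf cg)
    fix j
    have int: "(\<lambda>y. h y * C j y) integrable_on {0..1/2}" if "continuous_on {0..1/2} h" for h
      by (intro integrable_continuous_interval continuous_intros contC that)
    have "integral {0..1/2} (\<lambda>y. D y * C j y) = integral {0..1/2} (\<lambda>y. (\<Sum>n. f n y) * C j y - (\<Sum>n. g n y) * C j y - 1 / sqrt x * C j y)"
      by (simp add: D_def algebra_simps)
    also have "\<dots> = integral {0..1/2} (\<lambda>y. (\<Sum>n. f n y) * C j y) - integral {0..1/2} (\<lambda>y. (\<Sum>n. g n y) * C j y) - integral {0..1/2} (\<lambda>y. 1 / sqrt x * C j y)"
      using int[OF cf] int[OF cg] int[of "\<lambda>_. 1 / sqrt x"]
      by (simp add: Henstock_Kurzweil_Integration.integral_diff integrable_diff)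
    also have "integral {0..1/2} (\<lambda>y. 1 / sqrt x * C j y) = 1 / sqrt x * (if j = 0 then 1/2 else 0)"
      using orth[of 0 j] by (simp add: C_def)
    finally have "integral {0..1/2} (\<lambda>y. D y * C j y) = 0" unfolding fcoef gcoef by simp
    then show "integral {0..1/2} (\<lambda>y. D y * cos (2 * pi * real j * y)) = 0" by (simp only: C_def)
  qed auto
  moreover have "(\<Sum>n. f n 0) = 1 + 2 * (\<Sum>k. exp (- pi * (real (Suc k))\<^sup>2 * x))"
  proof -
    have "summable (\<lambda>n. exp (- pi * (real n)\<^sup>2 * x))"
    proof (rule summable_comparison_test'[OF Mf, of 0])
      fix n show "norm (exp (- pi * (real n)\<^sup>2 * x)) \<le> Mf n"
        using lef[of 0 n] by (simp add: f_def G_def mult_ac) (smt (verit) exp_gt_zero)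
    qed
    then have s1: "summable (\<lambda>n. exp (- pi * (real (Suc n))\<^sup>2 * x))" by (subst summable_Suc_iff)
    have "(\<Sum>n. f n 0) = (\<Sum>n. exp (- pi * (real n)\<^sup>2 * x) + exp (- pi * (real (Suc n))\<^sup>2 * x))"
      by (simp add: f_def G_def algebra_simps)
    also have "\<dots> = (\<Sum>n. exp (- pi * (real n)\<^sup>2 * x)) + (\<Sum>n. exp (- pi * (real (Suc n))\<^sup>2 * x))"
      by (rule suminf_add[symmetric]) fact+
    also have "(\<Sum>n. exp (- pi * (real n)\<^sup>2 * x)) = 1 + (\<Sum>n. exp (- pi * (real (Suc n))\<^sup>2 * x))"
      using suminf_split_head[OF \<open>summable (\<lambda>n. exp (- pi * (real n)\<^sup>2 * x))\<close>] by simp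
    finally show ?thesis by simp
  qed
  moreover have "(\<Sum>n. g n 0) = (2 / sqrt x) * (\<Sum>k. exp (- pi * (real (Suc k))\<^sup>2 / x))"
  proof -
    have "summable (\<lambda>k. exp (- pi * (real (Suc k))\<^sup>2 / x))"
    proof (rule summable_comparison_test'[OF summable_mult[OF Mg, of "sqrt x / 2"], of 0])
      fix n show "norm (exp (- pi * (real (Suc n))\<^sup>2 / x)) \<le> sqrt x / 2 * Mg n"
        using leg[of n 0] x by (simp add: g_def field_simps del: of_nat_Suc)
    qed
    from suminf_mult[OF this, of "2 / sqrt x"] show ?thesis by (simp add: g_def)
  qed
  ultimately show ?thesis by (simp add: D_def add_divide_distrib)
qed

section \<open>Evenness, positivity and decay of Phi\<close>

lemma summable_power_gaussian:
  assumes "c > 0" "m \<le> 4"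
  shows "summable (\<lambda>k. real (Suc k) ^ m * exp (- c * (real (Suc k))\<^sup>2))"
proof -
  have "(\<lambda>n. real n ^ 4 * exp (- c * (real n)\<^sup>2)) \<in> O(\<lambda>n. 1 / real n ^ 2)"
    using \<open>c > 0\<close> by real_asymp
  then have "summable (\<lambda>n. real n ^ 4 * exp (- c * (real n)\<^sup>2))"
    by (rule summable_comparison_test_bigo[rotated]) (use inverse_power_summable[of 2, where ?'a = real] in \<open>simp add: field_simps\<close>)
  then have "summable (\<lambda>k. real (Suc k) ^ 4 * exp (- c * (real (Suc k))\<^sup>2))"
    by (subst summable_Suc_iff)
  then show ?thesis
    by (rule summable_comparison_test'[of _ 0])
       (use assms in \<open>auto intro!: mult_right_mono power_increasing simp del: of_nat_Suc\<close>)
qed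

text \<open>For j = 0, \<open>exp u + 2 * theta_sum 0 u\<close> is exp u times Jacobi's theta
  function at exp (4 u), a combination that is even in u; j = 1 and j = 2 arise by differentiating
  it.\<close>

definition theta_sum :: "nat \<Rightarrow> real \<Rightarrow> real" where
  "theta_sum j u = (\<Sum>k. real (Suc k) ^ (2 * j) * exp (u - pi * (real (Suc k))\<^sup>2 * exp (4 * u)))"

lemma theta_sum_summable:
  assumes "j \<le> 2"
  shows "summable (\<lambda>k. real (Suc k) ^ (2 * j) * exp (u - pi * (real (Suc k))\<^sup>2 * exp (4 * u)))"
proof -
  have "summable (\<lambda>k. exp u * (real (Suc k) ^ (2 * j) * exp (- (pi * exp (4 * u)) * (real (Suc k))\<^sup>2)))"
    using assms by (intro summable_mult summable_power_gaussian) auto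
  then show ?thesis by (simp add: exp_diff exp_minus field_simps del: of_nat_Suc)
qed

lemma theta_sum_deriv:
  assumes j: "j \<le> 1"
  shows "(theta_sum j has_real_derivative theta_sum j u - 4 * pi * exp (4 * u) * theta_sum (Suc j) u) (at u)"
proof -
  define B where "B = \<bar>u\<bar> + 1"
  define n where "n = (\<lambda>k. real (Suc k))"
  have n1: "n k \<ge> 1" for k by (simp add: n_def)
  define f where "f = (\<lambda>k u. n k ^ (2 * j) * exp (u - pi * (n k)\<^sup>2 * exp (4 * u)))"
  define f' where "f' = (\<lambda>k u. f k u - 4 * pi * exp (4 * u) * (n k ^ (2 * Suc j) * exp (u - pi * (n k)\<^sup>2 * exp (4 * u))))"
  define c where "c = pi * exp (- 4 * B)"
  define K where "K = exp B * (1 + 4 * pi * exp (4 * B))"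
  have c: "c > 0" by (simp add: c_def)
  have le: "norm (f' k v) \<le> K * (n k ^ 4 * exp (- c * (n k)\<^sup>2))" if v: "v \<in> {-B<..<B}" for k v
  proof -
    have "exp (v - pi * (n k)\<^sup>2 * exp (4 * v)) \<le> exp (B - c * (n k)\<^sup>2)"
    proof -
      have "c \<le> pi * exp (4 * v)" using v by (simp add: c_def)
      then have "c * (n k)\<^sup>2 \<le> pi * exp (4 * v) * (n k)\<^sup>2" by (rule mult_right_mono) simp
      then show ?thesis using v by (simp add: mult_ac)
    qed
    then have e: "exp (v - pi * (n k)\<^sup>2 * exp (4 * v)) \<le> exp B * exp (- c * (n k)\<^sup>2)" by (simp add: exp_diff exp_minus field_simps)
    have p: "n k ^ (2 * j) \<le> n k ^ 4" "n k ^ (2 * Suc j) \<le> n k ^ 4"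
      by (rule power_increasing, use j n1[of k] in simp, rule n1)+
    have n0: "n k \<ge> 0" using n1[of k] by simp
    have a: "f k v \<le> n k ^ 4 * (exp B * exp (- c * (n k)\<^sup>2))" unfolding f_def
      by (intro mult_mono e p) (use n0 in auto)
    have b: "4 * pi * exp (4 * v) * (n k ^ (2 * Suc j) * exp (v - pi * (n k)\<^sup>2 * exp (4 * v)))
       \<le> 4 * pi * exp (4 * B) * (n k ^ 4 * (exp B * exp (- c * (n k)\<^sup>2)))"
      by (intro mult_mono e p) (use n0 v in auto)
    have "norm (f' k v) \<le> f k v + 4 * pi * exp (4 * v) * (n k ^ (2 * Suc j) * exp (v - pi * (n k)\<^sup>2 * exp (4 * v)))"
      using n0 by (auto simp: f'_def f_def abs_le_iff intro!: add_nonneg_nonneg)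
    also have "\<dots> \<le> K * (n k ^ 4 * exp (- c * (n k)\<^sup>2))" using add_mono[OF a b] by (simp add: K_def algebra_simps)
    finally show ?thesis .
  qed
  have "((\<lambda>v. \<Sum>k. f k v) has_field_derivative (\<Sum>k. f' k u)) (at u)"
  proof (rule has_field_derivative_series'(2)[where S = "{-B<..<B}" and ?x0.0 = u])
    show "convex {-B<..<B}" by simp
    show "(f k has_real_derivative f' k v) (at v within {-B<..<B})" for k v
      unfolding f'_def f_def
      by (auto intro!: derivative_eq_intros simp: algebra_simps power2_eq_square)
    show "uniformly_convergent_on {-B<..<B} (\<lambda>n v. \<Sum>k<n. f' k v)"
      by (rule Weierstrass_m_test'[OF le])
         (use summable_mult[OF summable_power_gaussian[OF c, of 4], of K] in \<open>auto simp: n_def\<close>)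
    show "summable (\<lambda>k. f k u)" unfolding f_def n_def by (rule theta_sum_summable) (use j in auto)
  qed (auto simp: B_def)
  moreover have "(\<Sum>k. f' k u) = theta_sum j u - 4 * pi * exp (4 * u) * theta_sum (Suc j) u"
    unfolding f'_def f_def n_def theta_sum_def
    using theta_sum_summable[of j u] theta_sum_summable[of "Suc j" u] j
    by (subst suminf_diff[symmetric] suminf_mult[symmetric]; (intro summable_mult)?; simp)+
  ultimately show ?thesis unfolding f_def n_def by (simp add: theta_sum_def[abs_def])
qed

lemma newman_Phi_theta_sum:
  "newman_Phi u = 2 * pi\<^sup>2 * exp (8 * u) * theta_sum 2 u - 3 * pi * exp (4 * u) * theta_sum 1 u"
proof -
  have s: "summable (\<lambda>k. real (Suc k) ^ (2 * j) * exp (u - pi * (real (Suc k))\<^sup>2 * exp (4 * u)))" if "j \<le> 2" for j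
    using theta_sum_summable[OF that] .
  have "2 * pi\<^sup>2 * exp (8 * u) * theta_sum 2 u - 3 * pi * exp (4 * u) * theta_sum 1 u =
    (\<Sum>k. 2 * pi\<^sup>2 * exp (8 * u) * (real (Suc k) ^ (2 * 2) * exp (u - pi * (real (Suc k))\<^sup>2 * exp (4 * u)))
      - 3 * pi * exp (4 * u) * (real (Suc k) ^ (2 * 1) * exp (u - pi * (real (Suc k))\<^sup>2 * exp (4 * u))))"
    unfolding theta_sum_def using s[of 2] s[of 1]
    by (subst suminf_mult[symmetric, OF s], simp)+ (rule suminf_diff; intro summable_mult s; simp)
  also have "\<dots> = newman_Phi u"
    unfolding newman_Phi_def Let_def
  proof (rule suminf_cong)
    fix k
    define n where "n = real (Suc k)"
    have e: "exp (8 * u) * exp u = exp (9 * u)" "exp (4 * u) * exp u = exp (5 * u)"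
      by (simp_all flip: exp_add)
    show "2 * pi\<^sup>2 * exp (8 * u) * (real (Suc k) ^ (2 * 2) * exp (u - pi * (real (Suc k))\<^sup>2 * exp (4 * u)))
      - 3 * pi * exp (4 * u) * (real (Suc k) ^ (2 * 1) * exp (u - pi * (real (Suc k))\<^sup>2 * exp (4 * u)))
      = (2 * pi\<^sup>2 * real (Suc k) ^ 4 * exp (9 * u) - 3 * pi * (real (Suc k))\<^sup>2 * exp (5 * u)) *
         exp (- pi * (real (Suc k))\<^sup>2 * exp (4 * u))"
      unfolding n_def[symmetric] e[symmetric] by (simp add: exp_diff exp_minus field_simps power2_eq_square power4_eq_xxxx)
  qed
  finally show ?thesis by simp
qed

text \<open>Let W be \<open>exp u + 2 * theta_sum 0 u\<close>. The theta functional equation makes W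
  even, and differentiating twice gives W'' = W + 16 Phi, so Phi inherits evenness.\<close>

lemma newman_Phi_even: "newman_Phi (- u) = newman_Phi u"
proof -
  define W where "W = (\<lambda>u. exp u + 2 * theta_sum 0 u)"
  define W1 where "W1 = (\<lambda>u. exp u + 2 * (theta_sum 0 u - 4 * pi * exp (4 * u) * theta_sum 1 u))"
  have W1: "(W has_real_derivative W1 u) (at u)" for u
    unfolding W_def W1_def using theta_sum_deriv[of 0 u] by (auto intro!: derivative_eq_intros)
  have W2: "(W1 has_real_derivative W u + 16 * newman_Phi u) (at u)" for u
  proof -
    have e: "exp (8 * u) = exp (4 * u) * exp (4 * u)" "exp (u * 8) = exp (u * 4) * exp (u * 4)"
      using exp_add[of "4 * u" "4 * u"] exp_add[of "u * 4" "u * 4"] by (simp_all add: mult.commute)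
    show ?thesis
      unfolding W1_def using theta_sum_deriv[of 0 u] theta_sum_deriv[of 1 u]
      by (auto intro!: derivative_eq_intros simp: W_def newman_Phi_theta_sum numeral_2_eq_2 algebra_simps e power2_eq_square)
  qed
  have Wth: "W u = exp u * (1 + 2 * (\<Sum>k. exp (- pi * (real (Suc k))\<^sup>2 * exp (4 * u))))" for u
  proof -
    have "summable (\<lambda>k. exp (- pi * (real (Suc k))\<^sup>2 * exp (4 * u)))"
      using summable_power_gaussian[of "pi * exp (4 * u)" 0] by (simp add: mult_ac)
    from suminf_mult[OF this, of "exp u"] show ?thesis
      by (simp add: W_def theta_sum_def exp_diff exp_minus field_simps)
  qed
  have even: "W (- u) = W u" for u
  proof -
    have s: "sqrt (exp (4 * u)) = exp (2 * u)"
      by (rule real_sqrt_unique) (simp_all add: exp_double[symmetric] flip: exp_of_nat_mult)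
    have "W u = exp u * ((1 + 2 * (\<Sum>k. exp (- pi * (real (Suc k))\<^sup>2 / exp (4 * u)))) / exp (2 * u))"
      unfolding Wth theta_functional_equation[of "exp (4 * u)", OF exp_gt_zero] s ..
    also have "\<dots> = exp (- u) * (1 + 2 * (\<Sum>k. exp (- pi * (real (Suc k))\<^sup>2 * exp (4 * - u))))"
    proof -
      have "exp u / exp (2 * u) = exp (- u)" by (simp flip: exp_diff)
      then show ?thesis by (simp add: exp_minus field_simps)
    qed
    also have "\<dots> = W (- u)" by (rule Wth[symmetric])
    finally show ?thesis by simp
  qed
  have W1odd: "W1 (- u) = - W1 u" for u
  proof -
    have "((\<lambda>v. W (- v)) has_real_derivative W1 (- u) * (- 1)) (at u)"
      by (rule DERIV_chain'[OF _ W1]) (auto intro!: derivative_eq_intros)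
    then have "(W has_real_derivative - W1 (- u)) (at u)" by (simp add: even)
    from DERIV_unique[OF this W1] show ?thesis by simp
  qed
  have "((\<lambda>v. - W1 (- v)) has_real_derivative - ((W (- u) + 16 * newman_Phi (- u)) * (- 1))) (at u)"
    by (rule DERIV_minus, rule DERIV_chain'[OF _ W2]) (auto intro!: derivative_eq_intros)
  then have "(W1 has_real_derivative W (- u) + 16 * newman_Phi (- u)) (at u)" by (simp add: W1odd add.commute)
  from DERIV_unique[OF this W2] show ?thesis by (simp add: even)
qed

lemma theta_sum_nonneg: "theta_sum j u \<ge> 0" if "j \<le> 2"
  unfolding theta_sum_def using theta_sum_summable[OF that] by (intro suminf_nonneg) auto

lemma newman_Phi_summand_pos:
  assumes u: "u \<ge> 0" and n: "n \<ge> 1"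
  shows "0 < (2 * pi\<^sup>2 * n ^ 4 * exp (9 * u) - 3 * pi * n\<^sup>2 * exp (5 * u)) * exp (- pi * n\<^sup>2 * exp (4 * u))"
proof -
  have e: "exp (9 * u) = exp (5 * u) * exp (4 * u)" "exp (u * 9) = exp (u * 5) * exp (u * 4)"
    using exp_add[of "5 * u" "4 * u"] exp_add[of "u * 5" "u * 4"] by (simp_all add: mult.commute)
  have "1 * 1 \<le> n\<^sup>2 * exp (4 * u)" using assms by (intro mult_mono one_le_power) auto
  then have "2 * pi * (n\<^sup>2 * exp (4 * u)) > 3" using pi_gt3 mult_left_mono[of 1 "n\<^sup>2 * exp (4 * u)" "2 * pi"] by linarith
  then have "pi * n\<^sup>2 * exp (5 * u) * (2 * pi * (n\<^sup>2 * exp (4 * u)) - 3) > 0" using n by simp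
  also have "pi * n\<^sup>2 * exp (5 * u) * (2 * pi * (n\<^sup>2 * exp (4 * u)) - 3) = 2 * pi\<^sup>2 * n ^ 4 * exp (9 * u) - 3 * pi * n\<^sup>2 * exp (5 * u)"
    by (simp add: e algebra_simps power2_eq_square power4_eq_xxxx)
  finally show ?thesis by simp
qed

lemma newman_Phi_pos:
  assumes "u \<ge> 0"
  shows "newman_Phi u > 0"
proof -
  let ?f = "\<lambda>k. (2 * pi\<^sup>2 * real (Suc k) ^ 4 * exp (9 * u) - 3 * pi * (real (Suc k))\<^sup>2 * exp (5 * u)) * exp (- pi * (real (Suc k))\<^sup>2 * exp (4 * u))"
  have "summable ?f"
  proof -
    have "summable (\<lambda>k. 2 * pi\<^sup>2 * exp (9 * u) * (real (Suc k) ^ 4 * exp (- (pi * exp (4 * u)) * (real (Suc k))\<^sup>2))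
       - 3 * pi * exp (5 * u) * (real (Suc k) ^ 2 * exp (- (pi * exp (4 * u)) * (real (Suc k))\<^sup>2)))"
      by (intro summable_diff summable_mult summable_power_gaussian) auto
    then show ?thesis by (simp add: algebra_simps del: of_nat_Suc)
  qed
  then show ?thesis unfolding newman_Phi_def Let_def
    by (rule suminf_pos) (rule newman_Phi_summand_pos[OF assms], simp)
qed

text \<open>For u >= 0 the doubly exponential decay beats every Gaussian; the other half-line
  follows by evenness.\<close>

lemma newman_Phi_bound: "\<exists>C. \<forall>u. \<bar>newman_Phi u\<bar> \<le> C * exp (- K * u\<^sup>2)"
proof -
  define A where "A = (\<Sum>k. real (Suc k) ^ 4 * exp (- (pi / 2) * (real (Suc k))\<^sup>2))"
  have le: "theta_sum 2 u \<le> exp (u - pi / 2 * exp (4 * u)) * A" if u: "u \<ge> 0" for u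
  proof -
    have sA: "summable (\<lambda>k. real (Suc k) ^ 4 * exp (- (pi / 2) * (real (Suc k))\<^sup>2))"
      by (intro summable_power_gaussian) auto
    have "theta_sum 2 u \<le> (\<Sum>k. exp (u - pi / 2 * exp (4 * u)) * (real (Suc k) ^ 4 * exp (- (pi / 2) * (real (Suc k))\<^sup>2)))"
      unfolding theta_sum_def
    proof (rule suminf_le)
      fix k
      define n where "n = real (Suc k)"
      have n: "n \<ge> 1" by (simp add: n_def)
      \<comment> \<open>This product separates n from u: with E = exp (4 u) it gives n^2 E >= n^2 +
        E - 1 >= (n^2 + E) / 2, leaving a convergent series in n times a doubly exponential factor
        in u.\<close>
      have "(n\<^sup>2 - 1) * (exp (4 * u) - 1) \<ge> 0" using n u by (intro mult_nonneg_nonneg) auto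
      moreover have "n\<^sup>2 \<ge> 1" "exp (4 * u) \<ge> 1" using n u by auto
      moreover have "(n\<^sup>2 - 1) * (exp (4 * u) - 1) = n\<^sup>2 * exp (4 * u) - n\<^sup>2 - exp (4 * u) + 1" by (simp add: algebra_simps)
      ultimately have "n\<^sup>2 * exp (4 * u) \<ge> n\<^sup>2 / 2 + exp (4 * u) / 2" by linarith
      then have "pi * (n\<^sup>2 * exp (4 * u)) \<ge> pi * (n\<^sup>2 / 2 + exp (4 * u) / 2)" by (rule mult_left_mono) simp
      then have "exp (u - pi * n\<^sup>2 * exp (4 * u)) \<le> exp (u - pi / 2 * exp (4 * u) + - (pi / 2) * n\<^sup>2)"
        by (simp add: algebra_simps)
      also have "\<dots> = exp (u - pi / 2 * exp (4 * u)) * exp (- (pi / 2) * n\<^sup>2)" by (rule exp_add)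
      finally have "n ^ 4 * exp (u - pi * n\<^sup>2 * exp (4 * u)) \<le> n ^ 4 * (exp (u - pi / 2 * exp (4 * u)) * exp (- (pi / 2) * n\<^sup>2))"
        by (rule mult_left_mono) simp
      then show "real (Suc k) ^ (2 * 2) * exp (u - pi * (real (Suc k))\<^sup>2 * exp (4 * u)) \<le>
        exp (u - pi / 2 * exp (4 * u)) * (real (Suc k) ^ 4 * exp (- (pi / 2) * (real (Suc k))\<^sup>2))"
        by (simp add: n_def mult_ac)
    qed (use sA theta_sum_summable[of 2 u] in \<open>auto intro: summable_mult\<close>)
    also have "\<dots> = exp (u - pi / 2 * exp (4 * u)) * A" unfolding A_def by (rule suminf_mult[OF sA])
    finally show ?thesis .
  qed
  have A: "A \<ge> 0" unfolding A_def by (intro suminf_nonneg summable_power_gaussian) auto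
  define T where "T = (\<lambda>u. exp (9 * u - pi / 2 * exp (4 * u) + K * u\<^sup>2))"
  have "(T \<longlongrightarrow> 0) at_top" unfolding T_def by real_asymp
  then have "eventually (\<lambda>u. T u < 1) at_top" by (rule order_tendstoD) simp
  then obtain U where U: "\<And>u. u \<ge> U \<Longrightarrow> T u < 1" by (auto simp: eventually_at_top_linorder)
  have "compact (T ` {0..U})" by (intro compact_continuous_image compact_Icc) (auto simp: T_def intro!: continuous_intros)
  then have "bounded (T ` {0..U})" by (rule compact_imp_bounded)
  then obtain D where "\<forall>x\<in>T ` {0..U}. norm x \<le> D" unfolding bounded_iff by blast
  then have D: "\<bar>T u\<bar> \<le> D" if "u \<in> {0..U}" for u using that by simp
  define E where "E = max D 1"
  have TE: "T u \<le> E" if "u \<ge> 0" for u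
    using U[of u] D[of u] that by (cases "u \<ge> U") (auto simp: E_def)
  define C where "C = 2 * pi\<^sup>2 * A * E"
  have pos: "\<bar>newman_Phi u\<bar> \<le> C * exp (- K * u\<^sup>2)" if u: "u \<ge> 0" for u
  proof -
    have "\<bar>newman_Phi u\<bar> = newman_Phi u" using newman_Phi_pos[OF u] by simp
    also have "\<dots> \<le> 2 * pi\<^sup>2 * exp (8 * u) * theta_sum 2 u"
      unfolding newman_Phi_theta_sum using theta_sum_nonneg[of 1 u] by simp
    also have "\<dots> \<le> 2 * pi\<^sup>2 * exp (8 * u) * (exp (u - pi / 2 * exp (4 * u)) * A)"
      by (intro mult_left_mono le u) auto
    also have "\<dots> = 2 * pi\<^sup>2 * A * (exp (8 * u) * exp (u - pi / 2 * exp (4 * u)))" by (simp add: mult_ac)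
    also have "exp (8 * u) * exp (u - pi / 2 * exp (4 * u)) = T u * exp (- K * u\<^sup>2)"
      unfolding T_def by (simp flip: exp_add)
    also have "2 * pi\<^sup>2 * A * (T u * exp (- K * u\<^sup>2)) \<le> 2 * pi\<^sup>2 * A * (E * exp (- K * u\<^sup>2))"
      by (intro mult_left_mono mult_right_mono TE u) (use A in auto)
    finally show ?thesis by (simp add: C_def mult_ac)
  qed
  have "\<bar>newman_Phi u\<bar> \<le> C * exp (- K * u\<^sup>2)" for u
    using pos[of u] pos[of "- u"] newman_Phi_even[of u] by (cases "u \<ge> 0") auto
  then show ?thesis by blast
qed

lemma newman_Phi_measurable [measurable]: "newman_Phi \<in> borel_measurable borel"
  unfolding newman_Phi_def[abs_def] Let_def by measurable

section \<open>De Bruijn's theorem\<close>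

text \<open>The difference of the logarithms has derivative y - tanh y, which is nonnegative for y
  >= 0. The bound dominates cosh (c u)^m by exp (l u^2) when m c^2 = 2 l.\<close>

lemma cosh_le_exp_half_square:
  fixes x :: real
  shows "cosh x \<le> exp (x\<^sup>2 / 2)"
proof -
  have tanh: "tanh x \<le> x" if "x \<ge> 0" for x :: real
  proof -
    have "0 - tanh 0 \<le> x - tanh x"
    proof (rule DERIV_nonneg_imp_nondecreasing[OF that])
      fix y :: real
      have "((\<lambda>y. y - tanh y) has_real_derivative 1 - (1 - (tanh y)\<^sup>2)) (at y)"
        by (auto intro!: derivative_eq_intros)
      then show "\<exists>d. ((\<lambda>y. y - tanh y) has_real_derivative d) (at y) \<and> 0 \<le> d"
        by (intro exI[of _ "1 - (1 - (tanh y)\<^sup>2)"]) simp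
    qed
    then show ?thesis by simp
  qed
  have pos: "cosh x \<le> exp (x\<^sup>2 / 2)" if "x \<ge> 0" for x :: real
  proof -
    have "0\<^sup>2 / 2 - ln (cosh 0) \<le> x\<^sup>2 / 2 - ln (cosh x)"
    proof (rule DERIV_nonneg_imp_nondecreasing[OF that])
      fix y :: real assume y: "0 \<le> y"
      have "((\<lambda>y. y\<^sup>2 / 2 - ln (cosh y)) has_real_derivative y - tanh y) (at y)"
        by (auto intro!: derivative_eq_intros simp: tanh_def field_simps)
      then show "\<exists>d. ((\<lambda>y. y\<^sup>2 / 2 - ln (cosh y)) has_real_derivative d) (at y) \<and> 0 \<le> d"
        using tanh[OF y] by (intro exI[of _ "y - tanh y"]) simp
    qed
    then have "ln (cosh x) \<le> x\<^sup>2 / 2" by simp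
    then have "exp (ln (cosh x)) \<le> exp (x\<^sup>2 / 2)" by (simp only: exp_le_cancel_iff)
    then show ?thesis by simp
  qed
  show ?thesis using pos[of "\<bar>x\<bar>"] by (cases "x \<ge> 0") auto
qed

section \<open>Kernels of super-Gaussian decay and their cosine transforms\<close>

lemma integrable_exp_neg_square:
  assumes "c > 0"
  shows "integrable lborel (\<lambda>u::real. exp (- c * u\<^sup>2))"
  using gaussian_fourier(1)[of "c / pi" 0] assms by simp

text \<open>The class is closed under multiplication by cosh (c u) and by exp (l u^2) for every real
  l, and decay against every Gaussian gives the transforms the growth required by
  \<open>real_zeros_norm_mono\<close>. Sign and decay concern u >= 0 only, because the transform
  integrates over that half-line.\<close>

definition gaussian_kernel :: "(real \<Rightarrow> real) \<Rightarrow> bool" where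
  "gaussian_kernel K \<longleftrightarrow> K \<in> borel_measurable borel \<and> (\<forall>u\<ge>0. K u > 0) \<and>
     (\<forall>k. \<exists>C. \<forall>u\<ge>0. K u \<le> C * exp (- k * u\<^sup>2))"

definition cosine_transform :: "(real \<Rightarrow> real) \<Rightarrow> complex \<Rightarrow> complex" where
  "cosine_transform K z = (LBINT u:{0..}. of_real (K u) * cos (z * of_real u))"

lemma gaussian_kernel_mult_exp:
  assumes K: "gaussian_kernel K" shows "gaussian_kernel (\<lambda>u. exp (l * u\<^sup>2) * K u)"
  unfolding gaussian_kernel_def
proof (intro conjI allI impI)
  show "(\<lambda>u. exp (l * u\<^sup>2) * K u) \<in> borel_measurable borel" using K by (auto simp: gaussian_kernel_def)
  show "exp (l * u\<^sup>2) * K u > 0" if "u \<ge> 0" for u using K that by (simp add: gaussian_kernel_def)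
  fix k
  obtain C where C: "\<And>u. u \<ge> 0 \<Longrightarrow> K u \<le> C * exp (- (k + l) * u\<^sup>2)" using K unfolding gaussian_kernel_def by blast
  have "exp (l * u\<^sup>2) * K u \<le> C * exp (- k * u\<^sup>2)" if "u \<ge> 0" for u
  proof -
    have "exp (l * u\<^sup>2) * K u \<le> exp (l * u\<^sup>2) * (C * exp (- (k + l) * u\<^sup>2))"
      by (intro mult_left_mono C that) auto
    also have "\<dots> = C * (exp (l * u\<^sup>2) * exp (- (k + l) * u\<^sup>2))" by simp
    also have "exp (l * u\<^sup>2) * exp (- (k + l) * u\<^sup>2) = exp (- k * u\<^sup>2)"
      by (simp add: algebra_simps flip: exp_add)
    finally show ?thesis .
  qed
  then show "\<exists>C. \<forall>u\<ge>0. exp (l * u\<^sup>2) * K u \<le> C * exp (- k * u\<^sup>2)" by blast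
qed

lemma gaussian_kernel_dominated:
  assumes K: "gaussian_kernel K" and g: "g \<in> borel_measurable borel" "\<And>u. u \<ge> 0 \<Longrightarrow> g u > 0"
    and le: "\<And>u. u \<ge> 0 \<Longrightarrow> g u \<le> A * exp (l * u\<^sup>2)"
  shows "gaussian_kernel (\<lambda>u. K u * g u)"
  unfolding gaussian_kernel_def
proof (intro conjI allI impI)
  show "(\<lambda>u. K u * g u) \<in> borel_measurable borel" using K g by (auto simp: gaussian_kernel_def)
  show "K u * g u > 0" if "u \<ge> 0" for u using K g(2)[OF that] that by (simp add: gaussian_kernel_def)
  fix k
  obtain C where C: "\<And>u. u \<ge> 0 \<Longrightarrow> exp (l * u\<^sup>2) * K u \<le> C * exp (- k * u\<^sup>2)"
    using gaussian_kernel_mult_exp[OF K, of l] unfolding gaussian_kernel_def by blast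
  have A: "A > 0" using le[of 0] g(2)[of 0] by simp
  have "K u * g u \<le> (A * C) * exp (- k * u\<^sup>2)" if u: "u \<ge> 0" for u
  proof -
    have "K u * g u \<le> K u * (A * exp (l * u\<^sup>2))"
      using K u by (intro mult_left_mono le) (auto simp: gaussian_kernel_def less_imp_le)
    also have "\<dots> = A * (exp (l * u\<^sup>2) * K u)" by simp
    also have "\<dots> \<le> A * (C * exp (- k * u\<^sup>2))" using A by (intro mult_left_mono C u) auto
    finally show ?thesis by simp
  qed
  then show "\<exists>C. \<forall>u\<ge>0. K u * g u \<le> C * exp (- k * u\<^sup>2)" by blast
qed

lemma gaussian_kernel_cosh:
  assumes K: "gaussian_kernel K"
  shows "gaussian_kernel (\<lambda>u. K u * cosh (c * u))"
proof (rule gaussian_kernel_dominated[OF K, where A = 1 and l = "c\<^sup>2 / 2"])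
  show "(\<lambda>u. cosh (c * u)) \<in> borel_measurable borel"
    by (intro borel_measurable_continuous_onI continuous_intros)
  show "cosh (c * u) \<le> 1 * exp (c\<^sup>2 / 2 * u\<^sup>2)" for u
    using cosh_le_exp_half_square[of "c * u"] by (simp add: power_mult_distrib)
qed auto

lemma gaussian_kernel_integrable:
  assumes K: "gaussian_kernel K"
  shows "integrable lborel (\<lambda>u. indicator {0..} u * K u * exp (r * \<bar>u\<bar> + l * u\<^sup>2))"
proof -
  have [measurable]: "K \<in> borel_measurable borel" using K by (simp add: gaussian_kernel_def)
  obtain C where C: "\<And>u. u \<ge> 0 \<Longrightarrow> K u \<le> C * exp (- (l + 2) * u\<^sup>2)" using K unfolding gaussian_kernel_def by blast
  have C0: "C > 0"
    using C[of 0] K by (auto simp: gaussian_kernel_def dest: less_le_trans[of 0 "K 0" C])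
  show ?thesis
  proof (rule Bochner_Integration.integrable_bound)
    show "integrable lborel (\<lambda>u::real. C * exp (r\<^sup>2) * exp (- 1 * u\<^sup>2))"
      by (intro integrable_mult_right integrable_exp_neg_square) simp
    have "norm (indicator {0..} u * K u * exp (r * \<bar>u\<bar> + l * u\<^sup>2)) \<le> C * exp (r\<^sup>2) * exp (- 1 * u\<^sup>2)" for u :: real
    proof (cases "u \<ge> 0")
      case True
      have "norm (indicator {0..} u * K u * exp (r * \<bar>u\<bar> + l * u\<^sup>2)) = K u * exp (r * u + l * u\<^sup>2)"
        using True K by (simp add: gaussian_kernel_def abs_mult less_imp_le)
      also have "\<dots> \<le> C * exp (- (l + 2) * u\<^sup>2) * exp (r * u + l * u\<^sup>2)"
        by (intro mult_right_mono C True) auto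
      also have "\<dots> = C * exp (r * u - 2 * u\<^sup>2)" by (simp add: algebra_simps flip: exp_add)
      also have "\<dots> \<le> C * exp (r\<^sup>2 - u\<^sup>2)"
      proof -
        have "0 \<le> (r - u / 2)\<^sup>2 + 3 / 4 * u\<^sup>2" by simp
        then have "r * u - 2 * u\<^sup>2 \<le> r\<^sup>2 - u\<^sup>2" by (simp add: power2_eq_square algebra_simps)
        then show ?thesis using C0 by simp
      qed
      finally show ?thesis by (simp add: exp_diff exp_minus field_simps)
    qed (use C0 in auto)
    then show "AE u in lborel. norm (indicator {0..} u * K u * exp (r * \<bar>u\<bar> + l * u\<^sup>2)) \<le> norm (C * exp (r\<^sup>2) * exp (- 1 * u\<^sup>2))"
      using C0 by (intro AE_I2) (simp add: abs_mult)
  qed simp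
qed

lemma norm_cos_le: "norm (cos (z * of_real u)) \<le> exp (norm z * \<bar>u\<bar>)" for z :: complex and u :: real
proof -
  define a where "a = \<i> * (z * of_real u)"
  have "norm (exp a) \<le> exp (norm a)" "norm (exp (- a)) \<le> exp (norm (- a))" by (rule norm_exp)+
  moreover have "norm (cos (z * of_real u)) = norm (exp a + exp (- a)) / 2"
    by (simp only: cos_exp_eq norm_divide norm_numeral a_def)
  moreover have "norm (exp a + exp (- a)) \<le> norm (exp a) + norm (exp (- a))" by (rule norm_triangle_ineq)
  moreover have "norm a = norm z * \<bar>u\<bar>" by (simp add: a_def norm_mult)
  ultimately show ?thesis by (simp only: norm_minus_cancel)
qed

lemma cos_i_of_real: "cos (\<i> * of_real a) = (of_real (cosh a) :: complex)"
  by (simp add: cos_exp_eq cosh_field_def exp_of_real[symmetric] algebra_simps flip: of_real_minus)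

context
  fixes K :: "real \<Rightarrow> real"
  assumes K: "gaussian_kernel K"
begin

lemma kernel_measurable [measurable]: "K \<in> borel_measurable borel"
  using K by (simp add: gaussian_kernel_def)

lemma kernel_pos: "u \<ge> 0 \<Longrightarrow> K u > 0"
  using K by (simp add: gaussian_kernel_def)

lemma kernel_integrable_exp: "integrable lborel (\<lambda>u. indicator {0..} u * K u * exp (r * \<bar>u\<bar>))"
  using gaussian_kernel_integrable[OF K, of r 0] by simp

lemma cosine_transform_integrable:
  fixes z :: complex
  shows "integrable lborel (\<lambda>u. indicator {0..} u *\<^sub>R (of_real (K u) * cos (z * of_real u)))"
proof (rule Bochner_Integration.integrable_bound[OF kernel_integrable_exp[of "norm z"]])
  show "AE u in lborel. norm (indicator {0..} u *\<^sub>R (of_real (K u) * cos (z * of_real u)))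
      \<le> norm (indicator {0..} u * K u * exp (norm z * \<bar>u\<bar>))"
  proof (rule AE_I2)
    fix u :: real
    show "norm (indicator {0..} u *\<^sub>R (of_real (K u) * cos (z * of_real u)))
      \<le> norm (indicator {0..} u * K u * exp (norm z * \<bar>u\<bar>))"
      using mult_left_mono[OF norm_cos_le[of z u], of "\<bar>K u\<bar>"]
      by (cases "u \<ge> 0") (simp_all add: norm_mult abs_mult)
  qed
qed simp

lemma cosine_transform_norm_le:
  "norm (cosine_transform K z) \<le> (\<integral>u. indicator {0..} u * K u * exp (norm z * \<bar>u\<bar>) \<partial>lborel)"
proof -
  have "norm (cosine_transform K z) \<le> (\<integral>u. norm (indicator {0..} u *\<^sub>R (of_real (K u) * cos (z * of_real u))) \<partial>lborel)"
    unfolding cosine_transform_def set_lebesgue_integral_def by (rule integral_norm_bound)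
  also have "\<dots> \<le> (\<integral>u. indicator {0..} u * K u * exp (norm z * \<bar>u\<bar>) \<partial>lborel)"
  proof (rule integral_mono)
    show "norm (indicator {0..} u *\<^sub>R (of_real (K u) * cos (z * of_real u))) \<le> indicator {0..} u * K u * exp (norm z * \<bar>u\<bar>)" for u
      using mult_left_mono[OF norm_cos_le[of z u], of "K u"] kernel_pos[of u]
      by (cases "u \<ge> 0") (simp_all add: norm_mult abs_mult)
  qed (rule integrable_norm[OF cosine_transform_integrable] kernel_integrable_exp)+
  finally show ?thesis .
qed

lemma cosine_transform_holomorphic: "cosine_transform K holomorphic_on UNIV"
proof -
  define g where "g = (\<lambda>u. of_real (indicator {0..} u * K u) :: complex)"
  have [measurable]: "g \<in> borel_measurable lborel" unfolding g_def by measurable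
  have gint: "integrable lborel (\<lambda>u. norm (g u) * exp (r * \<bar>u\<bar>))" for r
  proof -
    have "norm (g u) = indicator {0..} u * K u" for u
      using kernel_pos[of u] by (auto simp: g_def split: split_indicator)
    then show ?thesis using kernel_integrable_exp[of r] by simp
  qed
  define F where "F = (\<lambda>z. \<integral>u. g u * exp (z * of_real u) \<partial>lborel)"
  have F: "F holomorphic_on UNIV" unfolding F_def by (rule entire_exp_integral) (use gint in auto)
  have Fi: "integrable lborel (\<lambda>u. g u * exp (z * of_real u))" for z
  proof (rule Bochner_Integration.integrable_bound[OF gint[of "norm z"]])
    have "norm (exp (z * of_real u)) \<le> exp (norm z * \<bar>u\<bar>)" for u
      using norm_exp[of "z * of_real u"] by (simp add: norm_mult)
    then show "AE u in lborel. norm (g u * exp (z * of_real u)) \<le> norm (norm (g u) * exp (norm z * \<bar>u\<bar>))"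
      by (intro AE_I2) (simp add: norm_mult mult_left_mono)
  qed simp
  have eq: "cosine_transform K z = (F (\<i> * z) + F (- \<i> * z)) / 2" for z
  proof -
    have "cosine_transform K z = (\<integral>u. (g u * exp (\<i> * z * of_real u) + g u * exp (- \<i> * z * of_real u)) / 2 \<partial>lborel)"
      unfolding cosine_transform_def set_lebesgue_integral_def
      by (rule Bochner_Integration.integral_cong) (auto simp: g_def cos_exp_eq algebra_simps add_divide_distrib split: split_indicator)
    also have "\<dots> = (F (\<i> * z) + F (- \<i> * z)) / 2"
      unfolding F_def using Fi[of "\<i> * z"] Fi[of "- \<i> * z"] by simp
    finally show ?thesis .
  qed
  have "(\<lambda>z. (F (\<i> * z) + F (- \<i> * z)) / 2) holomorphic_on UNIV"
  proof -
    have "(\<lambda>z. F (a * z)) holomorphic_on UNIV" for a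
      by (rule holomorphic_on_compose_gen[OF _ F, unfolded o_def, of "\<lambda>z. a * z"]) (auto intro!: holomorphic_intros)
    from this[of \<i>] this[of "- \<i>"] show ?thesis by (intro holomorphic_on_divide holomorphic_on_add) auto
  qed
  moreover have "cosine_transform K = (\<lambda>z. (F (\<i> * z) + F (- \<i> * z)) / 2)" by (rule ext) (rule eq)
  ultimately show ?thesis by (simp only:)
qed

text \<open>The splitting |z| |u| <= e |z|^2 + u^2 / (4 e) leaves a finite integral in u for every e
  > 0.\<close>

lemma cosine_transform_growth:
  assumes e: "e > 0"
  shows "\<exists>C. \<forall>z. norm (cosine_transform K z) \<le> C * exp (e * (norm z)\<^sup>2)"
proof -
  have int: "integrable lborel (\<lambda>u. indicator {0..} u * K u * exp (u\<^sup>2 / (4 * e)))"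
    using gaussian_kernel_integrable[OF K, of 0 "1 / (4 * e)"] by simp
  have "norm (cosine_transform K z) \<le> (\<integral>u. indicator {0..} u * K u * exp (u\<^sup>2 / (4 * e)) \<partial>lborel) * exp (e * (norm z)\<^sup>2)" for z
  proof -
    have "norm (cosine_transform K z) \<le> (\<integral>u. indicator {0..} u * K u * exp (norm z * \<bar>u\<bar>) \<partial>lborel)"
      by (rule cosine_transform_norm_le)
    also have "\<dots> \<le> (\<integral>u. (indicator {0..} u * K u * exp (u\<^sup>2 / (4 * e))) * exp (e * (norm z)\<^sup>2) \<partial>lborel)"
    proof (rule integral_mono)
      fix u :: real
      have "0 \<le> (2 * e * norm z - \<bar>u\<bar>)\<^sup>2 / (4 * e)" using e by simp
      also have "\<dots> = e * (norm z)\<^sup>2 - norm z * \<bar>u\<bar> + u\<^sup>2 / (4 * e)"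
        using e by (simp add: power2_diff power_mult_distrib field_simps power2_eq_square)
      finally have "exp (norm z * \<bar>u\<bar>) \<le> exp (u\<^sup>2 / (4 * e) + e * (norm z)\<^sup>2)" by simp
      then have "exp (norm z * \<bar>u\<bar>) \<le> exp (u\<^sup>2 / (4 * e)) * exp (e * (norm z)\<^sup>2)" by (simp only: exp_add)
      then show "indicator {0..} u * K u * exp (norm z * \<bar>u\<bar>) \<le> (indicator {0..} u * K u * exp (u\<^sup>2 / (4 * e))) * exp (e * (norm z)\<^sup>2)"
        using kernel_pos[of u] by (auto simp: mult.assoc intro!: mult_left_mono split: split_indicator)
    qed (use int kernel_integrable_exp in auto)
    finally show ?thesis by simp
  qed
  then show ?thesis by blast
qed

lemma cosine_transform_of_real: "cosine_transform K (of_real x) \<in> \<real>"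
proof -
  have "cosine_transform K (of_real x) = of_real (\<integral>u. indicator {0..} u * (K u * cos (x * u)) \<partial>lborel)"
    unfolding cosine_transform_def set_lebesgue_integral_def
    by (subst integral_complex_of_real[symmetric], rule Bochner_Integration.integral_cong)
       (auto simp: scaleR_conv_of_real cos_of_real simp flip: of_real_mult)
  then show ?thesis by simp
qed

text \<open>On the imaginary axis the cosine becomes cosh, so the transform is a positive number
  there. This settles the borderline cases: the value at 0, equality in the maximum modulus
  argument, and the point s = 1 for zeta.\<close>

lemma cosine_transform_imaginary_axis:
  "cosine_transform K (\<i> * of_real y) = of_real (\<integral>u. indicator {0..} u * K u * cosh (y * u) \<partial>lborel)"
  unfolding cosine_transform_def set_lebesgue_integral_def
proof (subst integral_complex_of_real[symmetric], rule Bochner_Integration.integral_cong)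
  fix u :: real
  have "cos (\<i> * of_real y * of_real u) = (of_real (cosh (y * u)) :: complex)"
    using cos_i_of_real[of "y * u"] by (simp add: mult.assoc)
  then show "indicator {0..} u *\<^sub>R (of_real (K u) * cos (\<i> * of_real y * of_real u)) = complex_of_real (indicator {0..} u * K u * cosh (y * u))"
    by (simp add: scaleR_conv_of_real)
qed simp

lemma kernel_cosh_integrable: "integrable lborel (\<lambda>u. indicator {0..} u * K u * cosh (y * u))"
proof -
  have "integrable lborel (\<lambda>u. indicator {0..} u *\<^sub>R (of_real (K u) * cos (\<i> * of_real y * of_real u)) :: complex)"
    by (rule cosine_transform_integrable)
  from integrable_Re[OF this] show ?thesis
  proof (rule Bochner_Integration.integrable_cong[THEN iffD1, rotated -1])
    fix u :: real
    have "cos (\<i> * of_real y * of_real u) = (of_real (cosh (y * u)) :: complex)"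
      using cos_i_of_real[of "y * u"] by (simp add: mult.assoc)
    then show "Re (indicator {0..} u *\<^sub>R (of_real (K u) * cos (\<i> * of_real y * of_real u))) = indicator {0..} u * K u * cosh (y * u)"
      by simp
  qed simp
qed

lemma integral_pos_half_line:
  fixes f :: "real \<Rightarrow> real"
  assumes int: "integrable lborel (\<lambda>u. indicator {0..} u * f u)" and pos: "\<And>u. u > 0 \<Longrightarrow> f u > 0"
  shows "(\<integral>u. indicator {0..} u * f u \<partial>lborel) > 0"
proof -
  have nn: "AE u in lborel. 0 \<le> indicator {0..} u * f u"
    using AE_lborel_singleton[of "0::real"] by eventually_elim (use pos in \<open>auto simp: less_imp_le split: split_indicator\<close>)
  have "(\<integral>u. indicator {0..} u * f u \<partial>lborel) \<noteq> 0"
  proof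
    assume "(\<integral>u. indicator {0..} u * f u \<partial>lborel) = 0"
    then have "AE u in lborel. indicator {0..} u * f u = 0"
      using integral_nonneg_eq_0_iff_AE[OF int nn] by simp
    then have "AE u in lborel. u \<notin> {0<..<1::real}"
    proof (rule AE_mp, intro AE_I2 impI)
      fix u :: real assume "indicator {0..} u * f u = 0"
      then show "u \<notin> {0<..<1}" using pos[of u] by (auto split: split_indicator_asm)
    qed
    moreover have "{0<..<1::real} = {u \<in> space lborel. \<not> u \<notin> {0<..<1}}" by auto
    ultimately have "emeasure lborel {0<..<1::real} = 0"
      using AE_iff_measurable[of "{0<..<1::real}" lborel "\<lambda>u. u \<notin> {0<..<1}"] by simp
    then show False by simp
  qed
  moreover have "(\<integral>u. indicator {0..} u * f u \<partial>lborel) \<ge> 0" by (rule integral_nonneg_AE[OF nn])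
  ultimately show ?thesis by simp
qed

lemma cosine_transform_imaginary_pos: "(\<integral>u. indicator {0..} u * K u * cosh (y * u) \<partial>lborel) > 0"
  using integral_pos_half_line[of "\<lambda>u. K u * cosh (y * u)"] kernel_cosh_integrable[of y] kernel_pos
  by (simp add: mult.assoc)

lemma cosine_transform_even: "cosine_transform K (- z) = cosine_transform K z"
  by (simp add: cosine_transform_def)

lemma cosine_transform_0: "cosine_transform K 0 \<noteq> 0"
  using cosine_transform_imaginary_axis[of 0] cosine_transform_imaginary_pos[of 0] by auto

text \<open>A hypothesis of Hurwitz's theorem. The values at i and 2 i differ because cosh (2 u) >
  cosh u for u > 0.\<close>

lemma cosine_transform_nonconstant: "\<not> cosine_transform K constant_on {z. Im z > 0}"
proof
  assume "cosine_transform K constant_on {z. Im z > 0}"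
  then have "cosine_transform K (\<i> * of_real 1) = cosine_transform K (\<i> * of_real 2)"
    by (auto simp: constant_on_def)
  then have eq: "(\<integral>u. indicator {0..} u * K u * cosh (1 * u) \<partial>lborel) = (\<integral>u. indicator {0..} u * K u * cosh (2 * u) \<partial>lborel)"
    unfolding cosine_transform_imaginary_axis of_real_eq_iff .
  have "(\<integral>u. indicator {0..} u * (K u * (cosh (2 * u) - cosh (1 * u))) \<partial>lborel) > 0"
  proof (rule integral_pos_half_line)
    show "integrable lborel (\<lambda>u. indicator {0..} u * (K u * (cosh (2 * u) - cosh (1 * u))))"
      using Bochner_Integration.integrable_diff[OF kernel_cosh_integrable[of 2] kernel_cosh_integrable[of 1]] by (simp add: algebra_simps)
    show "K u * (cosh (2 * u) - cosh (1 * u)) > 0" if "u > 0" for u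
      using that kernel_pos[of u] cosh_real_strict_mono[of u "2 * u"] by simp
  qed
  also have "(\<integral>u. indicator {0..} u * (K u * (cosh (2 * u) - cosh (1 * u))) \<partial>lborel) = 0"
    using Bochner_Integration.integral_diff[OF kernel_cosh_integrable[of 2] kernel_cosh_integrable[of 1]] eq by (simp add: algebra_simps)
  finally show False by simp
qed

lemma cosine_transform_cosh:
  "cosine_transform (\<lambda>u. K u * cosh (c * u)) z =
    (cosine_transform K (z + \<i> * of_real c) + cosine_transform K (z - \<i> * of_real c)) / 2"
proof -
  have "cosine_transform (\<lambda>u. K u * cosh (c * u)) z =
     (\<integral>u. (indicator {0..} u *\<^sub>R (of_real (K u) * cos ((z + \<i> * of_real c) * of_real u)) +
        indicator {0..} u *\<^sub>R (of_real (K u) * cos ((z - \<i> * of_real c) * of_real u))) / 2 \<partial>lborel)"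
    unfolding cosine_transform_def set_lebesgue_integral_def
  proof (rule Bochner_Integration.integral_cong)
    fix u :: real
    have c: "cos (\<i> * of_real c * of_real u) = (of_real (cosh (c * u)) :: complex)"
      using cos_i_of_real[of "c * u"] by (simp add: mult.assoc)
    have "cos ((z + \<i> * of_real c) * of_real u) + cos ((z - \<i> * of_real c) * of_real u) = 2 * (cos (z * of_real u) * of_real (cosh (c * u)))"
      by (simp add: ring_distribs cos_add cos_diff c)
    then have "of_real (K u) * cos ((z + \<i> * of_real c) * of_real u) + of_real (K u) * cos ((z - \<i> * of_real c) * of_real u)
        = 2 * (of_real (K u * cosh (c * u)) * cos (z * of_real u))"
      by (simp add: distrib_left[symmetric])
    then show "indicator {0..} u *\<^sub>R (of_real (K u * cosh (c * u)) * cos (z * of_real u)) =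
      (indicator {0..} u *\<^sub>R (of_real (K u) * cos ((z + \<i> * of_real c) * of_real u)) +
        indicator {0..} u *\<^sub>R (of_real (K u) * cos ((z - \<i> * of_real c) * of_real u))) / 2"
      by (simp add: scaleR_add_right[symmetric])
  qed simp
  also have "\<dots> = (cosine_transform K (z + \<i> * of_real c) + cosine_transform K (z - \<i> * of_real c)) / 2"
    unfolding cosine_transform_def set_lebesgue_integral_def
    by (simp add: cosine_transform_integrable)
  finally show ?thesis .
qed

text \<open>Let f be the transform of K. By \<open>real_zeros_norm_mono\<close> the ratio B w = f (w
  - i c) / f (w + i c) has modulus at most 1 in the upper half-plane, since |Im w - c| <= |Im w +
  c|. A zero of the new transform is a point with B = -1, where the maximum modulus is attained, so
  B would be constant.\<close>

lemma real_zeros_cosh_upper: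
  assumes zeros: "\<And>z. cosine_transform K z = 0 \<Longrightarrow> z \<in> \<real>" and c: "c > 0"
    and z: "Im z > 0"
  shows "cosine_transform (\<lambda>u. K u * cosh (c * u)) z \<noteq> 0"
proof
  let ?f = "cosine_transform K"
  let ?S = "{w. Im w > 0}"
  assume "cosine_transform (\<lambda>u. K u * cosh (c * u)) z = 0"
  then have fz: "?f (z - \<i> * of_real c) = - ?f (z + \<i> * of_real c)"
    unfolding cosine_transform_cosh by (simp add: add_eq_0_iff)
  have nz: "?f (w + \<i> * of_real c) \<noteq> 0" if "w \<in> ?S" for w
    using zeros[of "w + \<i> * of_real c"] that c by (auto simp: complex_is_Real_iff)
  define B where "B = (\<lambda>w. ?f (w - \<i> * of_real c) / ?f (w + \<i> * of_real c))"
  have holf: "(\<lambda>w. ?f (w + a)) holomorphic_on ?S" for a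
    by (rule holomorphic_on_compose_gen[OF _ cosine_transform_holomorphic, unfolded o_def, of "\<lambda>w. w + a"])
       (auto intro!: holomorphic_intros)
  have holB: "B holomorphic_on ?S" unfolding B_def
    using holf[of "- (\<i> * of_real c)"] holf[of "\<i> * of_real c"] nz by (intro holomorphic_on_divide) auto
  have Bz: "B z = - 1" using nz[of z] z by (simp add: B_def fz)
  have le: "norm (B w) \<le> norm (B z)" if w: "w \<in> ?S" for w
  proof -
    have "norm (?f (Complex (Re w) (Im w - c))) \<le> norm (?f (Complex (Re w) (Im w + c)))"
      using w c by (intro real_zeros_norm_mono[OF cosine_transform_holomorphic cosine_transform_growth cosine_transform_of_real zeros cosine_transform_0]) auto
    moreover have "Complex (Re w) (Im w - c) = w - \<i> * of_real c" "Complex (Re w) (Im w + c) = w + \<i> * of_real c"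
      by (simp_all add: complex_eq_iff)
    ultimately show ?thesis using nz[OF w] by (simp add: Bz) (simp add: B_def norm_divide)
  qed
  have "B constant_on ?S"
    by (rule maximum_modulus_principle[OF holB _ _ _ _ _ le])
       (use z in \<open>auto intro: open_halfspace_Im_gt convex_connected convex_halfspace_Im_gt\<close>)
  \<comment> \<open>B = -1 throughout is impossible: at w = i both values of f are taken on the
    imaginary axis and are positive.\<close>
  then have "B (\<i> * of_real 1) = B z" using z by (auto simp: constant_on_def)
  then have "?f (\<i> * of_real 1 - \<i> * of_real c) / ?f (\<i> * of_real 1 + \<i> * of_real c) = - 1"
    unfolding Bz by (simp only: B_def)
  then have "?f (\<i> * of_real 1 - \<i> * of_real c) = - ?f (\<i> * of_real 1 + \<i> * of_real c)"
    using nz[of "\<i> * of_real 1"] by (simp add: divide_eq_eq split: if_splits)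
  then have "?f (\<i> * of_real (1 - c)) = - ?f (\<i> * of_real (1 + c))"
    by (simp add: algebra_simps)
  then have "complex_of_real ((\<integral>u. indicator {0..} u * K u * cosh ((1 - c) * u) \<partial>lborel) + (\<integral>u. indicator {0..} u * K u * cosh ((1 + c) * u) \<partial>lborel)) = 0"
    unfolding cosine_transform_imaginary_axis by simp
  then show False
    using cosine_transform_imaginary_pos[of "1 - c"] cosine_transform_imaginary_pos[of "1 + c"] by (simp only: of_real_eq_0_iff)
qed

end

declare kernel_measurable [measurable del]

lemma real_zeros_cosh:
  assumes K: "gaussian_kernel K" and zeros: "\<And>z. cosine_transform K z = 0 \<Longrightarrow> z \<in> \<real>" and c: "c > 0"
    and z: "cosine_transform (\<lambda>u. K u * cosh (c * u)) z = 0"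
  shows "z \<in> \<real>"
proof -
  have "\<not> Im z > 0" using real_zeros_cosh_upper[OF K zeros c] z by blast
  moreover have "\<not> Im (- z) > 0"
    using real_zeros_cosh_upper[OF K zeros c, of "- z"] z cosine_transform_even[OF gaussian_kernel_cosh[OF K, of c], of z] by auto
  ultimately show ?thesis by (simp add: complex_is_Real_iff)
qed

section \<open>From powers of cosh to the Gaussian factor\<close>

lemma gaussian_kernel_cosh_power:
  assumes "gaussian_kernel K" shows "gaussian_kernel (\<lambda>u. K u * cosh (c * u) ^ m)"
proof (induction m)
  case (Suc m)
  from gaussian_kernel_cosh[OF this, of c] show ?case by (simp add: mult_ac)
qed (use assms in simp)

lemma real_zeros_cosh_power:
  assumes K: "gaussian_kernel K" and zeros: "\<And>z. cosine_transform K z = 0 \<Longrightarrow> z \<in> \<real>" and c: "c > 0"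
  shows "cosine_transform (\<lambda>u. K u * cosh (c * u) ^ m) z = 0 \<Longrightarrow> z \<in> \<real>"
proof (induction m arbitrary: z)
  case (Suc m)
  have "(\<lambda>u. K u * cosh (c * u) ^ Suc m) = (\<lambda>u. K u * cosh (c * u) ^ m * cosh (c * u))" by (simp add: mult_ac)
  then show ?case using real_zeros_cosh[OF gaussian_kernel_cosh_power[OF K] Suc.IH c] Suc.prems by simp
qed (use zeros in simp)

lemma ln_cosh_scaled_limit: "(\<lambda>m. real m * ln (cosh (a / sqrt (real m)))) \<longlonglongrightarrow> a * a / 2"
  by (real_asymp simp: cosh_def)

text \<open>The kernels \<open>H m\<close> converge to \<open>G\<close> from below and have
  transforms with only real zeros. The transforms converge uniformly on bounded sets, so Hurwitz's
  theorem in the upper half-plane passes zero-freeness to the limit.\<close>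

lemma real_zeros_gaussian_upper:
  assumes K: "gaussian_kernel K" and zeros: "\<And>z. cosine_transform K z = 0 \<Longrightarrow> z \<in> \<real>" and l: "l > 0"
    and z: "Im z > 0"
  shows "cosine_transform (\<lambda>u. exp (l * u\<^sup>2) * K u) z \<noteq> 0"
proof -
  define G where "G = (\<lambda>u. exp (l * u\<^sup>2) * K u)"
  have G: "gaussian_kernel G" unfolding G_def by (rule gaussian_kernel_mult_exp[OF K])
  \<comment> \<open>Fixed by (m + 1) (c m)^2 = 2 l, for which cosh (c m u)^(m + 1) tends to exp (l
    u^2).\<close>
  define c where "c = (\<lambda>m. sqrt (2 * l) / sqrt (real (Suc m)))"
  have c: "c m > 0" for m using l by (simp add: c_def)
  define H where "H = (\<lambda>m u. K u * cosh (c m * u) ^ Suc m)"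
  have H: "gaussian_kernel (H m)" for m unfolding H_def by (rule gaussian_kernel_cosh_power[OF K])
  have HG: "H m u \<le> G u" if "u \<ge> 0" for m u
  proof -
    have "cosh (c m * u) ^ Suc m \<le> exp ((c m * u)\<^sup>2 / 2) ^ Suc m"
      by (intro power_mono cosh_le_exp_half_square) auto
    also have "\<dots> = exp (real (Suc m) * ((c m * u)\<^sup>2 / 2))" by (rule exp_of_nat_mult[symmetric])
    also have "real (Suc m) * ((c m * u)\<^sup>2 / 2) = l * u\<^sup>2"
      using l by (simp add: c_def power_mult_distrib power_divide field_simps del: of_nat_Suc)
    finally show ?thesis using kernel_pos[OF K that] by (simp add: H_def G_def mult.commute mult_left_mono)
  qed
  have lim: "(\<lambda>m. H m u) \<longlonglongrightarrow> G u" for u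
  proof -
    have "(\<lambda>m. real m * ln (cosh (sqrt (2 * l) * u / sqrt (real m)))) \<longlonglongrightarrow> (sqrt (2 * l) * u) * (sqrt (2 * l) * u) / 2"
      by (rule ln_cosh_scaled_limit)
    then have "(\<lambda>m. exp (real (Suc m) * ln (cosh (sqrt (2 * l) * u / sqrt (real (Suc m)))))) \<longlonglongrightarrow> exp ((sqrt (2 * l) * u) * (sqrt (2 * l) * u) / 2)"
      by (intro tendsto_exp LIMSEQ_Suc)
    moreover have "exp (real (Suc m) * ln (cosh (sqrt (2 * l) * u / sqrt (real (Suc m))))) = cosh (c m * u) ^ Suc m" for m
      unfolding exp_of_nat_mult by (simp add: c_def)
    moreover have "(sqrt (2 * l) * u) * (sqrt (2 * l) * u) / 2 = l * u\<^sup>2"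
      using l real_sqrt_mult_self[of "2 * l"] by (simp only: power2_eq_square mult_ac) (simp add: field_simps)
    ultimately show ?thesis
      unfolding H_def G_def by (simp only: mult.commute[of "exp _" "K u"]) (intro tendsto_mult tendsto_const)
  qed
  \<comment> \<open>Since H m <= G, this one integral bounds the difference of the transforms for
    all |w| <= r at once.\<close>
  define \<delta> where "\<delta> = (\<lambda>r m. \<integral>u. indicator {0..} u * (G u - H m u) * exp (r * \<bar>u\<bar>) \<partial>lborel)"
  have [measurable]: "G \<in> borel_measurable borel" by (rule kernel_measurable[OF G])
  have [measurable]: "H m \<in> borel_measurable borel" for m by (rule kernel_measurable[OF H])
  have \<delta>: "\<delta> r \<longlonglongrightarrow> 0" for r
  proof -
    have "\<delta> r \<longlonglongrightarrow> (\<integral>u. 0 \<partial>(lborel :: real measure))"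
      unfolding \<delta>_def
    proof (rule integral_dominated_convergence)
      show "integrable lborel (\<lambda>u. indicator {0..} u * G u * exp (r * \<bar>u\<bar>))" by (rule kernel_integrable_exp[OF G])
      show "AE u in lborel. (\<lambda>m. indicator {0..} u * (G u - H m u) * exp (r * \<bar>u\<bar>)) \<longlonglongrightarrow> 0"
      proof (rule AE_I2)
        fix u :: real
        have "(\<lambda>m. indicator {0..} u * (G u - H m u) * exp (r * \<bar>u\<bar>)) \<longlonglongrightarrow> indicator {0..} u * (G u - G u) * exp (r * \<bar>u\<bar>)"
          by (intro tendsto_intros lim)
        then show "(\<lambda>m. indicator {0..} u * (G u - H m u) * exp (r * \<bar>u\<bar>)) \<longlonglongrightarrow> 0" by simp
      qed
      show "AE u in lborel. norm (indicator {0..} u * (G u - H m u) * exp (r * \<bar>u\<bar>)) \<le> indicator {0..} u * G u * exp (r * \<bar>u\<bar>)" for m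
        using HG kernel_pos[OF H[of m]]
        by (intro AE_I2) (auto simp: abs_mult abs_le_iff less_imp_le intro!: mult_right_mono split: split_indicator)
    qed measurable
    then show ?thesis by simp
  qed
  have diff: "norm (cosine_transform (H m) w - cosine_transform G w) \<le> \<delta> r m" if "norm w \<le> r" for m w r
  proof -
    have "norm (cosine_transform (H m) w - cosine_transform G w) =
       norm (\<integral>u. indicator {0..} u *\<^sub>R (of_real (H m u) * cos (w * of_real u)) - indicator {0..} u *\<^sub>R (of_real (G u) * cos (w * of_real u)) \<partial>lborel)"
      unfolding cosine_transform_def set_lebesgue_integral_def
      using cosine_transform_integrable[OF G] cosine_transform_integrable[OF H] by simp
    also have "\<dots> \<le> (\<integral>u. norm (indicator {0..} u *\<^sub>R (of_real (H m u) * cos (w * of_real u)) - indicator {0..} u *\<^sub>R (of_real (G u) * cos (w * of_real u))) \<partial>lborel)"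
      by (rule integral_norm_bound)
    also have "\<dots> \<le> \<delta> r m"
      unfolding \<delta>_def
    proof (rule integral_mono)
      fix u :: real
      have main: "norm (of_real (H m u) * cos (w * of_real u) - of_real (G u) * cos (w * of_real u)) \<le> (G u - H m u) * exp (r * \<bar>u\<bar>)" if u: "u \<ge> 0"
      proof -
        have e: "of_real (H m u) * cos (w * of_real u) - of_real (G u) * cos (w * of_real u) = - (of_real (G u - H m u) * cos (w * of_real u))"
          by (simp add: algebra_simps)
        have cosle: "norm (cos (w * of_real u)) \<le> exp (r * \<bar>u\<bar>)"
        proof -
          have "norm w * \<bar>u\<bar> \<le> r * \<bar>u\<bar>" using \<open>norm w \<le> r\<close> by (rule mult_right_mono) simp
          then have "exp (norm w * \<bar>u\<bar>) \<le> exp (r * \<bar>u\<bar>)" by (simp only: exp_le_cancel_iff)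
          with norm_cos_le[of w u] show ?thesis by (rule order_trans)
        qed
        note e
        moreover have "\<bar>G u - H m u\<bar> = G u - H m u" using HG[OF u, of m] by simp
        ultimately have "norm (of_real (H m u) * cos (w * of_real u) - of_real (G u) * cos (w * of_real u))
            = (G u - H m u) * norm (cos (w * of_real u))" by (metis norm_minus_cancel norm_mult norm_of_real)
        also have "\<dots> \<le> (G u - H m u) * exp (r * \<bar>u\<bar>)" by (rule mult_left_mono[OF cosle]) (use HG[OF u, of m] in simp)
        finally show ?thesis .
      qed
      show "norm (indicator {0..} u *\<^sub>R (of_real (H m u) * cos (w * of_real u)) - indicator {0..} u *\<^sub>R (of_real (G u) * cos (w * of_real u)))
          \<le> indicator {0..} u * (G u - H m u) * exp (r * \<bar>u\<bar>)"
      proof (cases "u \<ge> 0")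
        case True
        then have i: "indicator {0..} u = (1::real)" by simp
        show ?thesis unfolding i scaleR_one mult_1_left by (rule main[OF True])
      qed simp
    next
      show "integrable lborel (\<lambda>u. indicator {0..} u * (G u - H m u) * exp (r * \<bar>u\<bar>))"
        using Bochner_Integration.integrable_diff[OF kernel_integrable_exp[OF G, of r] kernel_integrable_exp[OF H, of m r]] by (simp add: algebra_simps)
    qed (use cosine_transform_integrable[OF G] cosine_transform_integrable[OF H] in auto)
    finally show ?thesis .
  qed
  have "cosine_transform G z \<noteq> 0"
  proof (rule Hurwitz_no_zeros[of "{w. Im w > 0}" "\<lambda>m. cosine_transform (H m)" "cosine_transform G"])
    show "cosine_transform (H m) holomorphic_on {w. Im w > 0}" for m
      by (rule holomorphic_on_subset[OF cosine_transform_holomorphic[OF H]]) auto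
    show "cosine_transform G holomorphic_on {w. Im w > 0}"
      by (rule holomorphic_on_subset[OF cosine_transform_holomorphic[OF G]]) auto
    show "\<not> cosine_transform G constant_on {w. Im w > 0}" by (rule cosine_transform_nonconstant[OF G])
    show "cosine_transform (H m) w \<noteq> 0" if "w \<in> {w. Im w > 0}" for m w
      using real_zeros_cosh_power[OF K zeros c[of m], of "Suc m" w] that by (auto simp: H_def complex_is_Real_iff)
    fix L :: "complex set" assume "compact L"
    then obtain r where r: "\<And>w. w \<in> L \<Longrightarrow> norm w \<le> r" using compact_imp_bounded bounded_iff by metis
    show "uniform_limit L (\<lambda>m. cosine_transform (H m)) (cosine_transform G) sequentially"
    proof (rule uniform_limitI)
      fix e :: real assume "e > 0"
      with \<delta>[of r] have "eventually (\<lambda>m. \<delta> r m < e) sequentially" by (rule order_tendstoD)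
      then show "eventually (\<lambda>m. \<forall>w\<in>L. dist (cosine_transform (H m) w) (cosine_transform G w) < e) sequentially"
      proof eventually_elim
        case (elim m)
        show ?case
        proof
          fix w assume "w \<in> L"
          from diff[OF r[OF this], of m] elim
          show "dist (cosine_transform (H m) w) (cosine_transform G w) < e" by (simp only: dist_norm)
        qed
      qed
    qed
  qed (use z in \<open>auto intro: open_halfspace_Im_gt convex_connected convex_halfspace_Im_gt\<close>)
  then show ?thesis by (simp add: G_def)
qed

lemma newman_Phi_gaussian_kernel: "gaussian_kernel newman_Phi"
  unfolding gaussian_kernel_def
proof (intro conjI allI impI)
  show "\<exists>C. \<forall>u\<ge>0. newman_Phi u \<le> C * exp (- k * u\<^sup>2)" for k
    using newman_Phi_bound[of k] by (meson abs_le_D1)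
qed (auto simp: newman_Phi_pos)

lemma newman_H_cosine_transform: "newman_H l = cosine_transform (\<lambda>u. exp (l * u\<^sup>2) * newman_Phi u)"
  by (simp add: newman_H_def[abs_def] cosine_transform_def[abs_def])

theorem newman_H_real_zeros_mono:
  assumes zeros: "\<And>z. newman_H 0 z = 0 \<Longrightarrow> z \<in> \<real>" and l: "l \<ge> 0" and z: "newman_H l z = 0"
  shows "z \<in> \<real>"
proof (cases "l = 0")
  case False
  then have l: "l > 0" using assms by simp
  have zeros': "cosine_transform newman_Phi w = 0 \<Longrightarrow> w \<in> \<real>" for w
    using zeros[of w] by (simp add: newman_H_cosine_transform)
  note up = real_zeros_gaussian_upper[OF newman_Phi_gaussian_kernel zeros' l]
  have "newman_H l (- z) = 0"
    using z cosine_transform_even by (simp add: newman_H_cosine_transform gaussian_kernel_mult_exp newman_Phi_gaussian_kernel)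
  then have "\<not> Im z > 0" "\<not> Im (- z) > 0" using up z by (auto simp: newman_H_cosine_transform)
  then show ?thesis by (simp add: complex_is_Real_iff)
qed (use assms in auto)

section \<open>Translates of phi and the zeros of H_0\<close>

text \<open>\<open>newman_Phi u\<close> is the sum over \<open>n = k + 1\<close> of \<open>exp (- half_log k) * newman_phi (u + half_log k)\<close>.\<close>

definition newman_phi :: "real \<Rightarrow> real" where
  "newman_phi v = (2 * pi\<^sup>2 * exp (9 * v) - 3 * pi * exp (5 * v)) * exp (- pi * exp (4 * v))"

definition half_log :: "nat \<Rightarrow> real" where
  "half_log k = ln (real (Suc k)) / 2"

lemma newman_phi_measurable [measurable]: "newman_phi \<in> borel_measurable borel"
  unfolding newman_phi_def[abs_def] by measurable

lemma half_log_nonneg: "half_log k \<ge> 0"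
  by (simp add: half_log_def)

text \<open>Translation by L = ln n / 2 multiplies exp (4 u) by n^2, and exp (9 u) and exp (5 u) by
  n^(9/2) and n^(5/2); the factor exp (- L) = n^(-1/2) corrects the last two to n^4 and n^2.\<close>

lemma newman_phi_shift:
  "exp (- half_log k) * newman_phi (u + half_log k) =
    (2 * pi\<^sup>2 * real (Suc k) ^ 4 * exp (9 * u) - 3 * pi * (real (Suc k))\<^sup>2 * exp (5 * u)) *
      exp (- pi * (real (Suc k))\<^sup>2 * exp (4 * u))"
proof -
  define E where "E = exp (half_log k)"
  have E: "E > 0" by (simp add: E_def)
  have "E ^ 2 = exp (2 * half_log k)" unfolding E_def by (metis exp_double)
  then have n: "real (Suc k) = E ^ 2" by (simp add: half_log_def)
  have e: "exp (real m * (u + half_log k)) = exp (real m * u) * E ^ m" for m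
    unfolding E_def by (simp add: distrib_left exp_add exp_of_nat_mult)
  show ?thesis
    using e[of 9] e[of 5] e[of 4] E unfolding newman_phi_def n
    by (simp add: exp_minus E_def[symmetric] field_simps power2_eq_square eval_nat_numeral)
qed

lemma newman_Phi_sums:
  shows "(\<lambda>k. exp (- half_log k) * newman_phi (u + half_log k)) sums newman_Phi u"
    and "summable (\<lambda>k. \<bar>exp (- half_log k) * newman_phi (u + half_log k)\<bar>)"
proof -
  define n where "n = (\<lambda>k. real (Suc k))"
  define A B where "A = (\<lambda>k. 2 * pi\<^sup>2 * exp (9 * u) * (n k ^ 4 * exp (- (pi * exp (4 * u)) * (n k)\<^sup>2)))"
    and "B = (\<lambda>k. 3 * pi * exp (5 * u) * (n k ^ 2 * exp (- (pi * exp (4 * u)) * (n k)\<^sup>2)))"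
  have AB: "summable A" "summable B"
    unfolding A_def B_def n_def by (intro summable_mult summable_power_gaussian; simp)+
  have eq: "exp (- half_log k) * newman_phi (u + half_log k) = A k - B k" for k
    unfolding newman_phi_shift by (simp add: A_def B_def n_def algebra_simps del: of_nat_Suc)
  have "A k \<ge> 0" "B k \<ge> 0" for k by (simp_all add: A_def B_def)
  then have "\<bar>A k - B k\<bar> \<le> A k + B k" for k by (smt (verit))
  then show s: "summable (\<lambda>k. \<bar>exp (- half_log k) * newman_phi (u + half_log k)\<bar>)"
    unfolding eq by (intro summable_comparison_test'[OF summable_add[OF AB], of 0]) auto
  show "(\<lambda>k. exp (- half_log k) * newman_phi (u + half_log k)) sums newman_Phi u"
    using summable_sums[OF summable_rabs_cancel[OF s]]
    unfolding newman_Phi_def Let_def newman_phi_shift .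
qed

lemma newman_phi_bound_nonneg:
  obtains C where "C > 0" "\<And>v. v \<ge> 0 \<Longrightarrow> \<bar>newman_phi v\<bar> \<le> C * exp (- K * v\<^sup>2)"
proof -
  define T where "T = (\<lambda>v. (2 * pi\<^sup>2 * exp (9 * v) + 3 * pi * exp (5 * v)) * exp (- pi * exp (4 * v) + K * v\<^sup>2))"
  have "(T \<longlongrightarrow> 0) at_top" unfolding T_def by real_asymp
  then have "eventually (\<lambda>u. T u < 1) at_top" by (rule order_tendstoD) simp
  then obtain U where U: "\<And>u. u \<ge> U \<Longrightarrow> T u < 1" by (auto simp: eventually_at_top_linorder)
  have "compact (T ` {0..U})" by (intro compact_continuous_image compact_Icc) (auto simp: T_def intro!: continuous_intros)
  then have "bounded (T ` {0..U})" by (rule compact_imp_bounded)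
  then obtain D where "\<forall>x\<in>T ` {0..U}. norm x \<le> D" unfolding bounded_iff by blast
  then have D: "\<bar>T u\<bar> \<le> D" if "u \<in> {0..U}" for u using that by simp
  have TE: "T u \<le> max D 1" if "u \<ge> 0" for u
    using U[of u] D[of u] that by (cases "u \<ge> U") auto
  have "\<bar>newman_phi v\<bar> \<le> max D 1 * exp (- K * v\<^sup>2)" if v: "v \<ge> 0" for v
  proof -
    have "\<bar>newman_phi v\<bar> \<le> (2 * pi\<^sup>2 * exp (9 * v) + 3 * pi * exp (5 * v)) * exp (- pi * exp (4 * v))"
      unfolding newman_phi_def abs_mult by (intro mult_mono) (auto simp: abs_le_iff)
    also have "\<dots> = T v * exp (- K * v\<^sup>2)" unfolding T_def mult.assoc exp_add[symmetric] by simp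
    also have "\<dots> \<le> max D 1 * exp (- K * v\<^sup>2)" by (intro mult_right_mono TE v) auto
    finally show ?thesis .
  qed
  then show thesis by (intro that[of "max D 1"]) auto
qed

lemma newman_phi_bound_nonpos:
  assumes "v \<le> 0"
  shows "\<bar>newman_phi v\<bar> \<le> (2 * pi\<^sup>2 + 3 * pi) * exp (5 * v)"
proof -
  have "\<bar>newman_phi v\<bar> \<le> (2 * pi\<^sup>2 * exp (9 * v) + 3 * pi * exp (5 * v)) * 1"
    unfolding newman_phi_def abs_mult by (intro mult_mono) (auto simp: abs_le_iff)
  also have "\<dots> \<le> (2 * pi\<^sup>2 + 3 * pi) * exp (5 * v)"
    using assms by (simp add: distrib_right mult_left_mono)
  finally show ?thesis .
qed

text \<open>On the right the doubly exponential decay of phi beats exp (a v^2); on the left phi is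
  only O(exp (5 v)), and there v |v| = - v^2 supplies the decay. Up to a factor depending on n
  alone, this signed weight majorises the Gaussian translated by ln n / 2, for all n.\<close>

lemma newman_phi_integrable:
  assumes a: "a > 0"
  shows "integrable lborel (\<lambda>v. \<bar>newman_phi v\<bar> * exp (a * v * \<bar>v\<bar>) * exp (r * v))"
proof -
  obtain C where C: "C > 0" "\<And>v. v \<ge> 0 \<Longrightarrow> \<bar>newman_phi v\<bar> \<le> C * exp (- (a + 1) * v\<^sup>2)"
    using newman_phi_bound_nonneg by metis
  define M where "M = 2 * pi\<^sup>2 + 3 * pi"
  have M: "M > 0" by (simp add: M_def add_pos_pos)
  define c where "c = min (1/2) (a / 2)"
  have c: "c > 0" "c \<le> 1/2" "c \<le> a / 2" using a by (auto simp: c_def)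
  define D where "D = C * exp (r\<^sup>2 / 2) + M * exp ((r + 5)\<^sup>2 / (2 * a))"
  show ?thesis
  proof (rule Bochner_Integration.integrable_bound)
    show "integrable lborel (\<lambda>v::real. D * exp (- c * v\<^sup>2))"
      by (intro integrable_mult_right integrable_exp_neg_square c)
    have "\<bar>newman_phi v\<bar> * exp (a * v * \<bar>v\<bar>) * exp (r * v) \<le> D * exp (- c * v\<^sup>2)" for v
    proof (cases "v \<ge> 0")
      case True
      have "\<bar>newman_phi v\<bar> * exp (a * v * \<bar>v\<bar>) * exp (r * v) \<le> C * exp (- (a + 1) * v\<^sup>2) * exp (a * v * \<bar>v\<bar>) * exp (r * v)"
        by (intro mult_right_mono C True) auto
      also have "\<dots> = C * exp (r * v - v\<^sup>2)"
        using True by (simp add: mult.assoc algebra_simps power2_eq_square flip: exp_add)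
      also have "\<dots> \<le> C * exp (r\<^sup>2 / 2 - c * v\<^sup>2)"
      proof -
        have "0 \<le> (r - v)\<^sup>2" by simp
        moreover have "c * v\<^sup>2 \<le> 1/2 * v\<^sup>2" using c by (intro mult_right_mono) auto
        ultimately have "r * v - v\<^sup>2 \<le> r\<^sup>2 / 2 - c * v\<^sup>2" by (simp add: power2_diff)
        then show ?thesis using C(1) by simp
      qed
      also have "\<dots> = C * exp (r\<^sup>2 / 2) * exp (- c * v\<^sup>2)" unfolding mult.assoc exp_add[symmetric] by simp
      also have "\<dots> \<le> D * exp (- c * v\<^sup>2)" using M by (intro mult_right_mono) (auto simp: D_def)
      finally show ?thesis .
    next
      case False
      have "\<bar>newman_phi v\<bar> * exp (a * v * \<bar>v\<bar>) * exp (r * v) \<le> M * exp (5 * v) * exp (a * v * \<bar>v\<bar>) * exp (r * v)"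
        using newman_phi_bound_nonpos[of v] False by (intro mult_right_mono) (auto simp: M_def)
      also have "\<dots> = M * exp ((r + 5) * v - a * v\<^sup>2)"
        using False by (simp add: mult.assoc algebra_simps power2_eq_square flip: exp_add)
      also have "\<dots> \<le> M * exp ((r + 5)\<^sup>2 / (2 * a) - c * v\<^sup>2)"
      proof -
        have "0 \<le> ((r + 5) - a * v)\<^sup>2 / (2 * a)" using a by simp
        also have "\<dots> = (r + 5)\<^sup>2 / (2 * a) - (r + 5) * v + a / 2 * v\<^sup>2"
          using a by (simp add: power2_diff field_simps power2_eq_square)
        finally have "(r + 5) * v - a * v\<^sup>2 \<le> (r + 5)\<^sup>2 / (2 * a) - a / 2 * v\<^sup>2" by (simp add: algebra_simps)
        moreover have "c * v\<^sup>2 \<le> a / 2 * v\<^sup>2" using c by (intro mult_right_mono) auto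
        ultimately show ?thesis using M by simp
      qed
      also have "\<dots> = M * exp ((r + 5)\<^sup>2 / (2 * a)) * exp (- c * v\<^sup>2)" unfolding mult.assoc exp_add[symmetric] by simp
      also have "\<dots> \<le> D * exp (- c * v\<^sup>2)" using C(1) by (intro mult_right_mono) (auto simp: D_def)
      finally show ?thesis .
    qed
    moreover have "D > 0" using C(1) M by (auto simp: D_def intro!: add_pos_pos)
    ultimately show "AE v in lborel. norm (\<bar>newman_phi v\<bar> * exp (a * v * \<bar>v\<bar>) * exp (r * v)) \<le> norm (D * exp (- c * v\<^sup>2))"
      by (intro AE_I2) (simp add: abs_mult)
  qed simp
qed

definition phi_transform :: "real \<Rightarrow> complex \<Rightarrow> complex" where
  "phi_transform a z = (\<integral>v. of_real (exp (- a * v\<^sup>2) * newman_phi v) * exp (\<i> * z * of_real v) \<partial>lborel)"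

lemma lborel_integral_half_line:
  fixes g :: "real \<Rightarrow> complex"
  assumes g: "integrable lborel g"
  shows "(\<integral>u. g u \<partial>lborel) = (\<integral>u. indicator {0..} u *\<^sub>R (g u + g (- u)) \<partial>lborel)"
proof -
  have g': "integrable lborel (\<lambda>u. g (- u))" using lborel_integrable_real_affine[OF g, of "- 1" 0] by simp
  have i1: "integrable lborel (\<lambda>u. indicator {0..} u *\<^sub>R g u)" and i2: "integrable lborel (\<lambda>u. indicator {0..} u *\<^sub>R g (- u))"
    and i3: "integrable lborel (\<lambda>u. indicator {..0} u *\<^sub>R g u)"
    by (intro integrable_mult_indicator g g'; simp)+
  have "(\<integral>u. indicator {0..} u *\<^sub>R (g u + g (- u)) \<partial>lborel) = (\<integral>u. indicator {0..} u *\<^sub>R g u \<partial>lborel) + (\<integral>u. indicator {0..} u *\<^sub>R g (- u) \<partial>lborel)"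
    unfolding scaleR_add_right by (rule Bochner_Integration.integral_add[OF i1 i2])
  also have "(\<integral>u. indicator {0..} u *\<^sub>R g (- u) \<partial>lborel) = (\<integral>u. indicator {..0} u *\<^sub>R g u \<partial>lborel)"
    by (subst lborel_integral_real_affine[where c = "- 1" and t = 0])
       (auto intro!: Bochner_Integration.integral_cong split: split_indicator)
  also have "(\<integral>u. indicator {0..} u *\<^sub>R g u \<partial>lborel) + (\<integral>u. indicator {..0} u *\<^sub>R g u \<partial>lborel) = (\<integral>u. indicator {0..} u *\<^sub>R g u + indicator {..0} u *\<^sub>R g u \<partial>lborel)"
    by (rule Bochner_Integration.integral_add[OF i1 i3, symmetric])
  also have "\<dots> = (\<integral>u. g u \<partial>lborel)"
  proof (rule integral_cong_AE)
    show "AE u in lborel. indicator {0..} u *\<^sub>R g u + indicator {..0} u *\<^sub>R g u = g u"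
      using AE_lborel_singleton[of "0::real"] by eventually_elim (auto split: split_indicator)
  qed (use i1 i3 g in auto)
  finally show ?thesis by simp
qed

text \<open>Since \<open>newman_Phi\<close> is even, 2 H is a Fourier integral over the whole line.
  Substituting u = v - L in the n-th summand expands the Gaussian exp (- a (v - L)^2), and the cross
  term exp (2 a L v) moves into the argument of \<open>phi_transform\<close>. The case a = 0 is
  included because it yields the zeta function.\<close>

lemma newman_H_series:
  assumes a: "a \<ge> 0"
    and int: "integrable lborel (\<lambda>v. \<bar>newman_phi v\<bar> * exp (a * v * \<bar>v\<bar>) * exp (- Im z * v))"
    and sm: "summable (\<lambda>k. exp (- half_log k) * exp (Im z * half_log k - a * (half_log k)\<^sup>2 / 2))"
  shows "(\<lambda>k. of_real (exp (- half_log k) * exp (- a * (half_log k)\<^sup>2)) * exp (- \<i> * z * of_real (half_log k)) *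
      phi_transform a (z - 2 * \<i> * of_real (a * half_log k))) sums (2 * newman_H (- a) z)"
proof -
  define L where "L = half_log"
  define y where "y = Im z"
  define W where "W = (\<lambda>v. \<bar>newman_phi v\<bar> * exp (a * v * \<bar>v\<bar>) * exp (- y * v))"
  define N where "N = (\<lambda>k. exp (- L k) * exp (y * L k - a * (L k)\<^sup>2 / 2))"
  define T where "T = (\<lambda>k u. of_real (exp (- L k) * newman_phi (u + L k) * exp (- a * u\<^sup>2)) * exp (\<i> * z * of_real u))"
  define g where "g = (\<lambda>u. of_real (exp (- a * u\<^sup>2) * newman_Phi u) * exp (\<i> * z * of_real u))"
  have W: "integrable lborel W" using int by (simp add: W_def y_def)
  have [measurable]: "T k \<in> borel_measurable borel" for k unfolding T_def by measurable
  have shift: "T k (- L k + 1 * v) = of_real (exp (- L k) * exp (- a * (L k)\<^sup>2)) * exp (- \<i> * z * of_real (L k)) *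
      (of_real (exp (- a * v\<^sup>2) * newman_phi v) * exp (\<i> * (z - 2 * \<i> * of_real (a * L k)) * of_real v))" for k v
  proof -
    have 1: "exp (\<i> * z * of_real (- L k + 1 * v)) = exp (- \<i> * z * of_real (L k)) * exp (\<i> * z * of_real v)"
      by (simp add: algebra_simps flip: exp_add)
    have 2: "exp (\<i> * (z - 2 * \<i> * of_real (a * L k)) * of_real v) = exp (\<i> * z * of_real v) * of_real (exp (2 * a * L k * v))"
      by (simp add: algebra_simps exp_add[symmetric] flip: exp_of_real)
    have 3: "exp (- a * (- L k + 1 * v)\<^sup>2) = exp (- a * (L k)\<^sup>2) * (exp (- a * v\<^sup>2) * exp (2 * a * L k * v))"
      unfolding exp_add[symmetric] by (simp add: power2_eq_square algebra_simps)
    show ?thesis unfolding T_def 1 2 3 by simp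
  qed
  have nT: "norm (T k (- L k + 1 * v)) \<le> N k * W v" for k v
  proof -
    have n: "norm (exp (\<i> * z * of_real u)) = exp (- y * u)" for u by (simp add: y_def)
    \<comment> \<open>For v >= 0 the cross term is absorbed by 2 L v <= L^2 / 2 + 2 v^2; for v < 0
      it is nonpositive. Half of the Gaussian in L is kept for the summation over k.\<close>
    have "a * (2 * L k * v) - a * v\<^sup>2 - a * (L k)\<^sup>2 \<le> a * v * \<bar>v\<bar> - a * (L k)\<^sup>2 / 2"
    proof (cases "v \<ge> 0")
      case True
      have "0 \<le> a * ((L k - 2 * v)\<^sup>2 / 2)" using a by simp
      then show ?thesis using True by (simp add: power2_diff power2_eq_square algebra_simps)
    next
      case False
      then have "a * (L k * v) \<le> 0" using a half_log_nonneg[of k] by (simp add: L_def mult_nonneg_nonpos)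
      moreover have "a * (L k)\<^sup>2 \<ge> 0" using a by simp
      ultimately show ?thesis using False by (simp add: power2_eq_square algebra_simps)
    qed
    then have le: "exp (- a * (- L k + 1 * v)\<^sup>2) \<le> exp (a * v * \<bar>v\<bar>) * exp (- a * (L k)\<^sup>2 / 2)"
      unfolding exp_add[symmetric] by (simp add: power2_eq_square algebra_simps)
    have "norm (T k (- L k + 1 * v)) = exp (- L k) * \<bar>newman_phi v\<bar> * exp (- a * (- L k + 1 * v)\<^sup>2) * exp (- y * (- L k + 1 * v))"
      unfolding T_def norm_mult n norm_of_real abs_mult by simp
    also have "\<dots> \<le> exp (- L k) * \<bar>newman_phi v\<bar> * (exp (a * v * \<bar>v\<bar>) * exp (- a * (L k)\<^sup>2 / 2)) * exp (- y * (- L k + 1 * v))"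
      by (intro mult_right_mono mult_left_mono le) auto
    also have "exp (- y * (- L k + 1 * v)) = exp (y * L k) * exp (- y * v)" unfolding exp_add[symmetric] by (simp add: algebra_simps)
    also have "exp (- L k) * \<bar>newman_phi v\<bar> * (exp (a * v * \<bar>v\<bar>) * exp (- a * (L k)\<^sup>2 / 2)) * (exp (y * L k) * exp (- y * v)) = N k * W v"
    proof -
      have "exp (y * L k - a * (L k)\<^sup>2 / 2) = exp (y * L k) * exp (- a * (L k)\<^sup>2 / 2)" by (simp flip: exp_add)
      then show ?thesis by (simp only: N_def W_def mult_ac)
    qed
    finally show ?thesis .
  qed
  have N: "N k \<ge> 0" for k by (simp add: N_def)
  have Wn: "W v \<ge> 0" for v by (simp add: W_def)
  have intT': "integrable lborel (\<lambda>v. T k (- L k + 1 * v))" for k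
  proof (rule Bochner_Integration.integrable_bound[OF integrable_mult_right[OF W, of "N k"]])
    show "AE v in lborel. norm (T k (- L k + 1 * v)) \<le> norm (N k * W v)"
      using nT N Wn by (intro AE_I2) (simp add: abs_mult)
  qed simp
  have intT: "integrable lborel (T k)" for k
    using intT'[of k] lborel_integrable_real_affine_iff[of 1 "T k" "- L k"] by simp
  have intn: "(\<integral>u. norm (T k u) \<partial>lborel) \<le> N k * (\<integral>v. W v \<partial>lborel)" for k
  proof -
    have "(\<integral>u. norm (T k u) \<partial>lborel) = (\<integral>v. norm (T k (- L k + 1 * v)) \<partial>lborel)"
      using lborel_integral_real_affine[of 1 "\<lambda>u. norm (T k u)" "- L k"] by simp
    also have "\<dots> \<le> (\<integral>v. N k * W v \<partial>lborel)"
      by (rule integral_mono) (use nT intT' W in auto)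
    finally show ?thesis by simp
  qed
  have Tsum: "(\<lambda>k. T k u) sums g u" for u
  proof -
    have eq: "T k u = of_real (exp (- half_log k) * newman_phi (u + half_log k)) * (of_real (exp (- a * u\<^sup>2)) * exp (\<i> * z * of_real u))" for k
      by (simp add: T_def L_def)
    have "(\<lambda>k. of_real (exp (- half_log k) * newman_phi (u + half_log k)) * (of_real (exp (- a * u\<^sup>2)) * exp (\<i> * z * of_real u)))
        sums (of_real (newman_Phi u) * (of_real (exp (- a * u\<^sup>2)) * exp (\<i> * z * of_real u)))"
      by (intro sums_mult2 sums_of_real newman_Phi_sums(1))
    then show ?thesis unfolding eq g_def by (simp add: mult_ac)
  qed
  have Tabs: "summable (\<lambda>k. norm (T k u))" for u
  proof -
    have "norm (T k u) = \<bar>exp (- half_log k) * newman_phi (u + half_log k)\<bar> * norm (of_real (exp (- a * u\<^sup>2)) * exp (\<i> * z * of_real u))" for k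
      by (simp add: T_def L_def norm_mult abs_mult)
    then show ?thesis using summable_mult2[OF newman_Phi_sums(2)] by simp
  qed
  have sn: "summable (\<lambda>k. \<integral>u. norm (T k u) \<partial>lborel)"
  proof (rule summable_comparison_test'[of "\<lambda>k. N k * (\<integral>v. W v \<partial>lborel)" 0])
    show "summable (\<lambda>k. N k * (\<integral>v. W v \<partial>lborel))" using sm by (intro summable_mult2) (simp add: N_def L_def y_def)
    show "norm (\<integral>u. norm (T k u) \<partial>lborel) \<le> N k * (\<integral>v. W v \<partial>lborel)" for k
      using intn[of k] by simp
  qed
  have gsum: "g = (\<lambda>u. \<Sum>k. T k u)" using Tsum by (simp add: sums_iff fun_eq_iff)
  have intg: "integrable lborel g" unfolding gsum
    by (rule integrable_suminf[OF intT _ sn]) (simp add: Tabs)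
  have "(\<lambda>k. \<integral>u. T k u \<partial>lborel) sums (\<integral>u. g u \<partial>lborel)" unfolding gsum
    by (rule sums_integral[OF intT _ sn]) (simp add: Tabs)
  moreover have "(\<integral>u. T k u \<partial>lborel) = of_real (exp (- L k) * exp (- a * (L k)\<^sup>2)) * exp (- \<i> * z * of_real (L k)) *
      phi_transform a (z - 2 * \<i> * of_real (a * L k))" for k
  proof -
    have "(\<integral>u. T k u \<partial>lborel) = (\<integral>v. T k (- L k + 1 * v) \<partial>lborel)"
      using lborel_integral_real_affine[of 1 "T k" "- L k"] by simp
    also have "\<dots> = of_real (exp (- L k) * exp (- a * (L k)\<^sup>2)) * exp (- \<i> * z * of_real (L k)) * phi_transform a (z - 2 * \<i> * of_real (a * L k))"
      unfolding shift phi_transform_def by (rule integral_mult_right_zero)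
    finally show ?thesis .
  qed
  moreover have "(\<integral>u. g u \<partial>lborel) = 2 * newman_H (- a) z"
  proof -
    have "(\<integral>u. g u \<partial>lborel) = (\<integral>u. indicator {0..} u *\<^sub>R (g u + g (- u)) \<partial>lborel)"
      by (rule lborel_integral_half_line[OF intg])
    also have "\<dots> = (\<integral>u. 2 * (indicator {0..} u *\<^sub>R (of_real (exp (- a * u\<^sup>2) * newman_Phi u) * cos (z * of_real u))) \<partial>lborel)"
      by (rule Bochner_Integration.integral_cong)
         (auto simp: g_def newman_Phi_even cos_exp_eq field_simps split: split_indicator)
    also have "\<dots> = 2 * newman_H (- a) z"
      unfolding newman_H_def set_lebesgue_integral_def by (rule integral_mult_right_zero)
    finally show ?thesis .
  qed
  ultimately show ?thesis by (simp only: L_def)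
qed

text \<open>Euler's integral for Gamma after the substitution t = pi exp (4 v).\<close>

lemma gamma_exp_integral:
  assumes p: "Re p > 0"
  shows "integrable lborel (\<lambda>v. exp (4 * p * of_real v) * of_real (exp (- pi * exp (4 * v))))"
    and "(\<integral>v. exp (4 * p * of_real v) * of_real (exp (- pi * exp (4 * v))) \<partial>lborel) = exp (- p * of_real (ln pi)) * Gamma p / 4"
proof -
  define f where "f = (\<lambda>t. complex_of_real t powr (p - 1) / of_real (exp t))"
  define G where "G = (\<lambda>v. exp (4 * p * of_real v) * of_real (exp (- pi * exp (4 * v))) :: complex)"
  have [measurable]: "G \<in> borel_measurable lborel" unfolding G_def by measurable
  define K where "K = 4 * exp (p * of_real (ln pi))"
  have K: "K \<noteq> 0" by (simp add: K_def)
  have im: "(\<lambda>v. pi * exp (4 * v)) ` UNIV = {0<..}"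
  proof (intro equalityI subsetI)
    fix t :: real assume t: "t \<in> {0<..}"
    then have "t = pi * exp (4 * (ln (t / pi) / 4))" by simp
    then show "t \<in> (\<lambda>v. pi * exp (4 * v)) ` UNIV" by blast
  qed auto
  have eq: "\<bar>4 * pi * exp (4 * v)\<bar> *\<^sub>R f (pi * exp (4 * v)) = K * G v" for v
  proof -
    have l: "ln (pi * exp (4 * v)) = ln pi + 4 * v" by (simp add: ln_mult)
    have pe: "complex_of_real (pi * exp (4 * v)) = exp (of_real (ln pi + 4 * v))"
      by (simp add: exp_add exp_of_real flip: of_real_mult)
    have "complex_of_real (pi * exp (4 * v)) powr (p - 1) = exp ((p - 1) * of_real (ln pi + 4 * v))"
      using l by (simp add: powr_def Ln_of_real del: of_real_mult)
    then have "\<bar>4 * pi * exp (4 * v)\<bar> *\<^sub>R f (pi * exp (4 * v)) = 4 * (exp (of_real (ln pi + 4 * v)) * exp ((p - 1) * of_real (ln pi + 4 * v))) / of_real (exp (pi * exp (4 * v)))"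
      unfolding f_def pe[symmetric] by (simp add: scaleR_conv_of_real)
    also have "exp (of_real (ln pi + 4 * v)) * exp ((p - 1) * of_real (ln pi + 4 * v)) = exp (p * of_real (ln pi)) * exp (4 * p * of_real v)"
      unfolding exp_add[symmetric] by (simp add: algebra_simps)
    finally show ?thesis by (simp add: K_def G_def exp_minus field_simps)
  qed
  have "(\<lambda>v. \<bar>4 * pi * exp (4 * v)\<bar> *\<^sub>R f (pi * exp (4 * v))) absolutely_integrable_on UNIV \<and>
      integral UNIV (\<lambda>v. \<bar>4 * pi * exp (4 * v)\<bar> *\<^sub>R f (pi * exp (4 * v))) = Gamma p"
  proof (subst has_absolute_integral_change_of_variables_real)
    show "((\<lambda>v. pi * exp (4 * v)) has_real_derivative 4 * pi * exp (4 * v)) (at v within UNIV)" for v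
      by (auto intro!: derivative_eq_intros)
    show "inj (\<lambda>v. pi * exp (4 * v))" by (auto intro!: injI)
    show "f absolutely_integrable_on range (\<lambda>v. pi * exp (4 * v)) \<and> integral (range (\<lambda>v. pi * exp (4 * v))) f = Gamma p"
      unfolding im f_def using absolutely_integrable_Gamma_integral'[OF p] integral_unique[OF Gamma_integral_complex'[OF p]] by blast
  qed simp
  then have abs: "(\<lambda>v. K * G v) absolutely_integrable_on UNIV" and val: "integral UNIV (\<lambda>v. K * G v) = Gamma p"
    unfolding eq by auto
  have KG: "integrable lebesgue (\<lambda>v. K * G v)" using abs by (simp add: set_integrable_def)
  then have KG': "integrable lborel (\<lambda>v. K * G v)" by (simp add: integrable_completion)
  have "integrable lborel G"
    using integrable_mult_right[OF KG', of "inverse K"] K by (simp add: mult.assoc[symmetric])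
  then show "integrable lborel (\<lambda>v. exp (4 * p * of_real v) * of_real (exp (- pi * exp (4 * v))))"
    by (simp only: G_def)
  have "(\<integral>v. K * G v \<partial>lborel) = (\<integral>v. K * G v \<partial>lebesgue)" by (simp add: integral_completion)
  also have "\<dots> = Gamma p" using integral_lebesgue[OF KG] val by (simp only:)
  finally have "K * (\<integral>v. G v \<partial>lborel) = Gamma p" by simp
  then show "(\<integral>v. exp (4 * p * of_real v) * of_real (exp (- pi * exp (4 * v))) \<partial>lborel) = exp (- p * of_real (ln pi)) * Gamma p / 4"
    using K unfolding G_def[symmetric] by (simp add: K_def exp_minus field_simps)
qed

lemma Re_pos_not_nonpos_Ints: "Re w > 0 \<Longrightarrow> w \<notin> \<int>\<^sub>\<le>\<^sub>0"
  by (auto elim!: nonpos_Ints_cases)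

text \<open>The terms with exp (9 v) and exp (5 v) give Gamma (p + 1) = p Gamma p and Gamma p. They
  combine to the factor 2 p - 3, which equals s - 1 for s = 1/2 + i z / 2 and so cancels the pole of
  zeta.\<close>

lemma phi_transform_0:
  assumes z: "Im z < 5" and p: "p = (5 + \<i> * z) / 4"
  shows "phi_transform 0 z = exp ((1 - p) * of_real (ln pi)) * Gamma p * (2 * p - 3) / 4"
    and "integrable lborel (\<lambda>v. \<bar>newman_phi v\<bar> * exp (- Im z * v))"
proof -
  define E where "E = (\<lambda>q v. exp (4 * q * of_real v) * of_real (exp (- pi * exp (4 * v))) :: complex)"
  have Rep: "Re p > 0" using z by (simp add: p)
  then have Rep1: "Re (p + 1) > 0" by simp
  have E1: "integrable lborel (E p)" "(\<integral>v. E p v \<partial>lborel) = exp (- p * of_real (ln pi)) * Gamma p / 4"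
    using gamma_exp_integral[OF Rep] by (simp_all only: E_def)
  have E2: "integrable lborel (E (p + 1))" "(\<integral>v. E (p + 1) v \<partial>lborel) = exp (- (p + 1) * of_real (ln pi)) * Gamma (p + 1) / 4"
    using gamma_exp_integral[OF Rep1] by (simp_all only: E_def)
  have eq: "of_real (newman_phi v) * exp (\<i> * z * of_real v) = 2 * of_real pi ^ 2 * E (p + 1) v - 3 * of_real pi * E p v" for v
  proof -
    have "4 * (p + 1) * of_real v = of_real (9 * v) + \<i> * z * of_real v" "4 * p * of_real v = of_real (5 * v) + \<i> * z * of_real v"
      by (simp_all add: p field_simps)
    then have "exp (4 * (p + 1) * of_real v) = of_real (exp (9 * v)) * exp (\<i> * z * of_real v)"
        "exp (4 * p * of_real v) = of_real (exp (5 * v)) * exp (\<i> * z * of_real v)"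
      by (simp_all only: exp_add exp_of_real)
    then show ?thesis by (simp add: E_def newman_phi_def algebra_simps)
  qed
  have int: "integrable lborel (\<lambda>v. of_real (newman_phi v) * exp (\<i> * z * of_real v))"
    unfolding eq by (intro Bochner_Integration.integrable_diff integrable_mult_right E1(1) E2(1))
  have "norm (of_real (newman_phi v) * exp (\<i> * z * of_real v)) = \<bar>newman_phi v\<bar> * exp (- Im z * v)" for v
    by (simp add: norm_mult)
  with integrable_norm[OF int] show "integrable lborel (\<lambda>v. \<bar>newman_phi v\<bar> * exp (- Im z * v))" by simp
  have "phi_transform 0 z = (\<integral>v. 2 * of_real pi ^ 2 * E (p + 1) v - 3 * of_real pi * E p v \<partial>lborel)"
    unfolding phi_transform_def eq[symmetric] by simp
  also have "\<dots> = 2 * of_real pi ^ 2 * (\<integral>v. E (p + 1) v \<partial>lborel) - 3 * of_real pi * (\<integral>v. E p v \<partial>lborel)"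
    by (subst Bochner_Integration.integral_diff) (auto intro: E1(1) E2(1))
  also have "\<dots> = 2 * of_real pi ^ 2 * (exp (- (p + 1) * of_real (ln pi)) * Gamma (p + 1) / 4) - 3 * of_real pi * (exp (- p * of_real (ln pi)) * Gamma p / 4)"
    unfolding E1(2) E2(2) ..
  also have "Gamma (p + 1) = p * Gamma p" by (intro Gamma_plus1 Re_pos_not_nonpos_Ints Rep)
  also have "exp (- (p + 1) * of_real (ln pi)) = exp ((1 - p) * of_real (ln pi)) / of_real pi ^ 2"
  proof -
    have "of_real pi = (exp (of_real (ln pi)) :: complex)" by (simp add: exp_of_real)
    then have "exp (- (p + 1) * of_real (ln pi)) * of_real pi ^ 2 = exp (- (p + 1) * of_real (ln pi)) * (exp (of_real (ln pi)) * exp (of_real (ln pi)))"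
      by (simp only: power2_eq_square)
    also have "\<dots> = exp ((1 - p) * of_real (ln pi))" unfolding exp_add[symmetric] by (simp add: algebra_simps)
    finally show ?thesis by (simp add: field_simps)
  qed
  also have "exp (- p * of_real (ln pi)) = exp ((1 - p) * of_real (ln pi)) / of_real pi"
  proof -
    have "of_real pi = (exp (of_real (ln pi)) :: complex)" by (simp add: exp_of_real)
    then have "exp (- p * of_real (ln pi)) * of_real pi = exp (- p * of_real (ln pi)) * exp (of_real (ln pi))"
      by (simp only:)
    also have "\<dots> = exp ((1 - p) * of_real (ln pi))" unfolding exp_add[symmetric] by (simp add: algebra_simps)
    finally show ?thesis by (simp add: field_simps)
  qed
  also have "2 * of_real pi ^ 2 * (exp ((1 - p) * of_real (ln pi)) / of_real pi ^ 2 * (p * Gamma p) / 4)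
      - 3 * of_real pi * (exp ((1 - p) * of_real (ln pi)) / of_real pi * Gamma p / 4)
      = exp ((1 - p) * of_real (ln pi)) * Gamma p * (2 * p - 3) / 4"
    by (simp add: right_diff_distrib diff_divide_distrib)
  finally show "phi_transform 0 z = exp ((1 - p) * of_real (ln pi)) * Gamma p * (2 * p - 3) / 4" .
qed

text \<open>For a = 0 all translates have the same transform, and exp (- L - i z L) with L = ln n /
  2 is n^(-s). The remaining series is the Dirichlet series of zeta; Im z < -1 means Re s >
  1.\<close>

lemma newman_H_0_zeta_halfplane:
  assumes z: "Im z < - 1" and s: "s = 1 / 2 + \<i> * z / 2"
  shows "2 * newman_H 0 z = riemann_zeta s * phi_transform 0 z"
proof -
  have Re: "Re s > 1" using z by (simp add: s)
  have pw: "of_nat (Suc k) powr (- s) = of_real (exp (- half_log k)) * exp (- \<i> * z * of_real (half_log k))" for k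
  proof -
    have "of_nat (Suc k) powr (- s) = exp (- s * of_real (ln (real (Suc k))))"
      by (simp add: powr_def Ln_of_nat del: of_nat_Suc)
    also have "- s * of_real (ln (real (Suc k))) = of_real (- half_log k) + - \<i> * z * of_real (half_log k)"
      by (simp add: s half_log_def field_simps del: of_nat_Suc)
    finally show ?thesis by (simp only: exp_add exp_of_real)
  qed
  have "(\<lambda>k. of_real (exp (- half_log k) * exp (- 0 * (half_log k)\<^sup>2)) * exp (- \<i> * z * of_real (half_log k)) *
      phi_transform 0 (z - 2 * \<i> * of_real (0 * half_log k))) sums (2 * newman_H (- 0) z)"
  proof (rule newman_H_series)
    show "integrable lborel (\<lambda>v. \<bar>newman_phi v\<bar> * exp (0 * v * \<bar>v\<bar>) * exp (- Im z * v))"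
      using phi_transform_0(2)[of z, OF _ refl] z by simp
    have "exp (- half_log k) * exp (Im z * half_log k - 0 * (half_log k)\<^sup>2 / 2) = real (Suc k) powr ((Im z - 1) / 2)" for k
      by (simp add: half_log_def powr_def field_simps del: of_nat_Suc flip: exp_add)
    then show "summable (\<lambda>k. exp (- half_log k) * exp (Im z * half_log k - 0 * (half_log k)\<^sup>2 / 2))"
      using z by (simp only:) (intro summable_Suc_powr, simp)
  qed simp
  then have "(\<lambda>k. of_nat (Suc k) powr (- s) * phi_transform 0 z) sums (2 * newman_H 0 z)" unfolding pw by simp
  moreover have "(\<lambda>k. of_nat (Suc k) powr (- s) * phi_transform 0 z) sums (riemann_zeta s * phi_transform 0 z)"
    by (intro sums_mult2 riemann_zeta_sums Re)
  ultimately show ?thesis by (rule sums_unique2)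
qed

text \<open>G replaces (s - 1) zeta s so that the identity also holds at s = 1, where z = - i. The
  half-plane Im z < 1 contains the closed lower half-plane, which suffices by evenness, and Gamma
  ((5 + i z) / 4) is holomorphic there.\<close>

lemma newman_H_0_zeta:
  obtains G where "\<And>s. s \<noteq> 1 \<Longrightarrow> G s = (s - 1) * riemann_zeta s"
    "\<And>z. Im z < 1 \<Longrightarrow> newman_H 0 z = exp ((1 - (5 + \<i> * z) / 4) * of_real (ln pi)) * Gamma ((5 + \<i> * z) / 4) * G (1 / 2 + \<i> * z / 2) / 8"
proof -
  obtain G where G: "G holomorphic_on UNIV" "\<And>s. s \<noteq> 1 \<Longrightarrow> G s = (s - 1) * riemann_zeta s"
    using zeta_times_entire by blast
  define R where "R = (\<lambda>z. exp ((1 - (5 + \<i> * z) / 4) * of_real (ln pi)) * Gamma ((5 + \<i> * z) / 4) * G (1 / 2 + \<i> * z / 2) / 8)"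
  have "newman_H 0 z = R z" if z: "Im z < 1" for z
  proof (rule analytic_continuation_open[of "{z. Im z < - 1}" "{z. Im z < 1}" "newman_H 0" R])
    show "{z. Im z < - 1} \<noteq> {}" by (auto intro!: exI[of _ "- 2 * \<i>"])
    show "connected {z. Im z < 1}" by (intro convex_connected convex_halfspace_Im_lt)
    show "newman_H 0 holomorphic_on {z. Im z < 1}"
      using holomorphic_on_subset[OF cosine_transform_holomorphic[OF newman_Phi_gaussian_kernel], of "{z. Im z < 1}"]
      by (simp add: newman_H_cosine_transform)
    have hG: "(\<lambda>z. G (1 / 2 + \<i> * z / 2)) holomorphic_on {z. Im z < 1}"
      by (rule holomorphic_on_compose_gen[OF _ G(1), unfolded o_def, of "\<lambda>z. 1 / 2 + \<i> * z / 2"]) (auto intro!: holomorphic_intros)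
    have hGam: "(\<lambda>z. Gamma ((5 + \<i> * z) / 4)) holomorphic_on {z. Im z < 1}"
    proof (intro holomorphic_Gamma' holomorphic_intros)
      fix w assume "w \<in> {z. Im z < 1}"
      then have "Re ((5 + \<i> * w) / 4) > 0" by simp
      then show "(5 + \<i> * w) / 4 \<notin> \<int>\<^sub>\<le>\<^sub>0" by (rule Re_pos_not_nonpos_Ints)
    qed auto
    show "R holomorphic_on {z. Im z < 1}" unfolding R_def
      by (intro holomorphic_on_mult holomorphic_on_divide hG hGam) (auto intro!: holomorphic_intros)
    show "newman_H 0 w = R w" if "w \<in> {z. Im z < - 1}" for w
    proof -
      define s where "s = 1 / 2 + \<i> * w / 2"
      have w: "Im w < - 1" using that by simp
      have "Re s > 1" using w by (simp add: s_def)
      then have "s \<noteq> 1" by auto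
      have "2 * ((5 + \<i> * w) / 4) - 3 = s - 1" by (simp add: s_def field_simps)
      then have pt: "phi_transform 0 w = exp ((1 - (5 + \<i> * w) / 4) * of_real (ln pi)) * Gamma ((5 + \<i> * w) / 4) * (s - 1) / 4"
        using phi_transform_0(1)[of w "(5 + \<i> * w) / 4"] w by simp
      have "newman_H 0 w = (2 * newman_H 0 w) / 2" by simp
      also have "\<dots> = riemann_zeta s * phi_transform 0 w / 2" unfolding newman_H_0_zeta_halfplane[OF w s_def] ..
      finally have "newman_H 0 w = riemann_zeta s * phi_transform 0 w / 2" .
      then show ?thesis unfolding pt R_def s_def[symmetric] G(2)[OF \<open>s \<noteq> 1\<close>] by (simp add: field_simps)
    qed
  qed (use z in \<open>auto intro: open_halfspace_Im_lt\<close>)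
  then show thesis using G(2) unfolding R_def by (rule that[rotated])
qed

text \<open>Below the real axis the exponential and Gamma factors do not vanish, so a zero gives G s
  = 0 with Re s > 1/2. The point s = 1 is excluded by positivity on the imaginary axis, the open
  strip by the hypothesis, and Re s >= 1 by \<open>zeta_nonzero\<close>; evenness handles the upper
  half-plane.\<close>

theorem newman_H_0_real_zeros:
  assumes RH: "riemann_hypothesis" and z: "newman_H 0 z = 0"
  shows "z \<in> \<real>"
proof -
  obtain G where G: "\<And>s. s \<noteq> 1 \<Longrightarrow> G s = (s - 1) * riemann_zeta s"
    "\<And>z. Im z < 1 \<Longrightarrow> newman_H 0 z = exp ((1 - (5 + \<i> * z) / 4) * of_real (ln pi)) * Gamma ((5 + \<i> * z) / 4) * G (1 / 2 + \<i> * z / 2) / 8"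
    using newman_H_0_zeta by metis
  note K = newman_Phi_gaussian_kernel
  have HK: "newman_H 0 = cosine_transform newman_Phi" by (simp add: newman_H_cosine_transform)
  have no: "newman_H 0 w \<noteq> 0" if w: "Im w < 0" for w
  proof
    assume 0: "newman_H 0 w = 0"
    define s where "s = 1 / 2 + \<i> * w / 2"
    have Re: "Re s > 1 / 2" using w by (simp add: s_def)
    have "Re ((5 + \<i> * w) / 4) > 0" using w by simp
    then have "Gamma ((5 + \<i> * w) / 4) \<noteq> 0"
      unfolding Gamma_eq_zero_iff by (rule Re_pos_not_nonpos_Ints)
    then have Gs: "G s = 0" using G(2)[of w] 0 w by (simp add: s_def)
    show False
    proof (cases "s = 1")
      case True
      then have "w = \<i> * of_real (- 1)" by (simp add: s_def field_simps complex_eq_iff)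
      then show False using 0 cosine_transform_imaginary_axis[OF K, of "- 1"] cosine_transform_imaginary_pos[OF K, of "- 1"]
        by (simp only: HK of_real_eq_0_iff)
    next
      case False
      then have "riemann_zeta s = 0" using G(1) Gs by simp
      then show False using zeta_nonzero[of s] RH Re False unfolding riemann_hypothesis_def
        by (metis less_eq_real_def linorder_not_less order_less_trans half_gt_zero zero_less_one order_less_irrefl)
    qed
  qed
  have "newman_H 0 (- z) = 0" using z cosine_transform_even[OF K] by (simp add: HK)
  then have "\<not> Im z < 0" "\<not> Im (- z) < 0" using no z by blast+
  then show ?thesis by (simp add: complex_is_Real_iff)
qed

section \<open>The limiting Dirichlet series\<close>

text \<open>Completing the square with r + 4 in place of r leaves exp (- 4 L) = n^(-2) as a summable
  factor.\<close>

lemma summable_half_log_gaussian: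
  assumes a: "a > 0"
  shows "summable (\<lambda>k. exp (r * half_log k - a * (half_log k)\<^sup>2))"
proof (rule summable_comparison_test'[of "\<lambda>k. exp ((r + 4)\<^sup>2 / (4 * a)) * real (Suc k) powr (- 2)" 0])
  show "summable (\<lambda>k. exp ((r + 4)\<^sup>2 / (4 * a)) * real (Suc k) powr (- 2))"
    by (intro summable_mult summable_Suc_powr) simp
  fix k
  define L where "L = half_log k"
  have "0 \<le> ((r + 4) - 2 * a * L)\<^sup>2 / (4 * a)" using a by simp
  also have "\<dots> = (r + 4)\<^sup>2 / (4 * a) - (r + 4) * L + a * L\<^sup>2"
    using a by (simp add: power2_diff field_simps power2_eq_square)
  finally have "r * L - a * L\<^sup>2 \<le> (r + 4)\<^sup>2 / (4 * a) + - 4 * L" by (simp add: algebra_simps)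
  then have "exp (r * L - a * L\<^sup>2) \<le> exp ((r + 4)\<^sup>2 / (4 * a)) * exp (- 4 * L)" by (simp only: exp_add[symmetric] exp_le_cancel_iff)
  also have "exp (- 4 * L) = real (Suc k) powr (- 2)" by (simp add: L_def half_log_def powr_def)
  finally show "norm (exp (r * half_log k - a * (half_log k)\<^sup>2)) \<le> exp ((r + 4)\<^sup>2 / (4 * a)) * real (Suc k) powr (- 2)"
    by (simp add: L_def)
qed

text \<open>With \<open>n = k + 1\<close>, the summand is \<open>n powr (- 1 / 2 - w) * exp (- a / 4 * (ln n)\<^sup>2)\<close>: up to explicit
  nonvanishing factors, \<open>newman_H (- a)\<close> looks like translates of this Dirichlet series near the curve
  \<open>Im z = - (a / 2) * ln (Re z / (4 * pi))\<close>.\<close>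

definition dobner_series :: "real \<Rightarrow> complex \<Rightarrow> complex" where
  "dobner_series a w = (\<Sum>k. of_real (exp (- half_log k - a * (half_log k)\<^sup>2)) * exp (- 2 * of_real (half_log k) * w))"

lemma dobner_series_norm_term:
  fixes w :: complex
  shows "norm (of_real (exp (- half_log k - a * (half_log k)\<^sup>2)) * exp (- 2 * of_real (half_log k) * w))
    \<le> exp ((2 * norm w - 1) * half_log k - a * (half_log k)\<^sup>2)"
proof -
  have "norm (exp (- 2 * of_real (half_log k) * w)) \<le> exp (norm (- 2 * of_real (half_log k) * w))" by (rule norm_exp)
  also have "norm (- 2 * of_real (half_log k) * w) = 2 * half_log k * norm w" using half_log_nonneg[of k] by (simp add: norm_mult)
  finally have "norm (of_real (exp (- half_log k - a * (half_log k)\<^sup>2)) * exp (- 2 * of_real (half_log k) * w))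
      \<le> exp (- half_log k - a * (half_log k)\<^sup>2) * exp (2 * half_log k * norm w)"
    unfolding norm_mult norm_of_real abs_exp_cancel by (rule mult_left_mono) simp
  also have "\<dots> = exp ((2 * norm w - 1) * half_log k - a * (half_log k)\<^sup>2)"
    unfolding exp_add[symmetric] by (simp add: algebra_simps)
  finally show ?thesis .
qed

lemma dobner_series_summable:
  fixes w :: complex
  assumes "a > 0"
  shows "summable (\<lambda>k. norm (of_real (exp (- half_log k - a * (half_log k)\<^sup>2)) * exp (- 2 * of_real (half_log k) * w)))"
  by (rule summable_comparison_test'[OF summable_half_log_gaussian[OF assms, of "2 * norm w - 1"], of 0])
     (use dobner_series_norm_term[of _ a w] in simp)

lemma dobner_series_holomorphic:
  assumes a: "a > 0"
  shows "dobner_series a holomorphic_on A"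
proof -
  define g where "g = (\<lambda>k. of_real (exp (- half_log k - a * (half_log k)\<^sup>2)) :: complex)"
  define h where "h = (\<lambda>k. - 2 * half_log k)"
  have t: "g k * exp (w * of_real (h k)) = of_real (exp (- half_log k - a * (half_log k)\<^sup>2)) * exp (- 2 * of_real (half_log k) * w)" for k w
    by (simp add: g_def h_def mult_ac)
  have "(\<lambda>w. \<integral>k. g k * exp (w * of_real (h k)) \<partial>count_space UNIV) holomorphic_on A"
  proof (rule entire_exp_integral)
    fix r
    have "norm (g k) * exp (r * \<bar>h k\<bar>) = exp ((2 * r - 1) * half_log k - a * (half_log k)\<^sup>2)" for k
      using half_log_nonneg[of k] by (simp add: g_def h_def algebra_simps flip: exp_add)
    then show "integrable (count_space UNIV) (\<lambda>k. norm (g k) * exp (r * \<bar>h k\<bar>))"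
      using summable_half_log_gaussian[OF a, of "2 * r - 1"] by (simp add: integrable_count_space_nat_iff)
  qed simp_all
  moreover have "(\<integral>k. g k * exp (w * of_real (h k)) \<partial>count_space UNIV) = dobner_series a w" for w
    unfolding dobner_series_def t
    using dobner_series_summable[OF a, of w] by (intro integral_count_space_nat) (simp add: integrable_count_space_nat_iff)
  ultimately show ?thesis by simp
qed

text \<open>Half of the Gaussian weight pays for exp (2 |w| L) at the price exp (2 |w|^2 / a); the
  other half keeps the series convergent.\<close>

lemma dobner_series_growth:
  assumes a: "a > 0"
  obtains S where "S > 0" "\<And>w. norm (dobner_series a w) \<le> S * exp (2 / a * (norm w)\<^sup>2)"
proof -
  define S where "S = (\<Sum>k. exp (- 1 * half_log k - a / 2 * (half_log k)\<^sup>2))"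
  have sm: "summable (\<lambda>k. exp (- 1 * half_log k - a / 2 * (half_log k)\<^sup>2))"
    by (rule summable_half_log_gaussian) (use a in simp)
  have "S > 0" unfolding S_def by (rule suminf_pos[OF sm]) simp
  moreover have "norm (dobner_series a w) \<le> S * exp (2 / a * (norm w)\<^sup>2)" for w
  proof -
    have "norm (dobner_series a w) \<le> (\<Sum>k. norm (of_real (exp (- half_log k - a * (half_log k)\<^sup>2)) * exp (- 2 * of_real (half_log k) * w)))"
      unfolding dobner_series_def by (rule summable_norm[OF dobner_series_summable[OF a]])
    also have "\<dots> \<le> (\<Sum>k. exp (- 1 * half_log k - a / 2 * (half_log k)\<^sup>2) * exp (2 / a * (norm w)\<^sup>2))"
    proof (rule suminf_le)
      fix k
      define L where "L = half_log k"
      have "0 \<le> (a * L - 2 * norm w)\<^sup>2 / (2 * a)" using a by simp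
      also have "\<dots> = a / 2 * L\<^sup>2 - 2 * norm w * L + 2 / a * (norm w)\<^sup>2"
        using a by (simp add: power2_diff field_simps power2_eq_square)
      finally have "(2 * norm w - 1) * L - a * L\<^sup>2 \<le> (- 1 * L - a / 2 * L\<^sup>2) + 2 / a * (norm w)\<^sup>2" by (simp add: algebra_simps)
      then have "exp ((2 * norm w - 1) * L - a * L\<^sup>2) \<le> exp (- 1 * L - a / 2 * L\<^sup>2) * exp (2 / a * (norm w)\<^sup>2)"
        by (simp only: exp_add[symmetric] exp_le_cancel_iff)
      with dobner_series_norm_term[of k a w]
      show "norm (of_real (exp (- half_log k - a * (half_log k)\<^sup>2)) * exp (- 2 * of_real (half_log k) * w))
          \<le> exp (- 1 * half_log k - a / 2 * (half_log k)\<^sup>2) * exp (2 / a * (norm w)\<^sup>2)" unfolding L_def by linarith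
    qed (use sm dobner_series_summable[OF a] in \<open>auto intro: summable_mult2\<close>)
    also have "\<dots> = S * exp (2 / a * (norm w)\<^sup>2)" unfolding S_def by (rule suminf_mult2[OF sm, symmetric])
    finally show ?thesis .
  qed
  ultimately show thesis by (rule that)
qed

definition real_dobner_series :: "real \<Rightarrow> real \<Rightarrow> real" where
  "real_dobner_series a x = (\<Sum>k. exp (- half_log k - a * (half_log k)\<^sup>2) * exp (- 2 * half_log k * x))"

lemma dobner_series_real:
  assumes a: "a > 0"
  shows "dobner_series a (of_real x) = of_real (real_dobner_series a x)"
    and "x \<ge> 0 \<Longrightarrow> 1 \<le> real_dobner_series a x"
    and "x \<ge> 0 \<Longrightarrow> real_dobner_series a x \<le> real_dobner_series a 0"
    and "real_dobner_series a 1 < real_dobner_series a 0"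
proof -
  define f where "f = real_dobner_series a"
  have f_def: "f x = (\<Sum>k. exp (- half_log k - a * (half_log k)\<^sup>2) * exp (- 2 * half_log k * x))" for x
    by (simp only: f_def real_dobner_series_def)
  note f_eq = \<open>f = real_dobner_series a\<close>[symmetric]
  let ?t = "\<lambda>x k. exp (- half_log k - a * (half_log k)\<^sup>2) * exp (- 2 * half_log k * x)"
  have e: "of_real (exp (- half_log k - a * (half_log k)\<^sup>2)) * exp (- 2 * of_real (half_log k) * of_real x) = (of_real (?t x k) :: complex)" for k x
    by (simp add: exp_of_real[symmetric])
  have sm: "summable (?t x)" for x
  proof -
    have n: "norm (of_real (?t x k) :: complex) = ?t x k" for k
      by (subst norm_of_real, rule abs_of_nonneg) simp
    show ?thesis using dobner_series_summable[OF a, of "of_real x"] unfolding e n .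
  qed
  show "dobner_series a (of_real x) = of_real (real_dobner_series a x)"
    unfolding f_eq
    unfolding dobner_series_def e f_def by (rule suminf_of_real[OF sm, symmetric])
  \<comment> \<open>The term k = 0, that is n = 1, is exactly 1.\<close>
  show "1 \<le> real_dobner_series a x" if "x \<ge> 0"
    unfolding f_eq using sum_le_suminf[OF sm[of x], of "{0}"] unfolding f_def by (simp add: half_log_def)
  have le: "?t x k \<le> ?t 0 k" if "x \<ge> 0" for x k using that half_log_nonneg[of k] by simp
  show "real_dobner_series a x \<le> real_dobner_series a 0" if "x \<ge> 0" unfolding f_eq f_def by (rule suminf_le[OF le[OF that] sm sm])
  have "0 < (\<Sum>k. ?t 0 k - ?t 1 k)"
  \<comment> \<open>The term k = 0 does not depend on x; k = 1, that is n = 2, is the first that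
    decreases strictly.\<close>
  proof (rule suminf_pos2[where i = 1])
    show "summable (\<lambda>k. ?t 0 k - ?t 1 k)" by (intro summable_diff sm)
    show "0 < ?t 0 1 - ?t 1 1" by (simp add: half_log_def)
    show "0 \<le> ?t 0 k - ?t 1 k" for k using le[of 1 k] by simp
  qed
  moreover have "(\<Sum>k. ?t 0 k - ?t 1 k) = f 0 - f 1" unfolding f_def by (rule suminf_diff[OF sm sm, symmetric])
  ultimately show "real_dobner_series a 1 < real_dobner_series a 0" unfolding f_eq by simp
qed

lemma bounded_quadratic_constant:
  fixes A B C :: real
  assumes "\<And>x. x \<ge> 1 \<Longrightarrow> \<bar>A + B * x + C * x\<^sup>2\<bar> \<le> M"
  shows "B = 0" "C = 0"
proof -
  have 1: "((\<lambda>x. (A + B * x + C * x\<^sup>2) / x\<^sup>2) \<longlongrightarrow> 0) at_top"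
  proof (rule Lim_null_comparison[of _ "\<lambda>x. M / x\<^sup>2"])
    show "eventually (\<lambda>x. norm ((A + B * x + C * x\<^sup>2) / x\<^sup>2) \<le> M / x\<^sup>2) at_top"
      using eventually_ge_at_top[of 1] by eventually_elim (simp add: assms divide_right_mono)
  qed real_asymp
  have 2: "((\<lambda>x. (A + B * x + C * x\<^sup>2) / x\<^sup>2) \<longlongrightarrow> C) at_top" by real_asymp
  show C: "C = 0" by (rule tendsto_unique[OF trivial_limit_at_top_linorder 2 1])
  have 3: "((\<lambda>x. (A + B * x) / x) \<longlongrightarrow> 0) at_top"
  proof (rule Lim_null_comparison[of _ "\<lambda>x. M / x"])
    show "eventually (\<lambda>x. norm ((A + B * x) / x) \<le> M / x) at_top"
      using eventually_ge_at_top[of 1] by eventually_elim (use assms C in \<open>simp add: divide_right_mono\<close>)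
  qed real_asymp
  have 4: "((\<lambda>x. (A + B * x) / x) \<longlongrightarrow> B) at_top" by real_asymp
  show "B = 0" by (rule tendsto_unique[OF trivial_limit_at_top_linorder 4 3])
qed

text \<open>If F had no zero, then F = exp g with Re g = O(|z|^2), hence g = O(|z|^2) by
  \<open>borel_caratheodory\<close>, and g is a polynomial of degree at most 2. On the positive
  half-line ln F stays between 0 and ln (F 0), so the real quadratic Re g is constant there, against
  F 1 < F 0.\<close>

lemma dobner_series_zero:
  assumes a: "a > 0"
  obtains w where "dobner_series a w = 0"
proof (rule ccontr)
  assume "\<not> thesis"
  then have nz: "\<And>w. dobner_series a w \<noteq> 0" using that by blast
  let ?F = "dobner_series a"
  obtain g where g: "g holomorphic_on UNIV" "\<And>z. ?F z = exp (g z)"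
    using contractible_imp_holomorphic_log[OF dobner_series_holomorphic[OF a] contractible_UNIV] nz by (metis UNIV_I)
  obtain S where S: "S > 0" "\<And>w. norm (?F w) \<le> S * exp (2 / a * (norm w)\<^sup>2)"
    using dobner_series_growth[OF a] by blast
  define c where "c = \<bar>ln S\<bar> + \<bar>Re (g 0)\<bar> + 1"
  define K where "K = 2 / a"
  have K: "K > 0" using a by (simp add: K_def)
  have Reg: "Re (g z) \<le> ln S + K * (norm z)\<^sup>2" for z
  proof -
    have "exp (Re (g z)) \<le> exp (ln S + K * (norm z)\<^sup>2)"
      using S(2)[of z] S(1) by (simp add: g(2) exp_add K_def)
    then show ?thesis by simp
  qed
  \<comment> \<open>Applied on the disc of radius 2 |z|, of which z lies at half the radius; this
    turns K |w|^2 into 4 K |z|^2.\<close>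
  have bc: "norm (g z - g 0) \<le> 2 * (c + 4 * K * (norm z)\<^sup>2)" if z: "norm z \<ge> 1" for z
  proof (rule borel_caratheodory[of "\<lambda>w. g w - g 0" "2 * norm z"])
    show "(\<lambda>w. g w - g 0) holomorphic_on ball 0 (2 * norm z)"
      by (intro holomorphic_intros holomorphic_on_subset[OF g(1)]) auto
    have "c > 0" "4 * K * (norm z)\<^sup>2 \<ge> 0" using K by (simp_all add: c_def)
    then show "c + 4 * K * (norm z)\<^sup>2 > 0" by linarith
    fix w :: complex assume "w \<in> ball 0 (2 * norm z)"
    then have "(norm w)\<^sup>2 \<le> (2 * norm z)\<^sup>2" by (intro power_mono) auto
    then have "K * (norm w)\<^sup>2 \<le> 4 * K * (norm z)\<^sup>2" using mult_left_mono[of "(norm w)\<^sup>2" "(2 * norm z)\<^sup>2" K] K by (simp add: power_mult_distrib mult_ac)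
    then show "Re (g w - g 0) < c + 4 * K * (norm z)\<^sup>2" using Reg[of w] by (simp add: c_def)
  qed (use z in auto)
  have gb: "norm (g z) \<le> (norm (g 0) + 2 * c + 8 * K) * norm z ^ 2" if z: "1 \<le> norm z" for z
  proof -
    have "norm (g z) \<le> norm (g 0) + norm (g z - g 0)" by (metis norm_triangle_sub)
    also have "\<dots> \<le> norm (g 0) + 2 * (c + 4 * K * (norm z)\<^sup>2)" using bc[OF z] by simp
    also have "\<dots> \<le> (norm (g 0) + 2 * c) * norm z ^ 2 + 8 * K * norm z ^ 2"
    proof -
      have "1 \<le> norm z ^ 2" using z by simp
      moreover have "norm (g 0) + 2 * c \<ge> 0" by (auto simp: c_def)
      ultimately have "(norm (g 0) + 2 * c) * 1 \<le> (norm (g 0) + 2 * c) * norm z ^ 2" by (rule mult_left_mono)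
      then show ?thesis by simp
    qed
    finally show ?thesis by (simp add: algebra_simps)
  qed
  define q where "q = (\<lambda>k. Re ((deriv ^^ k) g 0 / fact k))"
  have gpoly: "Re (g (of_real x)) = q 0 + q 1 * x + q 2 * x\<^sup>2" for x
  proof -
    have "g (of_real x) = (\<Sum>k\<le>2. (deriv ^^ k) g 0 / fact k * of_real x ^ k)"
      by (rule Liouville_polynomial[OF g(1) gb])
    then have "Re (g (of_real x)) = (\<Sum>k\<le>2. Re ((deriv ^^ k) g 0 / fact k * of_real (x ^ k)))" by simp
    also have "\<dots> = (\<Sum>k\<le>2. q k * x ^ k)" 
    proof (rule sum.cong)
      have "Re (u * of_real t) = Re u * t" for u t by simp
      then show "Re ((deriv ^^ k) g 0 / fact k * of_real (x ^ k)) = q k * x ^ k" for k by (simp only: q_def)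
    qed simp
    finally show ?thesis by (simp add: numeral_2_eq_2)
  qed
  define f where "f = real_dobner_series a"
  note f = dobner_series_real[OF a, folded f_def]
  have lnf: "ln (f x) = q 0 + q 1 * x + q 2 * x\<^sup>2" if "x \<ge> 0" for x
  proof -
    have "norm (?F (of_real x)) = exp (q 0 + q 1 * x + q 2 * x\<^sup>2)" unfolding g(2) by (simp add: gpoly)
    then have "f x = exp (q 0 + q 1 * x + q 2 * x\<^sup>2)" using f(1)[of x] f(2)[OF that] by simp
    then show ?thesis by simp
  qed
  have "\<bar>q 0 + q 1 * x + q 2 * x\<^sup>2\<bar> \<le> ln (f 0)" if "x \<ge> 1" for x
  proof -
    have "1 \<le> f x" "f x \<le> f 0" using f(2)[of x] f(3)[of x] that by auto
    then have "0 \<le> ln (f x)" "ln (f x) \<le> ln (f 0)" by auto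
    then show ?thesis using lnf[of x] that by simp
  qed
  then have "q 1 = 0" "q 2 = 0" using bounded_quadratic_constant[of "q 0" "q 1" "q 2"] by blast+
  then have "ln (f 1) = ln (f 0)" using lnf[of 1] lnf[of 0] by simp
  then show False using f(2)[of 0] f(2)[of 1] f(4) by simp
qed

text \<open>A hypothesis of Hurwitz's theorem. Constancy near a zero would spread by analytic
  continuation to F = 0 everywhere, but F 0 >= 1. The variable enters as i z / 2 because a
  displacement z of the argument of \<open>newman_H\<close> reaches F in this form.\<close>

lemma dobner_series_nonconstant:
  assumes a: "a > 0" and w: "dobner_series a w = 0"
  shows "\<not> (\<lambda>z. dobner_series a (w + \<i> * z / 2)) constant_on ball 0 1"
proof
  define h where "h = (\<lambda>z. dobner_series a (w + \<i> * z / 2))"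
  assume "(\<lambda>z. dobner_series a (w + \<i> * z / 2)) constant_on ball 0 1"
  then obtain c where c: "\<And>z. z \<in> ball 0 1 \<Longrightarrow> h z = c" unfolding h_def constant_on_def by blast
  have "c = 0" using c[of 0] w by (simp add: h_def)
  have hol: "h holomorphic_on UNIV" unfolding h_def
    by (rule holomorphic_on_compose_gen[OF _ dobner_series_holomorphic[OF a, of UNIV], unfolded o_def, of "\<lambda>z. w + \<i> * z / 2"])
       (auto intro!: holomorphic_intros)
  have "h z = 0" for z
    by (rule analytic_continuation_open[of "ball 0 1" UNIV h "\<lambda>_. 0"])
       (use c hol \<open>c = 0\<close> in \<open>auto intro: connected_UNIV holomorphic_intros\<close>)
  \<comment> \<open>The point z is chosen as the solution of w + i z / 2 = 0.\<close>
  then have "dobner_series a (w + \<i> * (2 * (- \<i>) * (of_real 0 - w)) / 2) = 0" unfolding h_def by blast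
  then have "dobner_series a (of_real 0) = 0" by (simp add: algebra_simps)
  then show False using dobner_series_real(1,2)[OF a, of 0] by (simp del: of_real_0)
qed

text \<open>Dirichlet's simultaneous approximation for the first k + 1 frequencies. The multiplier q
  is only known to be a positive integer, so the numbers to be approximated are scaled by m
  beforehand; then T = q m is at least m and hence as large as desired.\<close>

lemma half_log_almost_periods:
  obtains T :: "nat \<Rightarrow> real" where "\<And>k. T k \<ge> M + real k"
    "\<And>n. (\<lambda>k. exp (- 2 * \<i> * of_real (half_log n) * of_real (T k))) \<longlonglongrightarrow> 1"
proof -
  have "\<exists>T. T \<ge> M + real k \<and> (\<forall>n\<le>k. norm (exp (- 2 * \<i> * of_real (half_log n) * of_real T) - 1) \<le> 2 * pi / real (Suc k))" for k
  proof -
    define m where "m = max 1 (M + real k)"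
    define \<theta> where "\<theta> = (\<lambda>n. m * half_log n / pi)"
    obtain q p where qp: "0 < q" "\<And>i. i < Suc k \<Longrightarrow> \<bar>of_int q * \<theta> i - of_int (p i)\<bar> < 1 / real (Suc k)"
      using Dirichlet_approx_simult[of "Suc k" "Suc k" \<theta>] by (metis zero_less_Suc)
    define T where "T = of_int q * m"
    have "1 * m \<le> of_int q * m" using qp(1) by (intro mult_right_mono) (auto simp: m_def)
    then have "T \<ge> M + real k" by (auto simp: T_def m_def)
    moreover have "norm (exp (- 2 * \<i> * of_real (half_log n) * of_real T) - 1) \<le> 2 * pi / real (Suc k)" if "n \<le> k" for n
    proof -
      define d where "d = - 2 * pi * (of_int q * \<theta> n - of_int (p n))"
      have "- 2 * half_log n * T = d - of_int (p n) * (2 * pi)" by (simp add: d_def \<theta>_def T_def field_simps)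
      then have "- 2 * \<i> * of_real (half_log n) * of_real T = \<i> * of_real d - 2 * of_int (p n) * of_real pi * \<i>"
        by (simp add: complex_eq_iff mult_ac)
      then have "exp (- 2 * \<i> * of_real (half_log n) * of_real T) = exp (\<i> * of_real d)"
        using exp_integer_2pi[of "of_int (p n)"] by (simp add: exp_diff)
      then have "norm (exp (- 2 * \<i> * of_real (half_log n) * of_real T) - 1) = 2 * \<bar>sin (d / 2)\<bar>"
        using dist_exp_i_1[of d] by simp
      also have "\<dots> \<le> \<bar>d\<bar>" using abs_sin_x_le_abs_x[of "d / 2"] by simp
      also have "\<dots> \<le> 2 * pi / real (Suc k)"
        using qp(2)[of n] that mult_left_mono[of "\<bar>of_int q * \<theta> n - of_int (p n)\<bar>" "1 / real (Suc k)" "2 * pi"]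
        by (simp add: d_def abs_mult del: of_nat_Suc)
      finally show ?thesis .
    qed
    ultimately show ?thesis by blast
  qed
  then obtain T where T: "\<And>k. T k \<ge> M + real k"
    "\<And>k n. n \<le> k \<Longrightarrow> norm (exp (- 2 * \<i> * of_real (half_log n) * of_real (T k)) - 1) \<le> 2 * pi / real (Suc k)" by metis
  have "(\<lambda>k. exp (- 2 * \<i> * of_real (half_log n) * of_real (T k))) \<longlonglongrightarrow> 1" for n
  proof -
    have "(\<lambda>k. exp (- 2 * \<i> * of_real (half_log n) * of_real (T k)) - 1) \<longlonglongrightarrow> 0"
    proof (rule Lim_null_comparison[of _ "\<lambda>k. 2 * pi / real (Suc k)"])
      show "eventually (\<lambda>k. norm (exp (- 2 * \<i> * of_real (half_log n) * of_real (T k)) - 1) \<le> 2 * pi / real (Suc k)) sequentially"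
        by (rule eventually_mono[OF eventually_ge_at_top[of n]]) (rule T(2))
      show "(\<lambda>k. 2 * pi / real (Suc k)) \<longlonglongrightarrow> 0" by real_asymp
    qed
    then show ?thesis by (simp add: LIM_zero_iff)
  qed
  with T(1) show thesis by (rule that)
qed

text \<open>Dominated convergence yields limits along sequences with moving arguments; compactness
  converts these into the uniform convergence that Hurwitz's theorem requires.\<close>

lemma uniform_limit_of_continuous_convergence:
  fixes G :: "nat \<Rightarrow> 'a::metric_space \<Rightarrow> 'b::metric_space"
  assumes K: "compact K" and g: "continuous_on K g"
    and conv: "\<And>\<kappa> \<zeta> \<zeta>'. filterlim \<kappa> sequentially sequentially \<Longrightarrow> (\<And>j. \<zeta> j \<in> K) \<Longrightarrow> \<zeta>' \<in> K \<Longrightarrow> \<zeta> \<longlonglongrightarrow> \<zeta>' \<Longrightarrow>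
       (\<lambda>j. G (\<kappa> j) (\<zeta> j)) \<longlonglongrightarrow> g \<zeta>'"
  shows "uniform_limit K G g sequentially"
proof (rule ccontr)
  assume "\<not> ?thesis"
  then obtain e where e: "e > 0" "\<not> (\<exists>N. \<forall>n\<ge>N. \<forall>x\<in>K. dist (G n x) (g x) < e)"
    unfolding uniform_limit_sequentially_iff by blast
  then have "\<forall>N. \<exists>n x. n \<ge> N \<and> x \<in> K \<and> \<not> dist (G n x) (g x) < e" by blast
  then obtain \<kappa> \<zeta> where bad: "\<And>N. \<kappa> N \<ge> N" "\<And>N. \<zeta> N \<in> K" "\<And>N. \<not> dist (G (\<kappa> N) (\<zeta> N)) (g (\<zeta> N)) < e" by metis
  obtain \<zeta>' r where r: "\<zeta>' \<in> K" "strict_mono r" "(\<zeta> \<circ> r) \<longlonglongrightarrow> \<zeta>'"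
    using K bad(2) unfolding compact_def by blast
  have "filterlim \<kappa> sequentially sequentially"
    unfolding filterlim_at_top by (meson bad(1) eventually_sequentiallyI order_trans)
  then have "filterlim (\<lambda>j. \<kappa> (r j)) sequentially sequentially"
    by (rule filterlim_compose[OF _ filterlim_subseq[OF r(2)]])
  then have "(\<lambda>j. G (\<kappa> (r j)) (\<zeta> (r j))) \<longlonglongrightarrow> g \<zeta>'"
    using conv[of "\<lambda>j. \<kappa> (r j)" "\<lambda>j. \<zeta> (r j)" \<zeta>'] bad(2) r by (simp add: o_def)
  moreover have "(\<lambda>j. g (\<zeta> (r j))) \<longlonglongrightarrow> g \<zeta>'"
    using continuous_on_tendsto_compose[OF g, of "\<lambda>j. \<zeta> (r j)" \<zeta>' sequentially] r bad(2) by (simp add: o_def)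
  ultimately have "(\<lambda>j. dist (G (\<kappa> (r j)) (\<zeta> (r j))) (g (\<zeta> (r j)))) \<longlonglongrightarrow> dist (g \<zeta>') (g \<zeta>')"
    by (rule tendsto_dist)
  then have "(\<lambda>j. dist (G (\<kappa> (r j)) (\<zeta> (r j))) (g (\<zeta> (r j)))) \<longlonglongrightarrow> 0" by simp
  then have "eventually (\<lambda>j. dist (G (\<kappa> (r j)) (\<zeta> (r j))) (g (\<zeta> (r j))) < e) sequentially"
    using e(1) by (rule order_tendstoD)
  then show False using bad(3) by (simp add: eventually_sequentially)
qed

section \<open>The saddle point integral\<close>

lemma integrable_exp_neg_abs:
  fixes \<kappa> :: real
  assumes k: "\<kappa> > 0"
  shows "integrable lborel (\<lambda>t::real. exp (- \<kappa> * \<bar>t\<bar>))"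
proof (rule Bochner_Integration.integrable_bound)
  have "integrable lborel (\<lambda>t::real. inverse (1 + t\<^sup>2))"
    using integrable_inverse_1_plus_square by (simp add: set_integrable_def)
  then show "integrable lborel (\<lambda>t::real. (1 + 2 / \<kappa>\<^sup>2) * inverse (1 + t\<^sup>2))" by (rule integrable_mult_right)
  have "exp (- \<kappa> * \<bar>t\<bar>) \<le> (1 + 2 / \<kappa>\<^sup>2) * inverse (1 + t\<^sup>2)" for t
  proof -
    have "1 + \<kappa> * \<bar>t\<bar> + (\<kappa> * \<bar>t\<bar>)\<^sup>2 / 2 \<le> exp (\<kappa> * \<bar>t\<bar>)" using k by (intro exp_lower_Taylor_quadratic) simp
    moreover have "\<kappa> * \<bar>t\<bar> \<ge> 0" using k by simp
    ultimately have e: "1 \<le> exp (\<kappa> * \<bar>t\<bar>)" "\<kappa>\<^sup>2 * t\<^sup>2 / 2 \<le> exp (\<kappa> * \<bar>t\<bar>)" by (simp_all add: power_mult_distrib)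
    from e(2) have "t\<^sup>2 \<le> 2 / \<kappa>\<^sup>2 * exp (\<kappa> * \<bar>t\<bar>)" using k by (simp add: field_simps)
    with e(1) have "1 + t\<^sup>2 \<le> (1 + 2 / \<kappa>\<^sup>2) * exp (\<kappa> * \<bar>t\<bar>)"
      unfolding distrib_right mult_1_left by linarith
    then have "(1 + t\<^sup>2) * exp (- \<kappa> * \<bar>t\<bar>) \<le> 1 + 2 / \<kappa>\<^sup>2" by (simp add: exp_minus field_simps)
    moreover have "1 + t\<^sup>2 > 0" by (simp add: add_pos_nonneg)
    ultimately show ?thesis by (simp add: field_simps)
  qed
  moreover have "(1 + 2 / \<kappa>\<^sup>2) * inverse (1 + t\<^sup>2) \<ge> 0" for t by simp
  ultimately show "AE t in lborel. norm (exp (- \<kappa> * \<bar>t\<bar>)) \<le> norm ((1 + 2 / \<kappa>\<^sup>2) * inverse (1 + t\<^sup>2))"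
    by (intro AE_I2) simp
qed simp

section \<open>The descent path through the saddle\<close>

lemma sin_ge_cubic:
  fixes y :: real
  assumes "y \<ge> 0"
  shows "y - y ^ 3 / 6 \<le> sin y"
proof -
  have "sin 0 - 0 + 0 ^ 3 / 6 \<le> sin y - y + y ^ 3 / 6"
  proof (rule DERIV_nonneg_imp_nondecreasing[OF assms])
    fix t :: real assume "0 \<le> t"
    have "((\<lambda>t. sin t - t + t ^ 3 / 6) has_real_derivative cos t - 1 + t\<^sup>2 / 2) (at t)"
      by (auto intro!: derivative_eq_intros)
    moreover have "cos t - 1 + t\<^sup>2 / 2 \<ge> 0"
    proof -
      have "(sin (t / 2))\<^sup>2 \<le> (t / 2)\<^sup>2" using abs_sin_x_le_abs_x[of "t / 2"] by (simp only: abs_le_square_iff)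
      moreover have "cos t = 1 - 2 * (sin (t / 2))\<^sup>2" using cos_double_sin[of "t / 2"] by simp
      ultimately show ?thesis by (simp add: power_divide)
    qed
    ultimately show "\<exists>d. ((\<lambda>t. sin t - t + t ^ 3 / 6) has_real_derivative d) (at t) \<and> 0 \<le> d" by blast
  qed
  then show ?thesis by simp
qed

text \<open>The path \<open>t - i eta t\<close> passes the saddle 0 of \<open>s - exp (4 s) / 4\<close> in the direction of
  steepest descent of \<open>exp (i x (s - exp (4 s) / 4))\<close>.\<close>

definition eta :: "real \<Rightarrow> real" where "eta t = t / sqrt (1 + 16 * t\<^sup>2)"
definition eta' :: "real \<Rightarrow> real" where "eta' t = 1 / sqrt (1 + 16 * t\<^sup>2) ^ 3"

lemma sqrt_eta_ge: "1 \<le> sqrt (1 + 16 * t\<^sup>2)" "4 * \<bar>t\<bar> \<le> sqrt (1 + 16 * t\<^sup>2)"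
  by (auto intro!: real_le_rsqrt simp: power_mult_distrib)

lemma sqrt_eta_sq: "sqrt (1 + 16 * t\<^sup>2) ^ 2 = 1 + 16 * t\<^sup>2"
  by (rule real_sqrt_pow2) simp

lemma eta_deriv: "(eta has_real_derivative eta' t) (at t)"
proof -
  define r where "r = sqrt (1 + 16 * t\<^sup>2)"
  have r: "r > 0" "r ^ 2 = 1 + 16 * t\<^sup>2" using sqrt_eta_ge(1)[of t] sqrt_eta_sq[of t] unfolding r_def by linarith+
  have pos: "1 + 16 * t\<^sup>2 > 0" using zero_le_power2[of t] by linarith
  have "(eta has_real_derivative (1 * r - t * ((32 * t) * (inverse r / 2))) / (r * r)) (at t)"
    unfolding eta_def[abs_def] r_def using pos
    by (auto intro!: derivative_eq_intros simp: power2_eq_square)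
  also have "(1 * r - t * ((32 * t) * (inverse r / 2))) / (r * r) = (r ^ 2 - 16 * t\<^sup>2) / r ^ 3"
    using r(1) by (simp add: field_simps power2_eq_square power3_eq_cube)
  also have "\<dots> = eta' t" unfolding r(2) by (simp add: eta'_def r_def)
  finally show ?thesis .
qed

lemma eta'_continuous: "continuous_on UNIV eta'"
proof -
  have "1 + 16 * t\<^sup>2 \<noteq> 0" for t :: real using add_pos_nonneg[of 1 "16 * t\<^sup>2"] by simp
  then show ?thesis unfolding eta'_def[abs_def] by (intro continuous_intros) auto
qed

lemma eta_continuous: "continuous_on A eta"
  using eta_deriv by (meson DERIV_continuous continuous_at_imp_continuous_on)

lemma eta'_bounds: "0 < eta' t" "eta' t \<le> 1"
  using sqrt_eta_ge(1)[of t] by (auto simp: eta'_def divide_le_eq_1 one_le_power add_pos_nonneg)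

text \<open>The shape of \<open>eta\<close> is chosen for these bounds together with slope 1 at 0:
  the path leaves the saddle in the direction 1 - i, and 4 |eta t| <= 1 keeps sin (4 eta t) of the
  same sign as t.\<close>

lemma eta_bounds: "\<bar>eta t\<bar> \<le> 1 / 4" "\<bar>eta t\<bar> \<le> \<bar>t\<bar>" "t \<ge> 0 \<Longrightarrow> eta t \<ge> 0" "t \<le> 0 \<Longrightarrow> eta t \<le> 0"
proof -
  have r: "sqrt (1 + 16 * t\<^sup>2) > 0" using sqrt_eta_ge(1)[of t] by linarith
  have ab: "\<bar>eta t\<bar> = \<bar>t\<bar> / sqrt (1 + 16 * t\<^sup>2)" using r by (simp add: eta_def abs_divide)
  show "\<bar>eta t\<bar> \<le> 1 / 4" unfolding ab using r sqrt_eta_ge(2)[of t] by (simp add: divide_le_eq)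
  show "\<bar>eta t\<bar> \<le> \<bar>t\<bar>" unfolding ab using r sqrt_eta_ge(1)[of t] by (simp add: divide_le_eq mult_le_cancel_left1)
  show "t \<ge> 0 \<Longrightarrow> eta t \<ge> 0" "t \<le> 0 \<Longrightarrow> eta t \<le> 0" using r by (auto simp: eta_def divide_nonpos_pos)
qed

lemma eta_minus: "eta (- t) = - eta t" by (simp add: eta_def)

text \<open>To the right of the saddle the descent must be fully quadratic, since it has to absorb
  the factor exp (2 a L t) of the n-th term. Taylor bounds for exp and sin reduce the claim to sqrt
  (1 + 16 t^2) <= 3 + 6 t.\<close>

lemma eta_descent_nonneg:
  assumes t: "t \<ge> 0"
  shows "t\<^sup>2 \<le> exp (4 * t) * sin (4 * eta t) / 4 - eta t"
proof -
  define e where "e = eta t"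
  define r where "r = sqrt (1 + 16 * t\<^sup>2)"
  have r: "r \<ge> 1" "r ^ 2 = 1 + 16 * t\<^sup>2" "r \<ge> 4 * t" using sqrt_eta_ge[of t] sqrt_eta_sq[of t] t by (auto simp: r_def)
  have er: "e = t / r" by (simp add: e_def eta_def r_def)
  have e: "0 \<le> e" "e \<le> 1/4" using eta_bounds[of t] t by (auto simp: e_def)
  have e2: "e\<^sup>2 \<le> t / 8" "e\<^sup>2 \<le> 1 / 16"
  proof -
    have "e\<^sup>2 = t\<^sup>2 / (1 + 16 * t\<^sup>2)" by (simp add: er power_divide r(2))
    moreover have pos: "1 + 16 * t\<^sup>2 > 0" by (simp add: add_pos_nonneg)
    moreover have "0 \<le> t * (1 - 4 * t)\<^sup>2" using t by simp
    then have "8 * t\<^sup>2 \<le> t * (1 + 16 * t\<^sup>2)" by (simp add: power2_eq_square algebra_simps)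
    ultimately show "e\<^sup>2 \<le> t / 8" by (simp add: divide_le_eq)
    have "e\<^sup>2 \<le> (1/4)\<^sup>2" using e by (intro power_mono) auto
    then show "e\<^sup>2 \<le> 1 / 16" by (simp add: power_divide)
  qed
  have "4 * e - (4 * e) ^ 3 / 6 \<le> sin (4 * e)" using e by (intro sin_ge_cubic) simp
  then have s: "e * (1 - 8 / 3 * e\<^sup>2) \<le> sin (4 * e) / 4" by (simp add: power3_eq_cube power2_eq_square algebra_simps)
  have ex: "1 + 4 * t + 8 * t\<^sup>2 \<le> exp (4 * t)"
    using exp_lower_Taylor_quadratic[of "4 * t"] t by (simp add: power_mult_distrib)
  have nn: "1 - 8 / 3 * e\<^sup>2 \<ge> 0" using e2 by simp
  have A: "1 + 3 * t + 6 * t\<^sup>2 \<le> (1 + 4 * t + 8 * t\<^sup>2) * (1 - 8 / 3 * e\<^sup>2)"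
  proof -
    have "e\<^sup>2 * t \<le> 1 / 16 * t" "e\<^sup>2 * t\<^sup>2 \<le> 1 / 16 * t\<^sup>2" using e2 t by (intro mult_right_mono; simp)+
    moreover have "t\<^sup>2 \<ge> 0" by simp
    moreover have "(1 + 4 * t + 8 * t\<^sup>2) * (1 - 8 / 3 * e\<^sup>2) = 1 + 4 * t + 8 * t\<^sup>2 - 8 / 3 * (e\<^sup>2) - 32 / 3 * (e\<^sup>2 * t) - 64 / 3 * (e\<^sup>2 * t\<^sup>2)"
      by (simp add: algebra_simps)
    ultimately show ?thesis using e2 t by linarith
  qed
  have "e * (1 + 3 * t + 6 * t\<^sup>2) \<le> e * ((1 + 4 * t + 8 * t\<^sup>2) * (1 - 8 / 3 * e\<^sup>2))" by (intro mult_left_mono A e)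
  also have "\<dots> = (1 + 4 * t + 8 * t\<^sup>2) * (e * (1 - 8 / 3 * e\<^sup>2))" by (simp add: algebra_simps)
  also have "\<dots> \<le> exp (4 * t) * (sin (4 * e) / 4)"
    using e nn by (intro mult_mono ex s mult_nonneg_nonneg) auto
  finally have 1: "e * (3 * t + 6 * t\<^sup>2) \<le> exp (4 * t) * sin (4 * e) / 4 - e" by (simp add: algebra_simps)
  have "r \<le> 3 + 6 * t"
  proof (rule power2_le_imp_le)
    show "r\<^sup>2 \<le> (3 + 6 * t)\<^sup>2" using t unfolding r(2) by (simp add: power2_eq_square algebra_simps)
  qed (use t in simp)
  then have "t\<^sup>2 * r \<le> t\<^sup>2 * (3 + 6 * t)" by (rule mult_left_mono) simp
  then have "t\<^sup>2 \<le> e * (3 * t + 6 * t\<^sup>2)" using r(1) by (simp add: er field_simps power2_eq_square)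
  with 1 show ?thesis by (simp add: e_def)
qed

text \<open>To the left exp (4 t) fades and the descent saturates, so the bound is quadratic near 0
  and only constant far out, where the Gaussian exp (- a s^2) takes over.\<close>

lemma eta_descent:
  shows "t\<^sup>2 / (8 * (1 + t\<^sup>2)) \<le> exp (4 * t) * sin (4 * eta t) / 4 - eta t"
proof (cases "t \<ge> 0")
  case True
  have "t\<^sup>2 / (8 * (1 + t\<^sup>2)) \<le> t\<^sup>2 / 1" by (intro divide_left_mono) (auto simp: add_pos_nonneg)
  then show ?thesis using eta_descent_nonneg[OF True] by simp
next
  case False
  define u where "u = - t"
  have u: "u > 0" "t = - u" using False by (auto simp: u_def)
  define r where "r = sqrt (1 + 16 * u\<^sup>2)"
  have r: "r \<ge> 1" "r ^ 2 = 1 + 16 * u\<^sup>2" using sqrt_eta_ge[of u] sqrt_eta_sq[of u] by (auto simp: r_def)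
  define m where "m = eta u"
  have m: "m \<ge> 0" "m = u / r" using eta_bounds(3)[of u] u by (auto simp: m_def eta_def r_def)
  have "sin (4 * m) / 4 \<le> m" using sin_x_le_x[of "4 * m"] m(1) by linarith
  then have "exp (- 4 * u) * (sin (4 * m) / 4) \<le> exp (- 4 * u) * m"
    by (rule mult_left_mono) simp
  moreover have "exp (- 4 * u) * (1 + 4 * u) \<le> 1"
    using exp_ge_add_one_self[of "4 * u"] by (simp add: exp_minus field_simps)
  then have "exp (- 4 * u) \<le> 1 / (1 + 4 * u)" using u by (simp add: field_simps)
  then have "exp (- 4 * u) * m \<le> 1 / (1 + 4 * u) * m" by (rule mult_right_mono) (rule m)
  ultimately have "m - 1 / (1 + 4 * u) * m \<le> m - exp (- 4 * u) * (sin (4 * m) / 4)" by linarith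
  moreover have "m - 1 / (1 + 4 * u) * m = 4 * u\<^sup>2 / ((1 + 4 * u) * r)"
  proof -
    define d where "d = 1 + 4 * u"
    have "d \<noteq> 0" "r \<noteq> 0" using u r(1) by (auto simp: d_def)
    then have "m - 1 / d * m = u * (d - 1) / (d * r)"
      by (simp add: m(2) field_simps)
    then show ?thesis by (simp add: d_def power2_eq_square mult_ac)
  qed
  moreover have "u\<^sup>2 / (8 * (1 + u\<^sup>2)) \<le> 4 * u\<^sup>2 / ((1 + 4 * u) * r)"
  proof -
    have "r \<le> 1 + 4 * u"
    proof (rule power2_le_imp_le)
      show "r\<^sup>2 \<le> (1 + 4 * u)\<^sup>2" using u unfolding r(2) by (simp add: power2_eq_square algebra_simps)
    qed (use u in simp)
    then have "(1 + 4 * u) * r \<le> (1 + 4 * u) * (1 + 4 * u)" using u by (intro mult_left_mono) auto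
    also have "\<dots> \<le> 32 * (1 + u\<^sup>2)"
    proof -
      have "0 \<le> (1 - 4 * u)\<^sup>2" by simp
      then show ?thesis by (simp add: power2_eq_square algebra_simps)
    qed
    finally have le: "(1 + 4 * u) * r \<le> 32 * (1 + u\<^sup>2)" .
    have "4 * u\<^sup>2 / (32 * (1 + u\<^sup>2)) \<le> 4 * u\<^sup>2 / ((1 + 4 * u) * r)"
      using u r(1) by (intro divide_left_mono[OF le]) (auto intro!: mult_pos_pos add_pos_nonneg)
    moreover have "4 * u\<^sup>2 / (32 * (1 + u\<^sup>2)) = u\<^sup>2 / (8 * (1 + u\<^sup>2))"
      using add_pos_nonneg[of 1 "u\<^sup>2"] by (simp add: field_simps)
    ultimately show ?thesis by simp
  qed
  ultimately show ?thesis using u(2) by (simp add: m_def eta_minus)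
qed

text \<open>What remains of exp (- a v^2 + i z v) phi(v) at v = v0 + s once the factors depending
  only on the saddle v0 are removed, where exp (4 v0) = i x / (4 pi). The two terms of phi then have
  the ratio 6 i / x, and the summand 1/4 makes the phase vanish at s = 0.\<close>

definition saddle_integrand :: "real \<Rightarrow> real \<Rightarrow> complex \<Rightarrow> complex \<Rightarrow> complex" where
  "saddle_integrand a x c s = exp (- of_real a * s\<^sup>2 + c * s) * (exp (9 * s) + 6 * \<i> / of_real x * exp (5 * s)) *
     exp (\<i> * of_real x * (s + 1 / 4 - exp (4 * s) / 4))"

definition saddle_integral :: "real \<Rightarrow> real \<Rightarrow> complex \<Rightarrow> complex" where
  "saddle_integral a x c = (\<integral>t. saddle_integrand a x c (Complex t (- eta t)) * Complex 1 (- eta' t) \<partial>lborel)"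

lemma saddle_osc_norm:
  "norm (exp (\<i> * of_real x * (Complex t y + 1 / 4 - exp (4 * Complex t y) / 4))) = exp (- x * (y - exp (4 * t) * sin (4 * y) / 4))"
proof -
  have "Im (Complex t y + 1 / 4 - exp (4 * Complex t y) / 4) = y - exp (4 * t) * sin (4 * y) / 4"
    by (simp add: Im_exp)
  then show ?thesis by (simp del: Im_divide_numeral)
qed

text \<open>The linear coefficient is split into a bounded part b and a real part l: for the n-th
  term l grows with n, and its contribution l t has to keep its sign.\<close>

lemma saddle_amp_norm_le:
  assumes a: "a > 0" and x: "x \<ge> 1" and y: "\<bar>y\<bar> \<le> 1" and b: "norm b \<le> B"
  shows "norm (exp (- of_real a * (Complex t y)\<^sup>2 + (b + of_real l) * Complex t y) *
      (exp (9 * Complex t y) + 6 * \<i> / of_real x * exp (5 * Complex t y)))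
    \<le> 7 * exp (- a * t\<^sup>2 + a + (B + 9) * \<bar>t\<bar> + B + l * t)"
proof -
  define s where "s = Complex t y"
  have B: "B \<ge> 0" using b norm_ge_zero[of b] by linarith
  have "y\<^sup>2 \<le> 1" using y by (simp add: abs_square_le_1)
  then have 1: "Re (- of_real a * s\<^sup>2) \<le> - a * t\<^sup>2 + a"
    using mult_left_mono[of "y\<^sup>2" 1 a] a by (simp add: s_def power2_eq_square algebra_simps)
  have "norm s \<le> \<bar>t\<bar> + 1" using cmod_le[of s] y by (simp add: s_def)
  then have "norm (b * s) \<le> B * (\<bar>t\<bar> + 1)" unfolding norm_mult using b B by (intro mult_mono) auto
  then have 2: "Re (b * s) \<le> B * (\<bar>t\<bar> + 1)" using complex_Re_le_cmod[of "b * s"] by linarith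
  have "norm (exp (- of_real a * s\<^sup>2 + (b + of_real l) * s)) = exp (Re (- of_real a * s\<^sup>2) + Re (b * s) + l * t)"
    by (simp add: s_def algebra_simps)
  also have "\<dots> \<le> exp (- a * t\<^sup>2 + a + B * (\<bar>t\<bar> + 1) + l * t)" using 1 2 by simp
  finally have e1: "norm (exp (- of_real a * s\<^sup>2 + (b + of_real l) * s)) \<le> exp (- a * t\<^sup>2 + a + B * (\<bar>t\<bar> + 1) + l * t)" .
  have "norm (exp (9 * s) + 6 * \<i> / of_real x * exp (5 * s)) \<le> norm (exp (9 * s)) + norm (6 * \<i> / of_real x * exp (5 * s))"
    by (rule norm_triangle_ineq)
  also have "\<dots> = exp (9 * t) + 6 / x * exp (5 * t)" using x by (simp add: norm_mult norm_divide s_def)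
  also have "\<dots> \<le> exp (9 * \<bar>t\<bar>) + 6 * exp (9 * \<bar>t\<bar>)"
    using x by (intro add_mono mult_mono) (auto simp: divide_le_eq)
  finally have e2: "norm (exp (9 * s) + 6 * \<i> / of_real x * exp (5 * s)) \<le> 7 * exp (9 * \<bar>t\<bar>)" by simp
  have "norm (exp (- of_real a * s\<^sup>2 + (b + of_real l) * s) * (exp (9 * s) + 6 * \<i> / of_real x * exp (5 * s)))
      \<le> exp (- a * t\<^sup>2 + a + B * (\<bar>t\<bar> + 1) + l * t) * (7 * exp (9 * \<bar>t\<bar>))"
    unfolding norm_mult by (intro mult_mono e1 e2) auto
  also have "\<dots> = 7 * exp (- a * t\<^sup>2 + a + (B + 9) * \<bar>t\<bar> + B + l * t)"
    by (simp add: algebra_simps flip: exp_add)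
  finally show ?thesis by (simp add: s_def)
qed

lemma gauss_linear_le:
  fixes a D t :: real
  assumes "a > 0" shows "- a * t\<^sup>2 + D * \<bar>t\<bar> \<le> D\<^sup>2 / (2 * a) - a / 2 * t\<^sup>2"
proof -
  have "0 \<le> (D - a * \<bar>t\<bar>)\<^sup>2 / (2 * a)" using assms by simp
  also have "\<dots> = D\<^sup>2 / (2 * a) - D * \<bar>t\<bar> + a / 2 * t\<^sup>2"
    using assms by (simp add: power2_diff power_mult_distrib field_simps power2_eq_square)
  finally show ?thesis by (simp add: algebra_simps)
qed

lemma saddle_integrand_holomorphic: "saddle_integrand a x c holomorphic_on A"
  unfolding saddle_integrand_def[abs_def] by (intro holomorphic_intros) auto

lemma saddle_path_continuous: "continuous_on UNIV (\<lambda>t. saddle_integrand a x c (Complex t (- eta t)) * Complex 1 (- eta' t))"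
  unfolding Complex_eq
  by (intro continuous_intros continuous_on_compose2[OF holomorphic_on_imp_continuous_on[OF saddle_integrand_holomorphic[of a x c UNIV]]]
      eta_continuous eta'_continuous) auto

text \<open>Seen from the saddle v0, the original real axis is the line Im s = - pi / 8. Between
  that line and the path the oscillating factor is at most exp (2 x): for t >= 0 because - pi / 8 <=
  y <= 0 makes sin (4 y) nonpositive, for t < 0 because exp (4 t) <= 1. The Gaussian then provides
  the decay for fixed x.\<close>

lemma saddle_contour:
  assumes a: "a > 0" and x: "x \<ge> 1"
  shows "(\<integral>t. saddle_integrand a x c (Complex t (- pi / 8)) \<partial>lborel) = saddle_integral a x c"
proof -
  define K where "K = 7 * exp (a + norm c + (norm c + 9)\<^sup>2 / (2 * a)) * exp (2 * x)"
  define Bd where "Bd = (\<lambda>t. K * exp (- (a / 2) * t\<^sup>2))"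
  have K: "K > 0" by (simp add: K_def)
  have seg: "closed_segment (- pi / 8) (- eta t) = {- pi / 8..- eta t}" for t
    using eta_bounds(1)[of t] pi_gt3 by (auto simp: closed_segment_eq_real_ivl abs_le_iff)
  have bound: "norm (saddle_integrand a x c (Complex t y)) \<le> Bd t" if y: "y \<in> {- pi / 8..- eta t}" for t y
  proof -
    have y1: "\<bar>y\<bar> \<le> 1" using y eta_bounds(1)[of t] pi_less_4 by (auto simp: abs_le_iff)
    have "- (y - exp (4 * t) * sin (4 * y) / 4) \<le> 2"
    proof (cases "t \<ge> 0")
      case True
      then have "y \<le> 0" using y eta_bounds(3)[of t] by auto
      then have "sin (4 * (- y)) \<ge> 0" using y by (intro sin_ge_zero) auto
      then have "exp (4 * t) * sin (4 * y) \<le> 0" by (simp add: mult_nonneg_nonpos)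
      then show ?thesis using y1 by simp
    next
      case False
      have "exp (4 * t) * sin (4 * y) \<le> 1 * 1" using False
        by (intro order_trans[OF mult_left_mono[OF sin_le_one]]) auto
      then show ?thesis using y1 by simp
    qed
    then have "x * - (y - exp (4 * t) * sin (4 * y) / 4) \<le> x * 2" using x by (intro mult_left_mono) auto
    then have "- x * (y - exp (4 * t) * sin (4 * y) / 4) \<le> 2 * x"
      by (simp only: mult_minus_right mult_minus_left mult.commute[of x 2])
    then have o: "norm (exp (\<i> * of_real x * (Complex t y + 1 / 4 - exp (4 * Complex t y) / 4))) \<le> exp (2 * x)"
      unfolding saddle_osc_norm by simp
    have "norm (exp (- of_real a * (Complex t y)\<^sup>2 + (c + of_real 0) * Complex t y) *
        (exp (9 * Complex t y) + 6 * \<i> / of_real x * exp (5 * Complex t y))) \<le> 7 * exp (- a * t\<^sup>2 + a + (norm c + 9) * \<bar>t\<bar> + norm c + 0 * t)"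
      by (rule saddle_amp_norm_le[OF a x y1]) simp
    also have "\<dots> \<le> 7 * exp (a + norm c + (norm c + 9)\<^sup>2 / (2 * a) + - (a / 2) * t\<^sup>2)"
      using gauss_linear_le[OF a, of t "norm c + 9"] by simp
    also have "\<dots> = 7 * exp (a + norm c + (norm c + 9)\<^sup>2 / (2 * a)) * exp (- (a / 2) * t\<^sup>2)" by (simp only: exp_add mult.assoc)
    finally have "norm (saddle_integrand a x c (Complex t y)) \<le> (7 * exp (a + norm c + (norm c + 9)\<^sup>2 / (2 * a)) * exp (- (a / 2) * t\<^sup>2)) * exp (2 * x)"
      unfolding saddle_integrand_def norm_mult[of _ "exp (\<i> * of_real x * _)"] using o by (intro mult_mono) auto
    then show ?thesis by (simp add: Bd_def K_def mult_ac)
  qed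
  have intB: "integrable lborel Bd" unfolding Bd_def using integrable_exp_neg_square[of "a / 2"] a by simp
  have contf: "continuous_on UNIV (saddle_integrand a x c)"
    by (rule holomorphic_on_imp_continuous_on[OF saddle_integrand_holomorphic])
  have "continuous_on UNIV (\<lambda>t. saddle_integrand a x c (Complex t (- pi / 8)))"
    unfolding Complex_eq by (intro continuous_on_compose2[OF contf] continuous_intros) auto
  then have m1: "(\<lambda>t. saddle_integrand a x c (Complex t (- pi / 8))) \<in> borel_measurable lborel"
    unfolding measurable_lborel1 measurable_lborel2 by (intro borel_measurable_continuous_onI)
  have m2: "(\<lambda>t. saddle_integrand a x c (Complex t (- eta t)) * Complex 1 (- eta' t)) \<in> borel_measurable lborel"
    unfolding measurable_lborel1 measurable_lborel2 by (intro borel_measurable_continuous_onI[OF saddle_path_continuous])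
  have "(\<integral>t. saddle_integrand a x c (Complex t (- pi / 8)) \<partial>lborel) =
      (\<integral>t. saddle_integrand a x c (Complex t (- eta t)) * Complex 1 (- eta' t) \<partial>lborel)"
  proof (rule contour_shift[where D = 1 and B = Bd])
    show "((\<lambda>t. - eta t) has_real_derivative - eta' t) (at t)" for t by (intro DERIV_minus eta_deriv)
    show "continuous_on UNIV (\<lambda>t. - eta' t)" by (intro continuous_on_minus eta'_continuous)
    show "\<bar>- eta t - - pi / 8\<bar> \<le> 1" for t using eta_bounds(1)[of t] pi_less_4 pi_gt3 by (auto simp: abs_le_iff)
    show "norm (saddle_integrand a x c (Complex t y)) \<le> Bd t" if "y \<in> closed_segment (- pi / 8) (- eta t)" for t y
      using that unfolding seg by (rule bound)
    show "(Bd \<longlongrightarrow> 0) at_top" "(Bd \<longlongrightarrow> 0) at_bot" unfolding Bd_def using a by real_asymp+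
    show "integrable lborel (\<lambda>t. saddle_integrand a x c (Complex t (- pi / 8)))"
    proof (rule Bochner_Integration.integrable_bound[OF intB])
      show "AE t in lborel. norm (saddle_integrand a x c (Complex t (- pi / 8))) \<le> norm (Bd t)"
        using bound[of "- pi / 8"] seg K by (intro AE_I2) (metis Bd_def abs_ge_self ends_in_segment(1) order_trans real_norm_def)
    qed (rule m1)
    show "integrable lborel (\<lambda>t. saddle_integrand a x c (Complex t (- eta t)) * Complex 1 (- eta' t))"
    proof (rule Bochner_Integration.integrable_bound[OF integrable_mult_right[OF intB, of 2]])
      have "norm (Complex 1 (- eta' t)) \<le> 2" for t using cmod_le[of "Complex 1 (- eta' t)"] eta'_bounds[of t] by simp
      moreover have "norm (saddle_integrand a x c (Complex t (- eta t))) \<le> Bd t" for t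
        using bound[of "- eta t" t] seg[of t] by (metis ends_in_segment(2))
      ultimately have "norm (saddle_integrand a x c (Complex t (- eta t)) * Complex 1 (- eta' t)) \<le> Bd t * 2" for t
        unfolding norm_mult by (intro mult_mono) (auto simp: Bd_def K less_imp_le)
      then show "AE t in lborel. norm (saddle_integrand a x c (Complex t (- eta t)) * Complex 1 (- eta' t)) \<le> norm (2 * Bd t)"
        using K by (intro AE_I2) (simp add: Bd_def abs_mult mult.commute)
    qed (rule m2)
  qed (rule saddle_integrand_holomorphic)
  then show ?thesis by (simp only: saddle_integral_def)
qed

text \<open>\<open>v0\<close> is the critical point of i x v - pi exp (4 v). It depends on x alone;
  the displacement w and the Gaussian enter through the linear coefficient i w - 2 a v0, so one path
  serves all n and all nearby arguments.\<close>

lemma phi_transform_saddle: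
  assumes a: "a > 0" and x: "x \<ge> 1"
  defines "v0 \<equiv> Complex (ln (x / (4 * pi)) / 4) (pi / 8)"
  shows "phi_transform a (of_real x + w) = exp (- of_real a * v0\<^sup>2 + (\<i> * of_real x + \<i> * w) * v0 + v0) *
    (- (of_real x)\<^sup>2 / 8) * exp (- \<i> * of_real x / 4) * saddle_integral a x (\<i> * w - 2 * of_real a * v0)"
proof -
  define r where "r = ln (x / (4 * pi)) / 4"
  define C where "C = exp (- of_real a * v0\<^sup>2 + (\<i> * of_real x + \<i> * w) * v0 + v0) * (- (of_real x)\<^sup>2 / 8) * exp (- \<i> * of_real x / 4)"
  define c where "c = \<i> * w - 2 * of_real a * v0"
  have e4: "exp (4 * v0) = \<i> * of_real x / (4 * of_real pi)"
  proof -
    have "4 * v0 = Complex (ln (x / (4 * pi))) (pi / 2)" by (simp add: v0_def complex_eq_iff)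
    then have "exp (4 * v0) = of_real (x / (4 * pi)) * cis (pi / 2)" using x by (simp add: exp_eq_polar)
    then show ?thesis by (simp add: cis_conv_exp complex_eq_iff Re_exp Im_exp)
  qed
  have pt: "of_real (exp (- a * (r + 1 * t)\<^sup>2) * newman_phi (r + 1 * t)) * exp (\<i> * (of_real x + w) * of_real (r + 1 * t))
      = C * saddle_integrand a x c (Complex t (- pi / 8))" for t
  proof -
    define s where "s = Complex t (- pi / 8)"
    define E where "E = exp (4 * v0)"
    have v: "of_real (r + 1 * t) = v0 + s" by (simp add: v0_def s_def r_def complex_eq_iff)
    have m: "of_real (exp (real m * (r + 1 * t))) = exp (of_nat m * (v0 + s))" for m
      unfolding v[symmetric] by (simp add: exp_of_real[symmetric])
    have ph: "of_real (newman_phi (r + 1 * t)) = (2 * of_real pi ^ 2 * exp (9 * (v0 + s)) - 3 * of_real pi * exp (5 * (v0 + s))) * exp (- of_real pi * exp (4 * (v0 + s)))"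
      using m[of 9] m[of 5] m[of 4] unfolding newman_phi_def by (simp add: exp_of_real[symmetric])
    have "9 * (v0 + s) = v0 + 4 * v0 + 4 * v0 + 9 * s" "5 * (v0 + s) = v0 + 4 * v0 + 5 * s" "4 * (v0 + s) = 4 * v0 + 4 * s"
      by (simp_all add: algebra_simps)
    then have ex: "exp (9 * (v0 + s)) = exp v0 * E * E * exp (9 * s)" "exp (5 * (v0 + s)) = exp v0 * E * exp (5 * s)" "exp (4 * (v0 + s)) = E * exp (4 * s)"
      by (simp_all only: exp_add E_def)
    have "2 * of_real pi ^ 2 * (exp v0 * E * E * exp (9 * s)) - 3 * of_real pi * (exp v0 * E * exp (5 * s))
        = exp v0 * (- (of_real x)\<^sup>2 / 8) * (exp (9 * s) + 6 * \<i> / of_real x * exp (5 * s))"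
      unfolding E_def e4 using x by (simp add: field_simps power2_eq_square)
    then have ph': "of_real (newman_phi (r + 1 * t)) = exp v0 * (- (of_real x)\<^sup>2 / 8) * (exp (9 * s) + 6 * \<i> / of_real x * exp (5 * s)) * exp (- (\<i> * of_real x / 4) * exp (4 * s))"
      unfolding ph ex by (simp add: E_def e4)
    have g: "of_real (exp (- a * (r + 1 * t)\<^sup>2)) = exp (- of_real a * (v0 + s)\<^sup>2)"
      unfolding v[symmetric] by (simp add: exp_of_real[symmetric])
    have "of_real (exp (- a * (r + 1 * t)\<^sup>2) * newman_phi (r + 1 * t)) * exp (\<i> * (of_real x + w) * of_real (r + 1 * t))
      = (- (of_real x)\<^sup>2 / 8) * (exp (9 * s) + 6 * \<i> / of_real x * exp (5 * s)) *
        (exp (- of_real a * (v0 + s)\<^sup>2) * exp v0 * exp (- (\<i> * of_real x / 4) * exp (4 * s)) * exp (\<i> * (of_real x + w) * (v0 + s)))"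
      unfolding of_real_mult g ph' v by (simp only: mult_ac)
    also have "exp (- of_real a * (v0 + s)\<^sup>2) * exp v0 * exp (- (\<i> * of_real x / 4) * exp (4 * s)) * exp (\<i> * (of_real x + w) * (v0 + s))
      = exp (- of_real a * v0\<^sup>2 + (\<i> * of_real x + \<i> * w) * v0 + v0) * exp (- \<i> * of_real x / 4) *
        exp (- of_real a * s\<^sup>2 + c * s) * exp (\<i> * of_real x * (s + 1 / 4 - exp (4 * s) / 4))"
      unfolding exp_add[symmetric] c_def by (rule arg_cong[of _ _ exp]) (simp add: field_simps power2_eq_square)
    finally show ?thesis unfolding C_def saddle_integrand_def s_def[symmetric] by (simp only: mult_ac)
  qed
  have "phi_transform a (of_real x + w) = (\<integral>t. C * saddle_integrand a x c (Complex t (- pi / 8)) \<partial>lborel)"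
    unfolding phi_transform_def using lborel_integral_real_affine[of 1 "\<lambda>v. of_real (exp (- a * v\<^sup>2) * newman_phi v) * exp (\<i> * (of_real x + w) * of_real v)" r]
    unfolding pt by simp
  also have "\<dots> = C * saddle_integral a x c" by (simp only: integral_mult_right_zero saddle_contour[OF a x])
  finally show ?thesis by (simp only: C_def c_def)
qed

section \<open>Rescaling, majorant and limit of the saddle integral\<close>

definition scaled_saddle :: "real \<Rightarrow> real \<Rightarrow> complex \<Rightarrow> real \<Rightarrow> complex" where
  "scaled_saddle a x c \<tau> = saddle_integrand a x c (Complex (\<tau> / sqrt x) (- eta (\<tau> / sqrt x))) * Complex 1 (- eta' (\<tau> / sqrt x))"

lemma saddle_integral_scaled:
  assumes "x > 0"
  shows "of_real (sqrt x) * saddle_integral a x c = (\<integral>\<tau>. scaled_saddle a x c \<tau> \<partial>lborel)"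
proof -
  have "saddle_integral a x c = \<bar>1 / sqrt x\<bar> *\<^sub>R (\<integral>\<tau>. saddle_integrand a x c (Complex (0 + 1 / sqrt x * \<tau>) (- eta (0 + 1 / sqrt x * \<tau>))) * Complex 1 (- eta' (0 + 1 / sqrt x * \<tau>)) \<partial>lborel)"
    unfolding saddle_integral_def using assms by (intro lborel_integral_real_affine) simp
  also have "\<dots> = (1 / sqrt x) *\<^sub>R (\<integral>\<tau>. scaled_saddle a x c \<tau> \<partial>lborel)"
    using assms by (simp add: scaled_saddle_def)
  finally show ?thesis using assms by (simp add: scaleR_conv_of_real)
qed

lemma scaled_saddle_measurable [measurable]: "scaled_saddle a x c \<in> borel_measurable borel"
proof (rule borel_measurable_continuous_onI)
  have "continuous_on UNIV (\<lambda>\<tau>::real. \<tau> / sqrt x)" by (cases "sqrt x = 0") (auto intro!: continuous_intros)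
  from continuous_on_compose2[OF saddle_path_continuous this, of a x c]
  show "continuous_on UNIV (scaled_saddle a x c)" unfolding scaled_saddle_def[abs_def] by simp
qed

text \<open>The three exponentials belong, in this order, to the right of the saddle, its left
  neighbourhood and the far left. The 14 is 7 from the amplitude times 2 for the derivative of the
  path.\<close>

definition saddle_majorant :: "real \<Rightarrow> real \<Rightarrow> real \<Rightarrow> real" where
  "saddle_majorant a B \<tau> = 14 * exp (a + B + (B + 9)\<^sup>2 + (B + 9)\<^sup>2 / (2 * a)) *
     (exp (- (1 / 4) * \<tau>\<^sup>2) + exp (- (1 / 16) * \<tau>\<^sup>2) + exp (- (sqrt (a / 2) / 2) * \<bar>\<tau>\<bar>))"

lemma saddle_majorant_integrable:
  assumes "a > 0" shows "integrable lborel (saddle_majorant a B)"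
  unfolding saddle_majorant_def[abs_def]
  using integrable_exp_neg_square[of "1 / 4"] integrable_exp_neg_square[of "1 / 16"] integrable_exp_neg_abs[of "sqrt (a / 2) / 2"] assms
  by (intro integrable_mult_right Bochner_Integration.integrable_add) auto

text \<open>All dependence on L is in exp (a L^2 / 2). For \<sigma> >= 0 one has 2 a L \<sigma> <= a
  L^2 / 2 + 2 a \<sigma>^2, and x >= 2 a lets the descent x \<sigma>^2 absorb the second part; for
  \<sigma> < 0 the term is nonpositive. The coefficient exp (- a L^2) of the Dirichlet series can
  afford this loss.\<close>

lemma saddle_exponent_bound:
  fixes a x B L \<sigma> g :: real
  assumes a: "a > 0" and x: "x \<ge> 1" "x \<ge> 2 * a" and B: "B \<ge> 0" and L: "L \<ge> 0"
    and g1: "\<sigma>\<^sup>2 / (8 * (1 + \<sigma>\<^sup>2)) \<le> g" and g2: "\<sigma> \<ge> 0 \<Longrightarrow> \<sigma>\<^sup>2 \<le> g"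
  defines "\<tau> \<equiv> sqrt x * \<sigma>"
  shows "exp (- a * \<sigma>\<^sup>2 + (B + 9) * \<bar>\<sigma>\<bar> + 2 * a * L * \<sigma> - x * g) \<le> exp (a * L\<^sup>2 / 2 + (B + 9)\<^sup>2 + (B + 9)\<^sup>2 / (2 * a)) *
     (exp (- (1 / 4) * \<tau>\<^sup>2) + exp (- (1 / 16) * \<tau>\<^sup>2) + exp (- (sqrt (a / 2) / 2) * \<bar>\<tau>\<bar>))"
    (is "exp ?E \<le> exp ?P * (exp ?A1 + exp ?A2 + exp ?A3)")
proof -
  have "?E \<le> ?P + ?A1 \<or> ?E \<le> ?P + ?A2 \<or> ?E \<le> ?P + ?A3"
  proof (cases "\<sigma> \<ge> 0")
    case True
    have "0 \<le> a / 2 * (L - 2 * \<sigma>)\<^sup>2" using a by simp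
    then have "2 * a * L * \<sigma> \<le> a * L\<^sup>2 / 2 + 2 * (a * \<sigma>\<^sup>2)" by (simp add: power2_eq_square algebra_simps)
    moreover have "x * \<sigma>\<^sup>2 \<le> x * g" using x g2[OF True] by (intro mult_left_mono) auto
    moreover have "2 * a * \<sigma>\<^sup>2 \<le> x * \<sigma>\<^sup>2" using x by (intro mult_right_mono) auto
    moreover have t2: "\<tau>\<^sup>2 = x * \<sigma>\<^sup>2" using x by (simp add: \<tau>_def power_mult_distrib)
    moreover have "(B + 9) * \<bar>\<sigma>\<bar> \<le> (B + 9)\<^sup>2 + \<tau>\<^sup>2 / 4"
    proof -
      have "\<sigma>\<^sup>2 \<le> \<tau>\<^sup>2" unfolding t2 using mult_right_mono[of 1 x "\<sigma>\<^sup>2"] x by simp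
      moreover have "0 \<le> (B + 9 - \<bar>\<sigma>\<bar> / 2)\<^sup>2" by simp
      ultimately show ?thesis by (simp add: power2_eq_square algebra_simps)
    qed
    moreover have "(B + 9)\<^sup>2 / (2 * a) \<ge> 0" using a by simp
    ultimately have "?E \<le> ?P + ?A1" by linarith
    then show ?thesis by simp
  next
    case False
    have "2 * a * L * \<sigma> \<le> 0" using False a L by (intro mult_nonneg_nonpos) auto
    moreover have "- a * \<sigma>\<^sup>2 + (B + 9) * \<bar>\<sigma>\<bar> \<le> (B + 9)\<^sup>2 / (2 * a) - a / 2 * \<sigma>\<^sup>2" by (rule gauss_linear_le[OF a])
    moreover have "a * L\<^sup>2 / 2 \<ge> 0" "(B + 9)\<^sup>2 \<ge> 0" "a / 2 * \<sigma>\<^sup>2 \<ge> 0" using a by auto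
    ultimately have E: "?E \<le> ?P - a / 2 * \<sigma>\<^sup>2 - x * g" by linarith
    show ?thesis
    proof (cases "\<sigma>\<^sup>2 \<le> 1")
      case True
      have "\<sigma>\<^sup>2 / 16 \<le> \<sigma>\<^sup>2 / (8 * (1 + \<sigma>\<^sup>2))" using True by (intro divide_left_mono) (auto intro!: mult_pos_pos add_pos_nonneg)
      then have "x * (\<sigma>\<^sup>2 / 16) \<le> x * g" using x by (intro mult_left_mono order_trans[OF _ g1]) auto
      moreover have "\<tau>\<^sup>2 = x * \<sigma>\<^sup>2" using x by (simp add: \<tau>_def power_mult_distrib)
      ultimately have "?E \<le> ?P + ?A2" using E \<open>a / 2 * \<sigma>\<^sup>2 \<ge> 0\<close> by linarith
      then show ?thesis by simp
    next
      case False
      have "1 / 16 \<le> \<sigma>\<^sup>2 / (8 * (1 + \<sigma>\<^sup>2))" using False add_pos_nonneg[of 1 "\<sigma>\<^sup>2"] by (simp add: field_simps)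
      then have "x * (1 / 16) \<le> x * g" using x by (intro mult_left_mono order_trans[OF _ g1]) auto
      \<comment> \<open>On the far left the descent gives only the constant x / 16; combined with
        the Gaussian by the arithmetic-geometric mean inequality it still decays exponentially in
        \<tau>.\<close>
      moreover have "a / 2 * \<sigma>\<^sup>2 + x / 16 \<ge> sqrt (a / 2) / 2 * \<bar>\<tau>\<bar>"
      proof -
        have "0 \<le> (sqrt (a / 2) * \<bar>\<sigma>\<bar> - sqrt x / 4)\<^sup>2" by simp
        also have "\<dots> = (sqrt (a / 2))\<^sup>2 * \<sigma>\<^sup>2 + (sqrt x)\<^sup>2 / 16 - sqrt (a / 2) / 2 * (sqrt x * \<bar>\<sigma>\<bar>)"
          unfolding power2_diff by (simp add: power_mult_distrib power_divide)
        also have "\<dots> = a / 2 * \<sigma>\<^sup>2 + x / 16 - sqrt (a / 2) / 2 * \<bar>\<tau>\<bar>" using a x by (simp add: \<tau>_def abs_mult)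
        finally show ?thesis by linarith
      qed
      ultimately have "?E \<le> ?P + ?A3" using E by linarith
      then show ?thesis by simp
    qed
  qed
  then have "exp ?E \<le> exp ?P * exp ?A1 \<or> exp ?E \<le> exp ?P * exp ?A2 \<or> exp ?E \<le> exp ?P * exp ?A3"
    by (simp only: exp_add[symmetric] exp_le_cancel_iff)
  moreover have "exp ?P * exp ?A1 > 0" "exp ?P * exp ?A2 > 0" "exp ?P * exp ?A3 > 0" by simp_all
  ultimately show ?thesis unfolding distrib_left by linarith
qed

lemma scaled_saddle_bound:
  assumes a: "a > 0" and x: "x \<ge> 1" "x \<ge> 2 * a" and b: "norm b \<le> B" and L: "L \<ge> 0"
  shows "norm (scaled_saddle a x (b + of_real (2 * a * L)) \<tau>) \<le> exp (a * L\<^sup>2 / 2) * saddle_majorant a B \<tau>"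
proof -
  define \<sigma> where "\<sigma> = \<tau> / sqrt x"
  define g where "g = exp (4 * \<sigma>) * sin (4 * eta \<sigma>) / 4 - eta \<sigma>"
  have \<tau>: "\<tau> = sqrt x * \<sigma>" using x by (simp add: \<sigma>_def)
  have B: "B \<ge> 0" using b norm_ge_zero[of b] by linarith
  have y: "\<bar>- eta \<sigma>\<bar> \<le> 1" using eta_bounds(1)[of \<sigma>] by simp
  have o: "norm (exp (\<i> * of_real x * (Complex \<sigma> (- eta \<sigma>) + 1 / 4 - exp (4 * Complex \<sigma> (- eta \<sigma>)) / 4))) = exp (- (x * g))"
    unfolding saddle_osc_norm by (simp add: g_def algebra_simps)
  have j: "norm (Complex 1 (- eta' \<sigma>)) \<le> 2" using cmod_le[of "Complex 1 (- eta' \<sigma>)"] eta'_bounds[of \<sigma>] by simp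
  have "norm (scaled_saddle a x (b + of_real (2 * a * L)) \<tau>) \<le>
      (7 * exp (- a * \<sigma>\<^sup>2 + a + (B + 9) * \<bar>\<sigma>\<bar> + B + 2 * a * L * \<sigma>)) * exp (- (x * g)) * 2"
    unfolding scaled_saddle_def saddle_integrand_def norm_mult[of _ "Complex _ _"] norm_mult[of _ "exp (\<i> * of_real x * _)"] \<sigma>_def[symmetric] o
    by (intro mult_mono saddle_amp_norm_le a x(1) y b j order_refl) auto
  also have "\<dots> = 14 * exp (a + B) * exp (- a * \<sigma>\<^sup>2 + (B + 9) * \<bar>\<sigma>\<bar> + 2 * a * L * \<sigma> - x * g)"
    by (simp add: algebra_simps flip: exp_add)
  also have "\<dots> \<le> 14 * exp (a + B) * (exp (a * L\<^sup>2 / 2 + (B + 9)\<^sup>2 + (B + 9)\<^sup>2 / (2 * a)) *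
     (exp (- (1 / 4) * \<tau>\<^sup>2) + exp (- (1 / 16) * \<tau>\<^sup>2) + exp (- (sqrt (a / 2) / 2) * \<bar>\<tau>\<bar>)))"
    unfolding \<tau> using eta_descent[of \<sigma>] eta_descent_nonneg[of \<sigma>]
    by (intro mult_left_mono saddle_exponent_bound a x B L) (auto simp: g_def)
  also have "\<dots> = exp (a * L\<^sup>2 / 2) * saddle_majorant a B \<tau>"
    by (simp add: saddle_majorant_def exp_add mult_ac)
  finally show ?thesis .
qed

lemma scaled_saddle_integrable:
  assumes a: "a > 0" and x: "x \<ge> 1" "x \<ge> 2 * a"
  shows "integrable lborel (scaled_saddle a x c)"
proof (rule Bochner_Integration.integrable_bound[OF saddle_majorant_integrable[OF a, of "norm c"]])
  show "AE \<tau> in lborel. norm (scaled_saddle a x c \<tau>) \<le> norm (saddle_majorant a (norm c) \<tau>)"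
    using scaled_saddle_bound[OF a x order_refl, of 0 c] by (intro AE_I2) (simp add: order_trans[OF _ abs_ge_self])
qed simp

lemma saddle_integral_bound:
  assumes a: "a > 0" and x: "x \<ge> 1" "x \<ge> 2 * a" and b: "norm b \<le> B" and L: "L \<ge> 0"
  shows "norm (of_real (sqrt x) * saddle_integral a x (b + of_real (2 * a * L))) \<le> exp (a * L\<^sup>2 / 2) * (\<integral>\<tau>. saddle_majorant a B \<tau> \<partial>lborel)"
proof -
  have x0: "x > 0" using x by linarith
  have "norm (\<integral>\<tau>. scaled_saddle a x (b + of_real (2 * a * L)) \<tau> \<partial>lborel) \<le> (\<integral>\<tau>. norm (scaled_saddle a x (b + of_real (2 * a * L)) \<tau>) \<partial>lborel)"
    by (rule integral_norm_bound)
  also have "\<dots> \<le> (\<integral>\<tau>. exp (a * L\<^sup>2 / 2) * saddle_majorant a B \<tau> \<partial>lborel)"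
    by (rule Bochner_Integration.integral_mono)
       (use scaled_saddle_integrable[OF a x] saddle_majorant_integrable[OF a, of B] scaled_saddle_bound[OF a x b L] in auto)
  finally show ?thesis unfolding saddle_integral_scaled[OF x0] by simp
qed

text \<open>With s = \<sigma> (1 - i \<rho>) and \<rho> tending to 1, the quadratic Taylor term - 2
  i x s^2 tends to - 4 \<tau>^2, while the remainder x O(|\<sigma>|^3) = O(\<tau>^2 |\<sigma>|)
  vanishes.\<close>

lemma saddle_phase_limit:
  assumes X: "filterlim X at_top sequentially" and X1: "\<And>j. X j \<ge> 1"
  shows "(\<lambda>j. \<i> * of_real (X j) * (Complex (\<tau> / sqrt (X j)) (- eta (\<tau> / sqrt (X j))) + 1 / 4
      - exp (4 * Complex (\<tau> / sqrt (X j)) (- eta (\<tau> / sqrt (X j)))) / 4)) \<longlonglongrightarrow> of_real (- 4 * \<tau>\<^sup>2)"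
proof -
  define \<sigma> where "\<sigma> = (\<lambda>j. \<tau> / sqrt (X j))"
  define s where "s = (\<lambda>j. Complex (\<sigma> j) (- eta (\<sigma> j)))"
  have sqX: "filterlim (\<lambda>j. sqrt (X j)) at_top sequentially" by (rule filterlim_compose[OF sqrt_at_top X])
  have inf: "filterlim (\<lambda>j. sqrt (X j)) at_infinity sequentially" by (rule filterlim_at_top_imp_at_infinity[OF sqX])
  have \<sigma>0: "\<sigma> \<longlonglongrightarrow> 0" unfolding \<sigma>_def by (rule tendsto_divide_0[OF tendsto_const inf])
  define \<rho> where "\<rho> = (\<lambda>j. 1 / sqrt (1 + 16 * (\<sigma> j)\<^sup>2))"
  have \<rho>: "\<rho> \<longlonglongrightarrow> 1 / sqrt (1 + 16 * 0\<^sup>2)" unfolding \<rho>_def by (intro tendsto_intros \<sigma>0) simp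
  have s_eq: "s j = of_real (\<tau> / sqrt (X j)) * (1 - \<i> * of_real (\<rho> j))" for j
    by (simp add: s_def eta_def \<rho>_def complex_eq_iff \<sigma>_def)
  have Xs2: "of_real (X j) * (s j)\<^sup>2 = of_real (\<tau>\<^sup>2) * (1 - \<i> * of_real (\<rho> j))\<^sup>2" for j
  proof -
    have "X j * (\<tau> / sqrt (X j))\<^sup>2 = \<tau>\<^sup>2" using X1[of j] by (simp add: power_divide)
    then have "complex_of_real (X j) * (of_real (\<tau> / sqrt (X j)))\<^sup>2 = of_real (\<tau>\<^sup>2)"
      by (simp only: of_real_mult[symmetric] of_real_power[symmetric])
    then show ?thesis by (simp only: s_eq power_mult_distrib mult.assoc[symmetric])
  qed
  define R where "R = (\<lambda>j. exp (4 * s j) - (1 + 4 * s j + 8 * (s j)\<^sup>2))"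
  have ns: "norm (s j) \<le> 2 * \<bar>\<sigma> j\<bar>" for j
    using cmod_le[of "s j"] eta_bounds(2)[of "\<sigma> j"] by (simp add: s_def)
  have nR: "norm (R j) \<le> exp (8 * \<bar>\<sigma> j\<bar>) * (8 * \<bar>\<sigma> j\<bar>) ^ 3 / 2" for j
  proof -
    have "norm (exp (4 * s j) - (\<Sum>i\<le>2. (4 * s j) ^ i / fact i)) \<le> exp (norm (4 * s j)) * norm (4 * s j) ^ Suc 2 / fact 2"
      by (rule Taylor_exp_field)
    moreover have "(\<Sum>i\<le>2. (4 * s j) ^ i / fact i) = 1 + 4 * s j + 8 * (s j)\<^sup>2"
      by (simp add: numeral_2_eq_2 power2_eq_square)
    ultimately have "norm (R j) \<le> exp (norm (4 * s j)) * norm (4 * s j) ^ 3 / 2" by (simp add: R_def numeral_3_eq_3)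
    also have "\<dots> \<le> exp (8 * \<bar>\<sigma> j\<bar>) * (8 * \<bar>\<sigma> j\<bar>) ^ 3 / 2"
      using ns[of j] by (intro divide_right_mono mult_mono power_mono) (auto simp: norm_mult)
    finally show ?thesis .
  qed
  have XR: "(\<lambda>j. of_real (X j) * R j) \<longlonglongrightarrow> 0"
  proof (rule Lim_null_comparison)
    show "eventually (\<lambda>j. norm (of_real (X j) * R j) \<le> exp (8 * \<bar>\<sigma> j\<bar>) * (256 * \<tau>\<^sup>2 * \<bar>\<sigma> j\<bar>)) sequentially"
    proof (rule always_eventually, rule allI)
      fix j
      have "norm (of_real (X j) * R j) \<le> X j * (exp (8 * \<bar>\<sigma> j\<bar>) * (8 * \<bar>\<sigma> j\<bar>) ^ 3 / 2)"
        using X1[of j] nR[of j] by (simp add: norm_mult mult_left_mono)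
      also have "\<dots> = exp (8 * \<bar>\<sigma> j\<bar>) * (256 * (X j * (\<sigma> j)\<^sup>2) * \<bar>\<sigma> j\<bar>)"
        by (simp add: power3_eq_cube power2_eq_square)
      also have "X j * (\<sigma> j)\<^sup>2 = \<tau>\<^sup>2" using X1[of j] by (simp add: \<sigma>_def power_divide)
      finally show "norm (of_real (X j) * R j) \<le> exp (8 * \<bar>\<sigma> j\<bar>) * (256 * \<tau>\<^sup>2 * \<bar>\<sigma> j\<bar>)" .
    qed
    have "(\<lambda>j. exp (8 * \<bar>\<sigma> j\<bar>) * (256 * \<tau>\<^sup>2 * \<bar>\<sigma> j\<bar>)) \<longlonglongrightarrow> exp (8 * \<bar>0\<bar>) * (256 * \<tau>\<^sup>2 * \<bar>0\<bar>)"
      by (intro tendsto_intros \<sigma>0)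
    then show "(\<lambda>j. exp (8 * \<bar>\<sigma> j\<bar>) * (256 * \<tau>\<^sup>2 * \<bar>\<sigma> j\<bar>)) \<longlonglongrightarrow> 0" by simp
  qed
  have eq: "\<i> * of_real (X j) * (s j + 1 / 4 - exp (4 * s j) / 4)
      = - 2 * \<i> * (of_real (\<tau>\<^sup>2) * (1 - \<i> * of_real (\<rho> j))\<^sup>2) - \<i> * (of_real (X j) * R j) / 4" for j
    unfolding Xs2[symmetric] by (simp add: R_def field_simps)
  have "(\<lambda>j. - 2 * \<i> * (of_real (\<tau>\<^sup>2) * (1 - \<i> * of_real (\<rho> j))\<^sup>2) - \<i> * (of_real (X j) * R j) / 4)
      \<longlonglongrightarrow> - 2 * \<i> * (of_real (\<tau>\<^sup>2) * (1 - \<i> * of_real (1 / sqrt (1 + 16 * 0\<^sup>2)))\<^sup>2) - \<i> * 0 / 4"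
    by (intro tendsto_intros \<rho> XR) simp
  also have "- 2 * \<i> * (of_real (\<tau>\<^sup>2) * (1 - \<i> * of_real (1 / sqrt (1 + 16 * 0\<^sup>2)))\<^sup>2) - \<i> * 0 / 4 = of_real (- 4 * \<tau>\<^sup>2)"
    by (simp add: power2_eq_square algebra_simps)
  finally show ?thesis unfolding eq[symmetric] unfolding s_def \<sigma>_def .
qed

definition saddle_limit :: complex where
  "saddle_limit = (\<integral>\<tau>. exp (of_real (- 4 * \<tau>\<^sup>2)) * Complex 1 (- 1) \<partial>lborel)"

text \<open>Up to a positive factor and the constant 1 - i, this is the total mass of a normal
  density of variance 1/8.\<close>

lemma saddle_limit_nonzero: "saddle_limit \<noteq> 0"
proof
  assume "saddle_limit = 0"
  moreover have "saddle_limit = (\<integral>\<tau>. of_real (exp (- 4 * \<tau>\<^sup>2)) \<partial>lborel) * Complex 1 (- 1)"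
    unfolding saddle_limit_def exp_of_real by (rule integral_mult_left_zero)
  ultimately have "(\<integral>\<tau>. complex_of_real (exp (- 4 * \<tau>\<^sup>2)) \<partial>lborel) = 0" by (auto simp: complex_eq_iff)
  then have z: "(\<integral>\<tau>. exp (- 4 * \<tau>\<^sup>2) \<partial>lborel) = (0::real)" by (simp only: integral_complex_of_real of_real_eq_0_iff)
  define d where "d = 1 / sqrt (8::real)"
  have d: "d > 0" "d\<^sup>2 = 1 / 8" by (simp_all add: d_def power_divide)
  have "normal_density 0 d \<tau> = 1 / sqrt (2 * pi * d\<^sup>2) * exp (- 4 * \<tau>\<^sup>2)" for \<tau>
    unfolding normal_density_def d(2) by simp
  then have "(\<integral>\<tau>. normal_density 0 d \<tau> \<partial>lborel) = 1 / sqrt (2 * pi * d\<^sup>2) * (\<integral>\<tau>. exp (- 4 * \<tau>\<^sup>2) \<partial>lborel)"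
    by (simp only: integral_mult_right_zero)
  then show False using integral_normal_density[OF d(1), of 0] z by simp
qed

text \<open>The limit depends neither on b nor on L, because on the scale s = \<tau> / sqrt x the
  factor exp (c s) tends to 1. All dependence on n is thus left to the explicit factors, which form
  the Dirichlet series.\<close>

lemma saddle_integral_limit:
  assumes a: "a > 0" and X: "filterlim X at_top sequentially" and X1: "\<And>j. X j \<ge> 1" "\<And>j. X j \<ge> 2 * a"
    and b: "b \<longlonglongrightarrow> b'" "\<And>j. norm (b j) \<le> B" and L: "L \<ge> 0"
  shows "(\<lambda>j. of_real (sqrt (X j)) * saddle_integral a (X j) (b j + of_real (2 * a * L))) \<longlonglongrightarrow> saddle_limit"
proof -
  have "(\<lambda>j. \<integral>\<tau>. scaled_saddle a (X j) (b j + of_real (2 * a * L)) \<tau> \<partial>lborel) \<longlonglongrightarrow> saddle_limit"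
    unfolding saddle_limit_def
  proof (rule integral_dominated_convergence)
    show "integrable lborel (\<lambda>\<tau>. exp (a * L\<^sup>2 / 2) * saddle_majorant a B \<tau>)"
      by (intro integrable_mult_right saddle_majorant_integrable a)
    show "AE \<tau> in lborel. norm (scaled_saddle a (X j) (b j + of_real (2 * a * L)) \<tau>) \<le> exp (a * L\<^sup>2 / 2) * saddle_majorant a B \<tau>" for j
      by (intro AE_I2 scaled_saddle_bound a X1 b(2) L)
    show "AE \<tau> in lborel. (\<lambda>j. scaled_saddle a (X j) (b j + of_real (2 * a * L)) \<tau>) \<longlonglongrightarrow> exp (of_real (- 4 * \<tau>\<^sup>2)) * Complex 1 (- 1)"
    proof (rule AE_I2)
      fix \<tau> :: real
      define \<sigma> where "\<sigma> = (\<lambda>j. \<tau> / sqrt (X j))"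
      have inf: "filterlim (\<lambda>j. sqrt (X j)) at_infinity sequentially"
        by (rule filterlim_at_top_imp_at_infinity[OF filterlim_compose[OF sqrt_at_top X]])
      have \<sigma>0: "\<sigma> \<longlonglongrightarrow> 0" unfolding \<sigma>_def by (rule tendsto_divide_0[OF tendsto_const inf])
      have e: "(\<lambda>j. eta (\<sigma> j)) \<longlonglongrightarrow> eta 0"
        using continuous_on_tendsto_compose[OF eta_continuous[of UNIV] \<sigma>0] by simp
      have e': "(\<lambda>j. eta' (\<sigma> j)) \<longlonglongrightarrow> eta' 0"
        using continuous_on_tendsto_compose[OF eta'_continuous \<sigma>0] by simp
      have s: "(\<lambda>j. Complex (\<sigma> j) (- eta (\<sigma> j))) \<longlonglongrightarrow> Complex 0 (- eta 0)" by (intro tendsto_Complex tendsto_minus \<sigma>0 e)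
      have "(\<lambda>j. 6 * \<i> * complex_of_real (1 / X j)) \<longlonglongrightarrow> 6 * \<i> * of_real 0"
        by (intro tendsto_intros tendsto_divide_0[OF tendsto_const] filterlim_at_top_imp_at_infinity[OF X])
      then have ix: "(\<lambda>j. 6 * \<i> / complex_of_real (X j)) \<longlonglongrightarrow> 0" by simp
      have j: "(\<lambda>j. Complex 1 (- eta' (\<sigma> j))) \<longlonglongrightarrow> Complex 1 (- eta' 0)" by (intro tendsto_Complex tendsto_minus tendsto_const e')
      have ph: "(\<lambda>j. \<i> * of_real (X j) * (Complex (\<sigma> j) (- eta (\<sigma> j)) + 1 / 4 - exp (4 * Complex (\<sigma> j) (- eta (\<sigma> j))) / 4)) \<longlonglongrightarrow> of_real (- 4 * \<tau>\<^sup>2)"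
        unfolding \<sigma>_def by (rule saddle_phase_limit[OF X X1(1)])
      have "(\<lambda>j. exp (- of_real a * (Complex (\<sigma> j) (- eta (\<sigma> j)))\<^sup>2 + (b j + of_real (2 * a * L)) * Complex (\<sigma> j) (- eta (\<sigma> j))) *
          (exp (9 * Complex (\<sigma> j) (- eta (\<sigma> j))) + 6 * \<i> / of_real (X j) * exp (5 * Complex (\<sigma> j) (- eta (\<sigma> j)))) *
          exp (\<i> * of_real (X j) * (Complex (\<sigma> j) (- eta (\<sigma> j)) + 1 / 4 - exp (4 * Complex (\<sigma> j) (- eta (\<sigma> j))) / 4)) *
          Complex 1 (- eta' (\<sigma> j)))
        \<longlonglongrightarrow> exp (- of_real a * (Complex 0 (- eta 0))\<^sup>2 + (b' + of_real (2 * a * L)) * Complex 0 (- eta 0)) *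
          (exp (9 * Complex 0 (- eta 0)) + 0 * exp (5 * Complex 0 (- eta 0))) * exp (of_real (- 4 * \<tau>\<^sup>2)) * Complex 1 (- eta' 0)"
        by (intro tendsto_mult[OF tendsto_mult[OF _ tendsto_exp[OF ph]] j] tendsto_mult tendsto_add tendsto_exp tendsto_power tendsto_const s ix b(1))
      then show "(\<lambda>j. scaled_saddle a (X j) (b j + of_real (2 * a * L)) \<tau>) \<longlonglongrightarrow> exp (of_real (- 4 * \<tau>\<^sup>2)) * Complex 1 (- 1)"
        unfolding scaled_saddle_def saddle_integrand_def \<sigma>_def
        by (simp add: eta_def eta'_def complex_eq_iff Complex_eq[of 0 0])
    qed
  qed simp_all
  moreover have "X j > 0" for j using X1(1)[of j] by linarith
  ultimately show ?thesis by (simp add: saddle_integral_scaled)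
qed

section \<open>Nonreal zeros for negative parameters\<close>

lemma newman_H_holomorphic: "newman_H l holomorphic_on A"
  unfolding newman_H_cosine_transform
  using cosine_transform_holomorphic[OF gaussian_kernel_mult_exp[OF newman_Phi_gaussian_kernel]]
  by (rule holomorphic_on_subset) simp

text \<open>The n-th term carries exp (L (2 a v - i z)). The values of x and y solve 2 a v - i z = -
  2 (w + i \<zeta> / 2) - 2 i T, which reproduces the n-th term of F at w + i \<zeta> / 2 with a
  vertical shift T, and they keep the linear coefficient of the saddle integral independent of x
  apart from 2 a L.\<close>

lemma newman_H_saddle_series:
  assumes a: "a > 0" and x: "x \<ge> 1" "x = 2 * Im w + 2 * T + a * pi / 4"
  defines "v \<equiv> Complex (ln (x / (4 * pi)) / 4) (pi / 8)"
  defines "y \<equiv> - (2 * a * Re v) - 2 * Re w"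
  shows "(\<lambda>k. exp (- of_real a * v\<^sup>2 + (\<i> * of_real x - of_real y) * v + v) * (- (of_real x)\<^sup>2 / 8) * exp (- \<i> * of_real x / 4) *
      exp (\<i> * \<zeta> * v) *
      (of_real (exp (- half_log k - a * (half_log k)\<^sup>2)) * exp (- 2 * of_real (half_log k) * (w + \<i> * \<zeta> / 2)) *
       exp (- 2 * \<i> * of_real (half_log k) * of_real T) *
       saddle_integral a x (2 * of_real (Re w) + \<i> * \<zeta> - \<i> * of_real (a * pi / 4) + of_real (2 * a * half_log k))))
    sums (2 * newman_H (- a) (of_real x + \<i> * of_real y + \<zeta>))"
proof -
  define z where "z = of_real x + \<i> * of_real y + \<zeta>"
  have "(\<lambda>k. of_real (exp (- half_log k) * exp (- a * (half_log k)\<^sup>2)) * exp (- \<i> * z * of_real (half_log k)) *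
      phi_transform a (z - 2 * \<i> * of_real (a * half_log k))) sums (2 * newman_H (- a) z)"
  proof (rule newman_H_series)
    show "integrable lborel (\<lambda>v. \<bar>newman_phi v\<bar> * exp (a * v * \<bar>v\<bar>) * exp (- Im z * v))" by (rule newman_phi_integrable[OF a])
    have "exp (- half_log k) * exp (Im z * half_log k - a * (half_log k)\<^sup>2 / 2) = exp ((Im z - 1) * half_log k - a / 2 * (half_log k)\<^sup>2)" for k
      by (simp add: algebra_simps flip: exp_add)
    then show "summable (\<lambda>k. exp (- half_log k) * exp (Im z * half_log k - a * (half_log k)\<^sup>2 / 2))"
      using summable_half_log_gaussian[of "a / 2" "Im z - 1"] a by simp
  qed (use a in simp)
  moreover have "of_real (exp (- half_log k) * exp (- a * (half_log k)\<^sup>2)) * exp (- \<i> * z * of_real (half_log k)) *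
      phi_transform a (z - 2 * \<i> * of_real (a * half_log k)) =
      exp (- of_real a * v\<^sup>2 + (\<i> * of_real x - of_real y) * v + v) * (- (of_real x)\<^sup>2 / 8) * exp (- \<i> * of_real x / 4) *
      exp (\<i> * \<zeta> * v) *
      (of_real (exp (- half_log k - a * (half_log k)\<^sup>2)) * exp (- 2 * of_real (half_log k) * (w + \<i> * \<zeta> / 2)) *
       exp (- 2 * \<i> * of_real (half_log k) * of_real T) *
       saddle_integral a x (2 * of_real (Re w) + \<i> * \<zeta> - \<i> * of_real (a * pi / 4) + of_real (2 * a * half_log k)))" for k
  proof -
    define L where "L = half_log k"
    define u where "u = \<i> * of_real y + \<zeta> - 2 * \<i> * of_real (a * L)"
    define S where "S = saddle_integral a x (\<i> * u - 2 * of_real a * v)"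
    have z: "z - 2 * \<i> * of_real (a * L) = of_real x + u" by (simp add: z_def u_def)
    have "Im v = pi / 8" by (simp add: v_def)
    then have c: "\<i> * u - 2 * of_real a * v = 2 * of_real (Re w) + \<i> * \<zeta> - \<i> * of_real (a * pi / 4) + of_real (2 * a * L)"
      by (simp add: u_def y_def complex_eq_iff algebra_simps)
    have "phi_transform a (of_real x + u) = exp (- of_real a * v\<^sup>2 + (\<i> * of_real x + \<i> * u) * v + v) *
        (- (of_real x)\<^sup>2 / 8) * exp (- \<i> * of_real x / 4) * S"
      unfolding v_def S_def by (rule phi_transform_saddle[OF a x(1)])
    then have "of_real (exp (- L) * exp (- a * L\<^sup>2)) * exp (- \<i> * z * of_real L) * phi_transform a (z - 2 * \<i> * of_real (a * L)) =
        of_real (exp (- L - a * L\<^sup>2)) * (- (of_real x)\<^sup>2 / 8) * exp (- \<i> * of_real x / 4) * S *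
        exp (- \<i> * z * of_real L + (- of_real a * v\<^sup>2 + (\<i> * of_real x + \<i> * u) * v + v))"
      unfolding z exp_add[of "- \<i> * z * of_real L"] exp_add[symmetric, of "- L"] by (simp add: mult_ac)
    also have "- \<i> * z * of_real L + (- of_real a * v\<^sup>2 + (\<i> * of_real x + \<i> * u) * v + v) =
        (- of_real a * v\<^sup>2 + (\<i> * of_real x - of_real y) * v + v) + \<i> * \<zeta> * v + - 2 * of_real L * (w + \<i> * \<zeta> / 2) + - 2 * \<i> * of_real L * of_real T"
    proof -
      have iu: "\<i> * u = - of_real y + \<i> * \<zeta> + 2 * of_real a * of_real L" by (simp add: u_def algebra_simps)
      have "- \<i> * z = - 2 * (w + \<i> * \<zeta> / 2) - 2 * \<i> * of_real T - 2 * of_real a * v"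
        using x(2) \<open>Im v = pi / 8\<close> by (simp add: z_def y_def complex_eq_iff algebra_simps)
      then show ?thesis unfolding iu by (simp only:) (simp add: algebra_simps)
    qed
    finally show ?thesis unfolding exp_add S_def c L_def by (simp only: mult_ac)
  qed
  ultimately show ?thesis by (simp only: z_def)
qed

text \<open>\<open>G k\<close> is \<open>newman_H (- a)\<close> on the unit disc around x k + i y k,
  divided by nonvanishing factors. It converges locally uniformly to \<open>g\<close>, which
  vanishes at 0. These discs lie below the real axis, so if all zeros were real, every
  \<open>G k\<close> would be zero-free and Hurwitz's theorem would be violated.\<close>

lemma newman_H_neg_nonreal_zero:
  assumes a: "a > 0"
  shows "\<exists>z. newman_H (- a) z = 0 \<and> z \<notin> \<real>"
proof (rule ccontr)
  assume "\<not> ?thesis"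
  then have real: "z \<in> \<real>" if "newman_H (- a) z = 0" for z using that by blast
  obtain w where w: "dobner_series a w = 0" using dobner_series_zero[OF a] by blast
  \<comment> \<open>For x >= q one has a ln (x / (4 pi)) >= 4 + 4 |w|, and therefore y <= - 2, so
    that the unit disc around x + i y avoids the real axis.\<close>
  define q where "q = 4 * pi * exp ((4 + 4 * norm w) / a)"
  have q: "q > 0" by (simp add: q_def)
  \<comment> \<open>The lower bound on T makes x k at least 1 + 2 a + q + k, which meets all size
    requirements of the saddle estimates at once.\<close>
  obtain T :: "nat \<Rightarrow> real" where T: "\<And>k. T k \<ge> (norm w + 1 + 2 * a + q) + real k"
    "\<And>n. (\<lambda>k. exp (- 2 * \<i> * of_real (half_log n) * of_real (T k))) \<longlonglongrightarrow> 1"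
    using half_log_almost_periods by blast
  define x where "x = (\<lambda>k. 2 * Im w + 2 * T k + a * pi / 4)"
  have x_ge: "x k \<ge> 1 + 2 * a + q + real k" for k
  proof -
    have "a * pi / 4 \<ge> 0" using a by simp
    then show ?thesis using T(1)[of k] abs_Im_le_cmod[of w] q a unfolding x_def by linarith
  qed
  have x: "x k \<ge> 1" "x k \<ge> 2 * a" "x k \<ge> q" for k using x_ge[of k] a q by linarith+
  have x_top: "filterlim x at_top sequentially"
  proof (rule filterlim_at_top_mono[OF filterlim_real_sequentially], intro always_eventually allI)
    show "real k \<le> x k" for k using x_ge[of k] a q by linarith
  qed
  define v where "v = (\<lambda>k. Complex (ln (x k / (4 * pi)) / 4) (pi / 8))"
  define y where "y = (\<lambda>k. - (2 * a * Re (v k)) - 2 * Re w)"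
  have y: "y k \<le> - 2" for k
  proof -
    have "exp ((4 + 4 * norm w) / a) \<le> x k / (4 * pi)" using x(3)[of k] by (simp add: q_def field_simps)
    then have "(4 + 4 * norm w) / a \<le> ln (x k / (4 * pi))" using x(1)[of k] by (subst ln_ge_iff) auto
    then have "4 + 4 * norm w \<le> a * ln (x k / (4 * pi))" using a by (simp add: field_simps)
    then show ?thesis using abs_Re_le_cmod[of w] by (simp add: y_def v_def)
  qed
  define K where "K = (\<lambda>k. exp (- of_real a * (v k)\<^sup>2 + (\<i> * of_real (x k) - of_real (y k)) * v k + v k) *
      (- (of_real (x k))\<^sup>2 / 8) * exp (- \<i> * of_real (x k) / 4))"
  have K: "K k \<noteq> 0" for k using x(1)[of k] by (simp add: K_def)
  define b where "b = (\<lambda>\<zeta>. 2 * of_real (Re w) + \<i> * \<zeta> - \<i> * of_real (a * pi / 4))"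
  define B where "B = 2 * norm w + 1 + a * pi / 4"
  have b: "norm (b \<zeta>) \<le> B" if "norm \<zeta> \<le> 1" for \<zeta>
  proof -
    have "norm (b \<zeta>) \<le> norm (2 * complex_of_real (Re w)) + norm (\<i> * \<zeta>) + norm (\<i> * of_real (a * pi / 4))"
      unfolding b_def by (intro order_trans[OF norm_triangle_ineq4] add_mono norm_triangle_ineq order_refl)
    also have "\<dots> \<le> B" using that a abs_Re_le_cmod[of w] by (simp add: B_def norm_mult)
    finally show ?thesis .
  qed
  define f where "f = (\<lambda>k \<zeta> n. of_real (exp (- half_log n - a * (half_log n)\<^sup>2)) * exp (- 2 * of_real (half_log n) * (w + \<i> * \<zeta> / 2)) *
      exp (- 2 * \<i> * of_real (half_log n) * of_real (T k)) *
      (of_real (sqrt (x k)) * saddle_integral a (x k) (b \<zeta> + of_real (2 * a * half_log n))))"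
  define G where "G = (\<lambda>k \<zeta>. 2 * newman_H (- a) (of_real (x k) + \<i> * of_real (y k) + \<zeta>) * of_real (sqrt (x k)) / (K k * exp (\<i> * \<zeta> * v k)))"
  define g where "g = (\<lambda>\<zeta>. saddle_limit * dobner_series a (w + \<i> * \<zeta> / 2))"
  have G_sums: "f k \<zeta> sums G k \<zeta>" for k \<zeta>
  proof -
    have "(\<lambda>n. (of_real (sqrt (x k)) / (K k * exp (\<i> * \<zeta> * v k))) * (K k * exp (\<i> * \<zeta> * v k) *
      (of_real (exp (- half_log n - a * (half_log n)\<^sup>2)) * exp (- 2 * of_real (half_log n) * (w + \<i> * \<zeta> / 2)) *
       exp (- 2 * \<i> * of_real (half_log n) * of_real (T k)) * saddle_integral a (x k) (b \<zeta> + of_real (2 * a * half_log n)))))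
      sums (of_real (sqrt (x k)) / (K k * exp (\<i> * \<zeta> * v k)) * (2 * newman_H (- a) (of_real (x k) + \<i> * of_real (y k) + \<zeta>)))"
      unfolding K_def b_def v_def y_def by (rule sums_mult[OF newman_H_saddle_series[OF a x(1)]]) (simp only: x_def)
    then show ?thesis using K[of k] by (simp add: G_def f_def mult_ac)
  qed
  \<comment> \<open>The weight exp (- a L^2) of the series times the loss exp (a L^2 / 2) of the
    saddle bound leaves exp (- a L^2 / 2), still summable.\<close>
  define M where "M = (\<lambda>n. exp ((2 * norm w) * half_log n - a / 2 * (half_log n)\<^sup>2) * (\<integral>\<tau>. saddle_majorant a B \<tau> \<partial>lborel))"
  have f_bound: "norm (f k \<zeta> n) \<le> M n" if \<zeta>: "norm \<zeta> \<le> 1" for k \<zeta> n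
  proof -
    define L where "L = half_log n"
    have L: "L \<ge> 0" by (simp add: L_def half_log_nonneg)
    have "norm (w + \<i> * \<zeta> / 2) \<le> norm w + 1 / 2"
      using norm_triangle_ineq[of w "\<i> * \<zeta> / 2"] \<zeta> by (simp add: norm_mult norm_divide)
    then have "2 * norm (w + \<i> * \<zeta> / 2) - 1 \<le> 2 * norm w" by simp
    then have "(2 * norm (w + \<i> * \<zeta> / 2) - 1) * L \<le> 2 * norm w * L" using L by (rule mult_right_mono)
    then have "norm (of_real (exp (- L - a * L\<^sup>2)) * exp (- 2 * of_real L * (w + \<i> * \<zeta> / 2))) \<le> exp (2 * norm w * L - a * L\<^sup>2)"
      using dobner_series_norm_term[of n a "w + \<i> * \<zeta> / 2"] unfolding L_def by (simp add: order_trans)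
    moreover have "norm (exp (- 2 * \<i> * of_real L * of_real (T k))) = 1" by simp
    moreover have "norm (of_real (sqrt (x k)) * saddle_integral a (x k) (b \<zeta> + of_real (2 * a * L))) \<le> exp (a * L\<^sup>2 / 2) * (\<integral>\<tau>. saddle_majorant a B \<tau> \<partial>lborel)"
      by (rule saddle_integral_bound[OF a x(1,2) b[OF \<zeta>] L])
    ultimately have "norm (f k \<zeta> n) \<le> exp (2 * norm w * L - a * L\<^sup>2) * 1 * (exp (a * L\<^sup>2 / 2) * (\<integral>\<tau>. saddle_majorant a B \<tau> \<partial>lborel))"
      unfolding f_def L_def[symmetric] norm_mult[of _ "of_real (sqrt (x k)) * _"] norm_mult[of _ "exp (- 2 * \<i> * _ * _)"]
      by (intro mult_mono) auto
    also have "\<dots> = M n"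
      unfolding M_def L_def[symmetric] mult_1_right mult.assoc[symmetric] exp_add[symmetric] by (simp add: field_simps)
    finally show ?thesis .
  qed
  have M: "summable M" unfolding M_def using a by (intro summable_mult2 summable_half_log_gaussian) simp
  \<comment> \<open>Both the index and the argument move, as
    \<open>uniform_limit_of_continuous_convergence\<close> demands; Tannery's theorem with the
    majorant M exchanges limit and sum.\<close>
  have limit: "(\<lambda>j. G (\<kappa> j) (\<zeta> j)) \<longlonglongrightarrow> g \<zeta>'"
    if \<kappa>: "filterlim \<kappa> sequentially sequentially" and \<zeta>: "\<And>j. norm (\<zeta> j) \<le> 1" "\<zeta> \<longlonglongrightarrow> \<zeta>'" for \<kappa> :: "nat \<Rightarrow> nat" and \<zeta> \<zeta>'
  proof -
    define c where "c = (\<lambda>n. of_real (exp (- half_log n - a * (half_log n)\<^sup>2)) * exp (- 2 * of_real (half_log n) * (w + \<i> * \<zeta>' / 2)))"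
    have bl: "(\<lambda>j. b (\<zeta> j)) \<longlonglongrightarrow> b \<zeta>'" unfolding b_def by (intro tendsto_intros \<zeta>(2))
    have "(\<lambda>j. f (\<kappa> j) (\<zeta> j) n) \<longlonglongrightarrow> c n * 1 * saddle_limit" for n
      unfolding f_def c_def
    proof (intro tendsto_mult)
      show "(\<lambda>j. exp (- 2 * \<i> * of_real (half_log n) * of_real (T (\<kappa> j)))) \<longlonglongrightarrow> 1"
        by (rule filterlim_compose[OF T(2) \<kappa>])
      show "(\<lambda>j. exp (- 2 * of_real (half_log n) * (w + \<i> * \<zeta> j / 2))) \<longlonglongrightarrow> exp (- 2 * of_real (half_log n) * (w + \<i> * \<zeta>' / 2))"
        by (intro tendsto_intros \<zeta>(2)) simp
      show "(\<lambda>j. of_real (sqrt (x (\<kappa> j))) * saddle_integral a (x (\<kappa> j)) (b (\<zeta> j) + of_real (2 * a * half_log n))) \<longlonglongrightarrow> saddle_limit"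
        by (rule saddle_integral_limit[OF a filterlim_compose[OF x_top \<kappa>] x(1,2) bl b[OF \<zeta>(1)] half_log_nonneg])
    qed (rule tendsto_const)
    then have "(\<lambda>j. \<Sum>n. f (\<kappa> j) (\<zeta> j) n) \<longlonglongrightarrow> (\<Sum>n. c n * 1 * saddle_limit)"
      using tannerys_theorem[of "\<lambda>n j. f (\<kappa> j) (\<zeta> j) n" "\<lambda>n. c n * 1 * saddle_limit" sequentially M] f_bound[OF \<zeta>(1)] M
      by (simp add: always_eventually)
    moreover have "summable c" unfolding c_def by (rule summable_norm_cancel[OF dobner_series_summable[OF a]])
    then have "(\<Sum>n. c n * 1 * saddle_limit) = g \<zeta>'"
      unfolding g_def dobner_series_def c_def[symmetric] by (simp add: suminf_mult mult.commute[of _ saddle_limit])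
    moreover have "(\<Sum>n. f (\<kappa> j) (\<zeta> j) n) = G (\<kappa> j) (\<zeta> j)" for j using G_sums sums_unique by metis
    ultimately show ?thesis by simp
  qed
  have "(\<lambda>\<zeta>. dobner_series a (w + \<i> * \<zeta> / 2)) holomorphic_on S" for S
    by (rule holomorphic_on_compose_gen[OF _ dobner_series_holomorphic[OF a, of UNIV], unfolded o_def, of "\<lambda>\<zeta>. w + \<i> * \<zeta> / 2"])
       (auto intro!: holomorphic_intros)
  then have hol_g: "g holomorphic_on S" for S unfolding g_def by (intro holomorphic_intros)
  have "g 0 \<noteq> 0"
  proof (rule Hurwitz_no_zeros[of "ball 0 1" G g])
    show "G k holomorphic_on ball 0 1" for k
    proof -
      have "(\<lambda>\<zeta>. newman_H (- a) (of_real (x k) + \<i> * of_real (y k) + \<zeta>)) holomorphic_on ball 0 1"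
        by (rule holomorphic_on_compose_gen[OF _ newman_H_holomorphic[of _ UNIV], unfolded o_def, of "\<lambda>\<zeta>. of_real (x k) + \<i> * of_real (y k) + \<zeta>"])
           (auto intro!: holomorphic_intros)
      then show ?thesis unfolding G_def using K by (intro holomorphic_intros) auto
    qed
    show "G k \<zeta> \<noteq> 0" if "\<zeta> \<in> ball 0 1" for k \<zeta>
    proof
      assume "G k \<zeta> = 0"
      then have "newman_H (- a) (of_real (x k) + \<i> * of_real (y k) + \<zeta>) = 0" using K[of k] x(1)[of k] by (simp add: G_def)
      then have "y k + Im \<zeta> = 0" using real by (fastforce simp: complex_is_Real_iff)
      then show False using y[of k] abs_Im_le_cmod[of \<zeta>] that by simp
    qed
    show "uniform_limit S G g sequentially" if S: "compact S" "S \<subseteq> ball 0 1" for S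
    proof (rule uniform_limit_of_continuous_convergence[OF S(1) holomorphic_on_imp_continuous_on[OF hol_g]])
      fix \<kappa> :: "nat \<Rightarrow> nat" and \<zeta> \<zeta>'
      assume "filterlim \<kappa> sequentially sequentially" and \<zeta>: "\<And>j. \<zeta> j \<in> S" and "\<zeta> \<longlonglongrightarrow> \<zeta>'"
      moreover have "norm (\<zeta> j) \<le> 1" for j using \<zeta>[of j] S(2) by (auto simp: less_imp_le)
      ultimately show "(\<lambda>j. G (\<kappa> j) (\<zeta> j)) \<longlonglongrightarrow> g \<zeta>'" by (intro limit)
    qed
    show "\<not> g constant_on ball 0 1"
    proof
      assume "g constant_on ball 0 1"
      then obtain c where c: "\<And>\<zeta>. \<zeta> \<in> ball 0 1 \<Longrightarrow> g \<zeta> = c" unfolding constant_on_def by blast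
      then have "dobner_series a (w + \<i> * \<zeta> / 2) = c / saddle_limit" if "\<zeta> \<in> ball 0 1" for \<zeta>
        using saddle_limit_nonzero c[OF that] unfolding g_def by (subst eq_divide_eq) (simp add: mult.commute)
      then show False using dobner_series_nonconstant[OF a w] unfolding constant_on_def by blast
    qed
  qed (use hol_g in auto)
  then show False using w by (simp add: g_def)
qed

lemma newman_H_real_zeros_iff:
  assumes "riemann_hypothesis"
  shows "(\<forall>z. newman_H l z = 0 \<longrightarrow> z \<in> \<real>) \<longleftrightarrow> 0 \<le> l"
proof (cases "0 \<le> l")
  case True
  then show ?thesis using newman_H_real_zeros_mono[OF newman_H_0_real_zeros[OF assms]] by blast
next
  case False
  then show ?thesis using newman_H_neg_nonreal_zero[of "- l"] by auto
qed

theorem theorem2: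
  fixes \<gamma> u \<alpha> :: "nat \<Rightarrow> real"
  assumes "riemann_hypothesis"
    and "zeta_deriv_recip_bound"
    and "strict_mono_on {1..} \<gamma>" and "\<gamma> ` {1..} = hardy_Z_pos_zeros"
    and "\<And>n. n \<ge> 1 \<Longrightarrow> u n \<in> {\<gamma> n<..<\<gamma> (n + 1)} \<and> deriv hardy_Z (of_real (u n)) = 0"
    and "\<And>n. n \<ge> 1 \<Longrightarrow> \<alpha> n = (u n - \<gamma> n) / (\<gamma> (n + 1) - \<gamma> n)"
    and "infinite {n. n \<ge> 2 \<and>
           \<gamma> (n + 1) - \<gamma> n < 1 / ln (\<gamma> n) \<and>
           \<not> {u (n - 1), u (n + 1)} \<subseteq> loglog_interval (\<gamma> n) \<union> loglog_interval (\<gamma> (n + 1)) \<and>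
           \<alpha> n \<in> {0.44..0.56}}"
  shows "de_bruijn_newman = 0"
  unfolding de_bruijn_newman_def newman_H_real_zeros_iff[OF assms(1)]
proof (rule the_equality)
  \<comment> \<open>Testing at l = 0 gives L <= 0, and at l = L gives 0 <= L.\<close>
  show "L = 0" if "\<forall>l. (0 \<le> l) = (L \<le> l)" for L :: real
    using that[rule_format, of 0] that[rule_format, of L] by simp
qed simp

end
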